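(* Let $\hat\Gamma=\arg\max_{\Gamma\in\mathcal{F}_s}\mathcal{D}_{\mathcal{U}_s}(\Gamma,\{X_i\}_{i=1}^n)$. Assume $\epsilon<\tau/3$ and that the distribution $P_\Gamma=EC(0,\Gamma,\eta)$ satisfies the marginal condition with parameters $\tau,\alpha,\kappa$. Then, there exist absolute constants $C,C_1>0$, such that for any $\delta\in(0,1/2)$ satisfying $C_1\frac{s\log\frac{ep}{s}+\log(1/\delta)}{n}<1$, we have $$\|\hat\Gamma-\Gamma\|_{\rm op}^2\le C\kappa\left(\left(\frac{s\log\frac{ep}{s}}{n}\vee\epsilon^2\right)+\frac{\log(1/\delta)}{n}\right),$$ with $\mathbb{P}_{(\epsilon,\Gamma,Q)}$-probability at least $1-2\delta$ uniformly over all probability distributions $Q$ on $\mathbb{R}^p$ and all $\Gamma\in\mathcal{F}_s(M)$.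
   Context: Elliptical distributions: $X\sim EC(0,\Sigma,\xi)$ on $\mathbb{R}^p$ means $X=\xi AU$, where $A\in\mathbb{R}^{p\times r}$ is deterministic, $\Sigma=AA^T$, $U$ is uniform on the unit sphere of $\mathbb{R}^r$, and $\xi\ge0$ is a real random variable independent of $U$. If $s_{\min}(\Sigma)>0$ (non-degenerate), the law of $u^TX/\sqrt{u^T\Sigma u}$ does not depend on $u\in S^{p-1}=\{u\in\mathbb{R}^p:\|u\|=1\}$. For a non-degenerate $EC(0,\Sigma,\xi)$, $EC(0,\Gamma,\eta)$ is its canonical representation if and only if $\Gamma=a^{-2}\Sigma$ and $\eta=a\xi$ for some $a>0$, and $P_\Gamma\left(\frac{|u^TX|^2}{u^T\Gamma u}\le1\right)=\frac12$, where $P_\Gamma=EC(0,\Gamma,\eta)$; $\Gamma$ is called the scatter matrix. The notation $P_\Gamma=EC(0,\Gamma,\eta)$ always denotes the canonical representation. Marginal condition with parameters $\tau,\alpha,\kappa$: with $G(t)=P_\Gamma\left(\frac{|u^TX|^2}{u^T\Gamma u}\le t\right)$ (which does not depend on $u\in S^{p-1}$), $G$ is continuous at $t=1$, and for some $\tau\in(0,1/2)$ and $\alpha,\kappa>0$, $$\inf_{|t|\ge\alpha}|G(1)-G(1+t)|\ge\tau\quad\text{and}\quad\inf_{0<|t|<\alpha}\frac{|G(1)-G(1+t)|}{|t|}\ge\kappa^{-1/2}.$$ Contamination model: $\mathbb{P}_{(\epsilon,\Gamma,Q)}=(1-\epsilon)P_\Gamma+\epsilon Q$ with $Q$ an arbitrary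 probability distribution; $X_1,\dots,X_n$ are i.i.d. from it, and the same symbol denotes their joint law. Classes: for $S\subset[p]=\{1,\dots,p\}$, $\mathcal{G}(S)=\{G=(g_{ij})\in\mathbb{R}^{p\times p}:g_{ij}=0\text{ if }i\notin S\text{ or }j\notin S\}$; $\mathcal{G}(s)=\bigcup_{S\subset[p]:|S|\le s}\mathcal{G}(S)$; $\mathcal{F}_s=\{\Gamma\succeq0:\Gamma-\mathrm{diag}(\Gamma)\in\mathcal{G}(s)\}$ with $\mathrm{diag}(\Gamma)$ the diagonal part of $\Gamma$; $\mathcal{F}_s(M)=\{\Gamma\in\mathcal{F}_s:s_{\max}(\Gamma)\le M\}$, where $M>0$ is an absolute constant that does not scale with $p$ or $n$; $s_{\max},s_{\min}$ are the largest and smallest singular values. Directions: $\mathcal{V}_S=\{u=(u_i)\in S^{p-1}:u_i=0\text{ if }i\notin S\}$ and $\mathcal{U}_s=\bigcup_{S\subset[p]:|S|=2s}\mathcal{V}_S$. Empirical matrix depth relative to $\mathcal{U}\subset S^{p-1}$: $$\mathcal{D}_{\mathcal{U}}(\Gamma,\{X_i\}_{i=1}^n)=\min_{u\in\mathcal{U}}\min\left\{\frac1n\sum_{i=1}^n\mathbb{I}\{|u^TX_i|^2\le u^T\Gamma u\},\ \frac1n\sum_{i=1}^n\mathbb{I}\{|u^TX_i|^2\ge u^T\Gamma u\}\right\}.$$ $\|\cdot\|_{\rm op}$ is the operator norm; $a\vee b=\max(a,b)$.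
   Formalization: The constant C_1 in the sample-size condition may depend on τ (C depends only on M): with C_1 independent of τ the claim fails for two-scale radial laws with τ→0. Also 1≤s and 2s≤p are stated, so that U_s is nonempty and the bound is defined. *)

theory Defs
  imports "HOL-Probability.Probability"
begin

text \<open>
  The dimension is a variable of the statement (the constants must not depend on it), so a vector
  of dimension \<open>p\<close> is a function \<open>nat \<Rightarrow> real\<close> read on the indices \<open>{..<p}\<close> and a matrix is a
  function \<open>nat \<Rightarrow> nat \<Rightarrow> real\<close> read on \<open>{..<p} \<times> {..<p}\<close>; the coordinates are numbered from 0.
  Random vectors take values in the extensional functions on \<open>{..<p}\<close>.
\<close>

abbreviation borel_vec :: "nat \<Rightarrow> (nat \<Rightarrow> real) measure" where
  "borel_vec p \<equiv> PiM {..<p} (\<lambda>_. borel)"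

definition dot :: "nat \<Rightarrow> (nat \<Rightarrow> real) \<Rightarrow> (nat \<Rightarrow> real) \<Rightarrow> real" where
  "dot p u x = (\<Sum>i<p. u i * x i)"

definition quad :: "nat \<Rightarrow> (nat \<Rightarrow> nat \<Rightarrow> real) \<Rightarrow> (nat \<Rightarrow> real) \<Rightarrow> real" where
  "quad p G u = (\<Sum>i<p. \<Sum>j<p. u i * G i j * u j)"

definition unit_sphere :: "nat \<Rightarrow> (nat \<Rightarrow> real) set" where
  "unit_sphere p = {u \<in> {..<p} \<rightarrow>\<^sub>E UNIV. L2_set u {..<p} = 1}"

definition op_norm :: "nat \<Rightarrow> (nat \<Rightarrow> nat \<Rightarrow> real) \<Rightarrow> real" where
  "op_norm p A = (SUP u\<in>unit_sphere p. L2_set (\<lambda>i. \<Sum>j<p. A i j * u j) {..<p})"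

text \<open>
  The nonnegative square roots of the eigenvalues of \<open>A\<^sup>T A\<close>. For \<open>p \<ge> 1\<close> this set is finite and
  nonempty, so its supremum and infimum are the largest and smallest singular value.
\<close>

definition singular_values :: "nat \<Rightarrow> (nat \<Rightarrow> nat \<Rightarrow> real) \<Rightarrow> real set" where
  "singular_values p A =
     {\<sigma>. 0 \<le> \<sigma> \<and> (\<exists>v\<in>unit_sphere p.
        \<forall>i<p. (\<Sum>k<p. A k i * (\<Sum>j<p. A k j * v j)) = \<sigma>\<^sup>2 * v i)}"

definition smax :: "nat \<Rightarrow> (nat \<Rightarrow> nat \<Rightarrow> real) \<Rightarrow> real" where
  "smax p A = Sup (singular_values p A)"

definition smin :: "nat \<Rightarrow> (nat \<Rightarrow> nat \<Rightarrow> real) \<Rightarrow> real" where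
  "smin p A = Inf (singular_values p A)"

definition psd :: "nat \<Rightarrow> (nat \<Rightarrow> nat \<Rightarrow> real) \<Rightarrow> bool" where
  "psd p G \<longleftrightarrow> (\<forall>i<p. \<forall>j<p. G i j = G j i) \<and> (\<forall>u. 0 \<le> quad p G u)"

subsection \<open>Elliptical distributions\<close>

text \<open>
  Normalised surface (cone) measure of the unit sphere of dimension \<open>r \<ge> 1\<close>: the law of
  \<open>Z / \<parallel>Z\<parallel>\<close> for \<open>Z\<close> uniform on the unit ball.
\<close>

definition uniform_sphere :: "nat \<Rightarrow> (nat \<Rightarrow> real) measure" where
  "uniform_sphere r =
     distr (uniform_measure (PiM {..<r} (\<lambda>_. lborel))
              {z \<in> space (PiM {..<r} (\<lambda>_. lborel)). L2_set z {..<r} \<le> 1})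
       (borel_vec r) (\<lambda>z. \<lambda>i\<in>{..<r}. z i / L2_set z {..<r})"

text \<open>
  \<open>elliptical p P \<Sigma> \<xi>\<close> says that \<open>P\<close> is the law of \<open>X = \<xi> A U\<close>. The argument \<open>\<xi>\<close> is the law of the
  radial variable; independence of \<open>\<xi>\<close> and \<open>U\<close> is expressed by the product measure.
\<close>

definition elliptical ::
  "nat \<Rightarrow> (nat \<Rightarrow> real) measure \<Rightarrow> (nat \<Rightarrow> nat \<Rightarrow> real) \<Rightarrow> real measure \<Rightarrow> bool" where
  "elliptical p P \<Sigma> \<xi> \<longleftrightarrow>
     prob_space \<xi> \<and> sets \<xi> = sets borel \<and> (AE x in \<xi>. 0 \<le> x) \<and>
     (\<exists>r A. 1 \<le> r \<and> (\<forall>i<p. \<forall>j<p. \<Sigma> i j = (\<Sum>k<r. A i k * A j k)) \<and>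
        P = distr (\<xi> \<Otimes>\<^sub>M uniform_sphere r) (borel_vec p)
              (\<lambda>(x, U). \<lambda>i\<in>{..<p}. x * (\<Sum>k<r. A i k * U k)))"

definition proj_cdf ::
  "nat \<Rightarrow> (nat \<Rightarrow> real) measure \<Rightarrow> (nat \<Rightarrow> nat \<Rightarrow> real) \<Rightarrow> (nat \<Rightarrow> real) \<Rightarrow> real \<Rightarrow> real" where
  "proj_cdf p P \<Gamma> u t = measure P {x \<in> space P. \<bar>dot p u x\<bar>\<^sup>2 / quad p \<Gamma> u \<le> t}"

text \<open>
  \<open>P\<close> is a non-degenerate \<open>EC(0, \<Sigma>, \<xi>)\<close> with canonical representation \<open>EC(0, \<Gamma>, \<eta>)\<close>.
  The value of \<^const>\<open>proj_cdf\<close> does not depend on the direction \<open>u\<close>.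
\<close>

definition canonical_representation_of ::
  "nat \<Rightarrow> (nat \<Rightarrow> real) measure \<Rightarrow> (nat \<Rightarrow> nat \<Rightarrow> real) \<Rightarrow> real measure
     \<Rightarrow> (nat \<Rightarrow> nat \<Rightarrow> real) \<Rightarrow> real measure \<Rightarrow> bool" where
  "canonical_representation_of p P \<Sigma> \<xi> \<Gamma> \<eta> \<longleftrightarrow>
     elliptical p P \<Sigma> \<xi> \<and> 0 < smin p \<Sigma> \<and>
     (\<exists>a>0. (\<forall>i<p. \<forall>j<p. \<Gamma> i j = \<Sigma> i j / a\<^sup>2) \<and> \<eta> = distr \<xi> borel (\<lambda>x. a * x)) \<and>
     (\<forall>u\<in>unit_sphere p. proj_cdf p P \<Gamma> u 1 = 1 / 2)"

definition canonical_elliptical ::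
  "nat \<Rightarrow> (nat \<Rightarrow> real) measure \<Rightarrow> (nat \<Rightarrow> nat \<Rightarrow> real) \<Rightarrow> real measure \<Rightarrow> bool" where
  "canonical_elliptical p P \<Gamma> \<eta> \<longleftrightarrow>
     elliptical p P \<Gamma> \<eta> \<and> (\<exists>\<Sigma> \<xi>. canonical_representation_of p P \<Sigma> \<xi> \<Gamma> \<eta>)"

definition marginal_condition ::
  "nat \<Rightarrow> (nat \<Rightarrow> real) measure \<Rightarrow> (nat \<Rightarrow> nat \<Rightarrow> real) \<Rightarrow> real \<Rightarrow> real \<Rightarrow> real \<Rightarrow> bool" where
  "marginal_condition p P \<Gamma> \<tau> \<alpha> \<kappa> \<longleftrightarrow>
     0 < \<tau> \<and> \<tau> < 1 / 2 \<and> 0 < \<alpha> \<and> 0 < \<kappa> \<and>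
     (\<forall>u\<in>unit_sphere p. let G = proj_cdf p P \<Gamma> u in
        isCont G 1 \<and>
        (INF t\<in>{t. \<alpha> \<le> \<bar>t\<bar>}. \<bar>G 1 - G (1 + t)\<bar>) \<ge> \<tau> \<and>
        (INF t\<in>{t. 0 < \<bar>t\<bar> \<and> \<bar>t\<bar> < \<alpha>}. \<bar>G 1 - G (1 + t)\<bar> / \<bar>t\<bar>) \<ge> \<kappa> powr (- 1 / 2))"

subsection \<open>Contamination model\<close>

definition contaminated ::
  "real \<Rightarrow> (nat \<Rightarrow> real) measure \<Rightarrow> (nat \<Rightarrow> real) measure \<Rightarrow> (nat \<Rightarrow> real) measure" where
  "contaminated \<epsilon> P Q =
     measure_of (space P) (sets P)
       (\<lambda>B. ennreal (1 - \<epsilon>) * emeasure P B + ennreal \<epsilon> * emeasure Q B)"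

lemma emeasure_contaminated:
  assumes "sets Q = sets P" "B \<in> sets P"
  shows "emeasure (contaminated \<epsilon> P Q) B
           = ennreal (1 - \<epsilon>) * emeasure P B + ennreal \<epsilon> * emeasure Q B"
  unfolding contaminated_def
proof (rule emeasure_measure_of_sigma)
  show "sigma_algebra (space P) (sets P)" ..
  show "positive (sets P) (\<lambda>B. ennreal (1 - \<epsilon>) * emeasure P B + ennreal \<epsilon> * emeasure Q B)"
    by (simp add: positive_def)
  show "countably_additive (sets P)
          (\<lambda>B. ennreal (1 - \<epsilon>) * emeasure P B + ennreal \<epsilon> * emeasure Q B)"
    using assms(1)
    by (auto intro!: countably_additiveI
        simp: suminf_add[symmetric] suminf_emeasure ennreal_suminf_cmult)
qed (fact assms(2))

subsection \<open>Matrix classes, directions and depth\<close>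

definition supported_on :: "nat \<Rightarrow> nat set \<Rightarrow> (nat \<Rightarrow> nat \<Rightarrow> real) set" where
  "supported_on p S = {G. \<forall>i<p. \<forall>j<p. i \<notin> S \<or> j \<notin> S \<longrightarrow> G i j = 0}"

definition sparse_matrices :: "nat \<Rightarrow> nat \<Rightarrow> (nat \<Rightarrow> nat \<Rightarrow> real) set" where
  "sparse_matrices p s = (\<Union>S\<in>{S. S \<subseteq> {..<p} \<and> card S \<le> s}. supported_on p S)"

definition scatter_class :: "nat \<Rightarrow> nat \<Rightarrow> (nat \<Rightarrow> nat \<Rightarrow> real) set" where
  "scatter_class p s =
     {\<Gamma>. psd p \<Gamma> \<and> (\<lambda>i j. \<Gamma> i j - (if i = j then \<Gamma> i j else 0)) \<in> sparse_matrices p s}"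

definition bounded_scatter_class :: "nat \<Rightarrow> nat \<Rightarrow> real \<Rightarrow> (nat \<Rightarrow> nat \<Rightarrow> real) set" where
  "bounded_scatter_class p s M = {\<Gamma> \<in> scatter_class p s. smax p \<Gamma> \<le> M}"

definition supported_directions :: "nat \<Rightarrow> nat set \<Rightarrow> (nat \<Rightarrow> real) set" where
  "supported_directions p S = {u \<in> unit_sphere p. \<forall>i<p. i \<notin> S \<longrightarrow> u i = 0}"

definition sparse_directions :: "nat \<Rightarrow> nat \<Rightarrow> (nat \<Rightarrow> real) set" where
  "sparse_directions p s =
     (\<Union>S\<in>{S. S \<subseteq> {..<p} \<and> card S = 2 * s}. supported_directions p S)"

text \<open>
  The quantity under the infimum only takes the values \<open>k / n\<close> with \<open>k \<le> n\<close>, so over a nonempty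
  set of directions the infimum is a minimum.
\<close>

definition matrix_depth ::
  "nat \<Rightarrow> nat \<Rightarrow> (nat \<Rightarrow> real) set \<Rightarrow> (nat \<Rightarrow> nat \<Rightarrow> real) \<Rightarrow> (nat \<Rightarrow> nat \<Rightarrow> real) \<Rightarrow> real" where
  "matrix_depth p n U \<Gamma> X =
     (INF u\<in>U. min
        ((\<Sum>i<n. of_bool (\<bar>dot p u (X i)\<bar>\<^sup>2 \<le> quad p \<Gamma> u)) / real n)
        ((\<Sum>i<n. of_bool (\<bar>dot p u (X i)\<bar>\<^sup>2 \<ge> quad p \<Gamma> u)) / real n))"

definition deepest_sparse_scatter ::
  "nat \<Rightarrow> nat \<Rightarrow> nat \<Rightarrow> (nat \<Rightarrow> nat \<Rightarrow> real) \<Rightarrow> (nat \<Rightarrow> nat \<Rightarrow> real) \<Rightarrow> bool" where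
  "deepest_sparse_scatter p s n X \<Gamma>h \<longleftrightarrow>
     is_arg_max (\<lambda>\<Gamma>. matrix_depth p n (sparse_directions p s) \<Gamma> X)
       (\<lambda>\<Gamma>. \<Gamma> \<in> scatter_class p s) \<Gamma>h"

end

theory Submission
  imports Defs
begin

text \<open>
  Why the theorem holds. Fix a direction \<open>u\<close> and write \<open>q\<close>, \<open>qh\<close> for the values of the quadratic
  forms of \<open>\<Gamma>\<close> and of the maximiser \<open>\<Gamma>h\<close> at \<open>u\<close>. The canonical normalisation makes the slab
  \<open>\<bar>dot p u x\<bar>\<^sup>2 \<le> q\<close> and its complement equally likely under \<open>P\<close>, so with contamination and
  sampling error \<open>h\<close> the depth of \<open>\<Gamma>\<close> is at least \<open>(1 - \<epsilon>) / 2 - h\<close>. The maximiser is at least as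
  deep, hence the slab of \<open>\<Gamma>h\<close> and its closed outside both have \<open>P\<close>-probability at least
  \<open>1/2 - \<Delta>\<close> with \<open>\<Delta> = (\<epsilon> + 2 * h) / (1 - \<epsilon>)\<close>.
  The marginal condition inverts this: \<open>\<Delta> < \<tau>\<close> excludes a ratio \<open>qh / q\<close> far from 1, and near 1
  the slope bound gives \<open>\<bar>qh / q - 1\<bar> \<le> sqrt \<kappa> * \<Delta>\<close>
  (\<open>ratio_near_one_if_cdf_near_half\<close>, \<open>deepest_scatter_direction_bound\<close>). Multiplying by
  \<open>q \<le> M\<close> bounds the form of \<open>\<Gamma>h - \<Gamma>\<close> on all sparse directions. Off the diagonal this
  difference lives on one block of at most \<open>2 * s\<close> coordinates, so those directions already
  determine its operator norm (\<open>op_norm_scatter_difference_le\<close>).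

  What remains is \<open>h\<close>: the empirical and the true probabilities of all slabs with \<open>2 * s\<close>-sparse
  normals must agree up to order \<open>sqrt ((s * ln (e * p / s) + ln (1 / \<delta>)) / n)\<close>, without an extra
  factor \<open>ln n\<close>. The indicator of a slab is a combination of indicators of two halfspaces. For one
  support \<open>S\<close> the halfspaces have VC dimension at most \<open>card S + 1\<close> (Dudley), and a union bound over the
  supports costs \<open>2 * s * ln (e * p / s)\<close> in the exponent. For one class of VC dimension \<open>d\<close> the
  deviation is of order \<open>sqrt ((d + x) / n)\<close> outside probability \<open>4 * exp (- x)\<close>
  (\<open>uniform_deviation_countable\<close>). Comparison with a ghost sample reduces this claim to random signs on
  \<open>2 * n\<close> fixed points. There a single union bound over all traces of the class would lose the logarithm;
  chaining along nets of spacing \<open>2 * n / 4 ^ j\<close> avoids this, because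
  the size of such a net is at most exponential in \<open>d * j\<close>, a bound free of \<open>n\<close>
  (\<open>ln_card_separated_le\<close>, \<open>card_flip_sign_sup_le\<close>).
\<close>

section \<open>Shattering and separated set families\<close>

definition shatters :: "'a set set \<Rightarrow> 'a set \<Rightarrow> bool" where
  "shatters F S \<longleftrightarrow> Pow S \<subseteq> (\<lambda>A. A \<inter> S) ` F"

text \<open>
  Pajor's form of the Sauer-Shelah lemma. Splitting at a point \<open>w\<close>, the family has as many members as
  the union and the intersection of its two halves together (both halves with \<open>w\<close> deleted), and a
  set shattered by the intersection stays shattered after adding \<open>w\<close>.
\<close>

lemma card_le_card_shattered:
  assumes "finite W" "F \<subseteq> Pow W"
  shows "card F \<le> card {S. S \<subseteq> W \<and> shatters F S}"
  using assms
proof (induction W arbitrary: F rule: finite_induct)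
  case empty
  show ?case
  proof (cases "F = {}")
    case False
    then have "F = {{}}" using empty by auto
    then have "{S. S \<subseteq> {} \<and> shatters F S} = {{}}" by (auto simp: shatters_def)
    then show ?thesis using \<open>F = {{}}\<close> by simp
  qed simp
next
  case (insert w W)
  define B where "B = {A\<in>F. w \<notin> A}"
  define C' where "C' = {A\<in>F. w \<in> A}"
  define C where "C = (\<lambda>A. A - {w}) ` C'"
  have finF: "finite F" using insert by (meson finite.insertI finite_Pow_iff finite_subset)
  have fin: "finite B" "finite C'" "finite C" using finF by (auto simp: B_def C'_def C_def)
  have BW: "B \<subseteq> Pow W" and CW: "C \<subseteq> Pow W" using insert.prems by (auto simp: B_def C_def C'_def)
  have "inj_on (\<lambda>A. A - {w}) C'" by (auto simp: inj_on_def C'_def)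
  then have cC: "card C = card C'" unfolding C_def by (rule card_image)
  have "F = B \<union> C'" "B \<inter> C' = {}" by (auto simp: B_def C'_def)
  then have "card F = card B + card C" using cC fin by (simp add: card_Un_disjoint)
  also have "\<dots> = card (B \<union> C) + card (B \<inter> C)" using fin card_Un_Int by blast
  also have "card (B \<union> C) \<le> card {S. S \<subseteq> W \<and> shatters (B \<union> C) S}"
    using BW CW by (intro insert.IH) auto
  also have "card (B \<inter> C) \<le> card {S. S \<subseteq> W \<and> shatters (B \<inter> C) S}"
    using BW CW by (intro insert.IH) auto
  also have "card {S. S \<subseteq> W \<and> shatters (B \<inter> C) S}
             = card (Set.insert w ` {S. S \<subseteq> W \<and> shatters (B \<inter> C) S})"
    using insert.hyps by (intro card_image[symmetric]) (auto simp: inj_on_def)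
  also have "card {S. S \<subseteq> W \<and> shatters (B \<union> C) S}
               + card (Set.insert w ` {S. S \<subseteq> W \<and> shatters (B \<inter> C) S})
             = card ({S. S \<subseteq> W \<and> shatters (B \<union> C) S} \<union> Set.insert w ` {S. S \<subseteq> W \<and> shatters (B \<inter> C) S})"
    using insert.hyps by (intro card_Un_disjoint[symmetric]) auto
  also have "\<dots> \<le> card {S. S \<subseteq> Set.insert w W \<and> shatters F S}"
  proof (intro card_mono)
    show "finite {S. S \<subseteq> Set.insert w W \<and> shatters F S}" using insert.hyps by auto
    have 1: "shatters F S" if S: "S \<subseteq> W" "shatters (B \<union> C) S" for S
      unfolding shatters_def
    proof
      fix D assume "D \<in> Pow S"
      then obtain A where A: "A \<in> B \<union> C" "D = A \<inter> S" using S(2) unfolding shatters_def by blast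
      have "w \<notin> S" using S(1) insert.hyps by auto
      then obtain A' where "A' \<in> F" "A' \<inter> S = A \<inter> S" using A(1)
        unfolding B_def C_def C'_def by fastforce
      then show "D \<in> (\<lambda>A. A \<inter> S) ` F" using A(2) by blast
    qed
    have 2: "shatters F (Set.insert w S)" if S: "S \<subseteq> W" "shatters (B \<inter> C) S" for S
      unfolding shatters_def
    proof
      fix D assume D: "D \<in> Pow (Set.insert w S)"
      then have "D - {w} \<in> Pow S" by auto
      then obtain A where A: "A \<in> B" "A \<in> C" "D - {w} = A \<inter> S"
        using S(2) unfolding shatters_def by blast
      from A(2) obtain A2 where "A2 \<in> F" "w \<in> A2" "A = A2 - {w}" by (auto simp: C_def C'_def)
      then have "Set.insert w A \<in> F" by (simp add: insert_absorb)
      then have A': "A \<in> F" "w \<notin> A" "Set.insert w A \<in> F" using A(1) by (auto simp: B_def)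
      have "w \<notin> S" using S(1) insert.hyps by auto
      show "D \<in> (\<lambda>A. A \<inter> Set.insert w S) ` F"
      proof (cases "w \<in> D")
        case True
        then have "D = Set.insert w A \<inter> Set.insert w S" using A(3) D by auto
        then show ?thesis using A' by blast
      next
        case False
        then have "D = A \<inter> Set.insert w S" using A(3) D A' by auto
        then show ?thesis using A' by blast
      qed
    qed
    show "{S. S \<subseteq> W \<and> shatters (B \<union> C) S} \<union> Set.insert w ` {S. S \<subseteq> W \<and> shatters (B \<inter> C) S}
          \<subseteq> {S. S \<subseteq> Set.insert w W \<and> shatters F S}"
      using 1 2 by auto
  qed
  finally show ?case by simp
qed

text \<open>
  Weight every set by \<open>y ^ card S\<close>: the small sets have weight at least \<open>y ^ d\<close> each, and the total
  weight of the power set is \<open>(1 + y) ^ card W\<close>. Leaving \<open>y\<close> free lets each application choose it.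
\<close>

lemma card_small_subsets_le:
  assumes "finite W" "0 < y" "y \<le> (1::real)"
  shows "real (card {S. S \<subseteq> W \<and> card S \<le> d}) \<le> exp (real d * ln (1 / y) + y * real (card W))"
proof -
  let ?F = "{S. S \<subseteq> W \<and> card S \<le> d}"
  have fin: "finite (Pow W)" using assms by simp
  have "real (card ?F) * y ^ d = (\<Sum>S\<in>?F. y ^ d)" by simp
  also have "\<dots> \<le> (\<Sum>S\<in>?F. y ^ card S)"
    using assms by (intro sum_mono power_decreasing) auto
  also have "\<dots> \<le> (\<Sum>S\<in>Pow W. y ^ card S)"
    using assms fin by (intro sum_mono2) auto
  also have "\<dots> = (\<Prod>x\<in>W. y + 1)"
    by (subst prod_add[OF assms(1)]) simp
  also have "\<dots> \<le> (\<Prod>x\<in>W. exp y)"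
    using assms by (intro prod_mono) (auto simp: add.commute)
  also have "\<dots> = exp (y * real (card W))"
    by (simp add: exp_of_nat2_mult)
  finally have "real (card ?F) * y ^ d \<le> exp (y * real (card W))" .
  then have "real (card ?F) \<le> exp (y * real (card W)) / y ^ d"
    using assms by (simp add: field_simps)
  also have "\<dots> = exp (real d * ln (1 / y) + y * real (card W))"
  proof -
    have "exp (real d * ln (1 / y)) = 1 / y ^ d"
      using assms by (subst exp_of_nat_mult) (simp add: power_one_over)
    then show ?thesis by (simp add: exp_add)
  qed
  finally show ?thesis .
qed

text \<open>
  A packing bound in the style of Dudley and Haussler. A random tuple of about \<open>2 * ln m / \<epsilon>\<close> points
  distinguishes all pairs among \<open>m\<close> separated sets with positive probability; on these few points the
  family still has \<open>m\<close> traces, so the Sauer-Shelah lemma bounds \<open>m\<close> by a function of \<open>ln m\<close>. The bound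
  does not depend on the size of the ground set.
\<close>

lemma ln_card_separated_le:
  fixes \<epsilon> :: real
  assumes W: "finite W" and F: "F \<subseteq> Pow W" and vc: "\<And>S. S \<subseteq> W \<Longrightarrow> shatters F S \<Longrightarrow> card S \<le> d"
    and \<epsilon>: "0 < \<epsilon>" "\<epsilon> \<le> 1"
    and sep: "\<And>A B. A \<in> F \<Longrightarrow> B \<in> F \<Longrightarrow> A \<noteq> B \<Longrightarrow> real (card (sym_diff A B)) \<ge> \<epsilon> * real (card W)"
  shows "ln (real (card F)) \<le> 2 * real d * ln (8 / \<epsilon>) + 1"
proof (cases "card F \<le> 1")
  case True
  have "ln (8/\<epsilon>) \<ge> 0" using \<epsilon> by (intro ln_ge_zero) (simp add: field_simps)
  then have "2 * real d * ln (8 / \<epsilon>) \<ge> 0" by simp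
  moreover have "ln (real (card F)) \<le> 0"
    using True by (cases "card F = 0") auto
  ultimately show ?thesis by linarith
next
  case False
  define m where "m = card F"
  define N where "N = card W"
  have finF: "finite F" using F W by (meson finite_Pow_iff finite_subset)
  have m: "m \<ge> 2" using False by (simp add: m_def)
  have "W \<noteq> {}"
  proof
    assume "W = {}"
    then have "F \<subseteq> {{}}" using F by auto
    then have "card F \<le> card {{} :: 'a set}" by (intro card_mono) auto
    then show False using False by simp
  qed
  then have N: "N > 0" using W by (simp add: N_def card_gt_0_iff)
  define k where "k = nat \<lceil>2 * ln m / \<epsilon>\<rceil>"
  have lnm: "ln m \<ge> 0" using m by simp
  have k1: "2 * ln m / \<epsilon> \<le> real k" unfolding k_def by linarith
  have k2: "real k \<le> 2 * ln m / \<epsilon> + 1"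
  proof -
    have "0 \<le> 2 * ln m / \<epsilon>" using lnm \<epsilon> by simp
    then show ?thesis unfolding k_def by linarith
  qed
  define T where "T = (PiE {..<k} (\<lambda>_. W))"
  \<comment> \<open>A tuple is bad for a pair when it misses the symmetric difference of the pair.\<close>
  define bad where "bad = (\<lambda>(A,B). PiE {..<k} (\<lambda>_. W - sym_diff A B))"
  define prs where "prs = {(A,B). A \<in> F \<and> B \<in> F \<and> A \<noteq> B}"
  have prs_sub: "prs \<subseteq> F \<times> F - {(A,A) | A. A\<in>F}" by (auto simp: prs_def)
  have cprs: "card prs < m^2"
  proof -
    have "F \<noteq> {}" using m unfolding m_def by auto
    then obtain A where "A \<in> F" by blast
    then have "prs \<subset> F \<times> F" using prs_sub by blast
    then have "card prs < card (F \<times> F)" using finF by (intro psubset_card_mono) auto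
    then show ?thesis by (simp add: m_def card_cartesian_product power2_eq_square)
  qed
  have finprs: "finite prs" using finF prs_sub finite_subset[OF _ finite_cartesian_product[OF finF finF]] by blast
  have cT: "real (card T) = real N ^ k" unfolding T_def by (simp add: card_PiE N_def)
  have cbad: "real (card (bad q)) \<le> real N ^ k / real (m^2)" if "q \<in> prs" for q
  proof -
    obtain A B where q: "q = (A,B)" by force
    have AB: "A \<in> F" "B \<in> F" "A \<noteq> B" using that q by (auto simp: prs_def)
    have sub: "sym_diff A B \<subseteq> W" using AB F by auto
    have "real (card (bad q)) = real (card (W - sym_diff A B)) ^ k"
      unfolding bad_def q by (simp add: card_PiE)
    also have "real (card (W - sym_diff A B)) = real N - real (card (sym_diff A B))"
      using sub W by (subst card_Diff_subset) (auto simp: N_def finite_subset card_mono of_nat_diff)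
    also have "(real N - real (card (sym_diff A B))) ^ k \<le> (real N * exp (-\<epsilon>)) ^ k"
    proof (rule power_mono)
      have "real N - real (card (sym_diff A B)) \<le> real N * (1 - \<epsilon>)"
        using sep[OF AB] by (simp add: N_def algebra_simps)
      also have "\<dots> \<le> real N * exp (-\<epsilon>)"
        using exp_ge_add_one_self[of "-\<epsilon>"] by (intro mult_left_mono) auto
      finally show "real N - real (card (sym_diff A B)) \<le> real N * exp (-\<epsilon>)" .
      show "0 \<le> real N - real (card (sym_diff A B))"
        using card_mono[OF W sub] by (simp add: N_def)
    qed
    also have "\<dots> = real N ^ k * exp (- \<epsilon> * real k)"
      by (simp add: power_mult_distrib exp_of_nat_mult[symmetric] mult.commute)
    also have "\<dots> \<le> real N ^ k * exp (- (2 * ln m))"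
    proof -
      have "2 * ln m \<le> \<epsilon> * real k" using k1 \<epsilon> by (simp add: field_simps)
      then show ?thesis by (intro mult_left_mono) auto
    qed
    also have "exp (- (2 * ln m)) = 1 / real (m^2)"
      using m by (simp add: exp_minus exp_double inverse_eq_divide)
    finally show ?thesis by simp
  qed
  have "real (card (\<Union>q\<in>prs. bad q)) \<le> (\<Sum>q\<in>prs. real (card (bad q)))"
    using of_nat_mono[OF card_UN_le[OF finprs, of bad], where 'a=real] by simp
  also have "\<dots> \<le> (\<Sum>q\<in>prs. real N ^ k / real (m^2))"
    by (intro sum_mono cbad)
  also have "\<dots> = real (card prs) * (real N ^ k / real (m^2))" by simp
  also have "\<dots> < real (m^2) * (real N ^ k / real (m^2))"
    using cprs N m by (intro mult_strict_right_mono) (auto simp flip: of_nat_power)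
  also have "\<dots> = real (card T)" using m cT by simp
  finally have lt: "card (\<Union>q\<in>prs. bad q) < card T" by simp
  have "finite (\<Union>q\<in>prs. bad q)"
    using finprs W by (auto simp: bad_def intro!: finite_PiE)
  then have "\<not> T \<subseteq> (\<Union>q\<in>prs. bad q)"
    using lt by (meson card_mono not_le)
  then obtain f where f: "f \<in> T" "\<And>q. q \<in> prs \<Longrightarrow> f \<notin> bad q" by blast
  define V where "V = f ` {..<k}"
  have VW: "V \<subseteq> W" using f(1) by (auto simp: V_def T_def)
  have finV: "finite V" by (simp add: V_def)
  have cV: "card V \<le> k" unfolding V_def using card_image_le[of "{..<k}" f] by simp
  have inj: "inj_on (\<lambda>A. A \<inter> V) F"
  proof (rule inj_onI, rule ccontr)
    fix A B assume AB: "A \<in> F" "B \<in> F" "A \<inter> V = B \<inter> V" "A \<noteq> B"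
    then have "f \<notin> bad (A,B)" using f(2) by (auto simp: prs_def)
    then obtain i where "i < k" "f i \<in> sym_diff A B"
      using f(1) unfolding bad_def T_def by (auto simp: PiE_iff)
    then show False using AB(3) by (auto simp: V_def)
  qed
  let ?F' = "(\<lambda>A. A \<inter> V) ` F"
  have "real m = real (card ?F')" using card_image[OF inj] by (simp add: m_def)
  also have "\<dots> \<le> real (card {S. S \<subseteq> V \<and> shatters ?F' S})"
    using card_le_card_shattered[OF finV, of ?F'] by auto
  also have "\<dots> \<le> real (card {S. S \<subseteq> V \<and> card S \<le> d})"
  proof -
    have "card S \<le> d" if S: "S \<subseteq> V" "shatters ?F' S" for S
    proof (rule vc)
      show "S \<subseteq> W" using S VW by auto
      have "(\<lambda>A. A \<inter> S) ` ?F' = (\<lambda>A. A \<inter> S) ` F"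
        unfolding image_image using S(1) by (intro image_cong) auto
      then show "shatters F S" using S(2) by (simp add: shatters_def)
    qed
    then show ?thesis using finV by (intro of_nat_mono card_mono) auto
  qed
  \<comment> \<open>With the weight \<open>y = \<epsilon>/8\<close> the term \<open>y * k\<close> is only about \<open>ln m / 4\<close>, which the left side absorbs.\<close>
  also have "\<dots> \<le> exp (real d * ln (1 / (\<epsilon>/8)) + (\<epsilon>/8) * real (card V))"
    using finV \<epsilon> by (intro card_small_subsets_le) auto
  finally have "ln (real m) \<le> real d * ln (1 / (\<epsilon>/8)) + (\<epsilon>/8) * real (card V)"
    using m ln_le_cancel_iff[of "real m" "exp (real d * ln (1 / (\<epsilon>/8)) + (\<epsilon>/8) * real (card V))"]
    by (simp del: ln_le_cancel_iff)
  also have "(\<epsilon>/8) * real (card V) \<le> (\<epsilon>/8) * (2 * ln m / \<epsilon> + 1)"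
    using cV k2 \<epsilon> by (intro mult_left_mono) auto
  also have "\<dots> = ln m / 4 + \<epsilon>/8" using \<epsilon> by (simp add: field_simps)
  finally have *: "ln (real m) \<le> real d * ln (8/\<epsilon>) + ln m / 4 + 1/8" using \<epsilon> by simp
  have "ln (8/\<epsilon>) \<ge> 0" using \<epsilon> by (intro ln_ge_zero) (simp add: field_simps)
  then have "real d * ln (8 / \<epsilon>) \<ge> 0" by simp
  with * show ?thesis by (simp add: m_def)
qed

section \<open>Random signs and chaining\<close>

text \<open>
  A vector of signs is encoded by the set \<open>\<sigma>\<close> of its negative entries, so that averaging over all sign
  vectors is counting in a power set.
\<close>

definition flip_sign :: "'a set \<Rightarrow> 'a \<Rightarrow> real" where
  "flip_sign \<sigma> i = (if i \<in> \<sigma> then - 1 else 1)"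

text \<open>
  The estimate \<open>cosh x \<le> exp (x\<^sup>2 / 2)\<close>, the case \<open>p = 1/2\<close> of the analytic part of Hoeffding's lemma.
\<close>

lemma exp_plus_exp_minus_le: "exp x + exp (- x) \<le> 2 * exp (x\<^sup>2 / 2)" for x :: real
proof -
  have *: "exp x + exp (- x) \<le> 2 * exp (x\<^sup>2 / 2)" if "x \<ge> 0" for x :: real
  proof -
    have "- (2*x) * (1/2) + ln (1 + (1/2) * (exp (2*x) - 1)) \<le> (2*x)\<^sup>2 / 8"
      by (rule Hoeffdings_lemma_aux) (use that in auto)
    then have "ln ((1 + exp (2*x)) / 2) \<le> x + x\<^sup>2 / 2"
      by (simp add: field_simps power2_eq_square)
    moreover have "(1 + exp (2*x)) / 2 > 0" by (simp add: add_pos_pos)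
    ultimately have "(1 + exp (2*x)) / 2 \<le> exp (x + x\<^sup>2 / 2)"
      by (metis exp_le_cancel_iff exp_ln)
    then have "exp (-x) * (1 + exp (2*x)) \<le> exp (-x) * (2 * exp (x + x\<^sup>2 / 2))"
      by (intro mult_left_mono) auto
    then show ?thesis by (simp add: algebra_simps exp_add[symmetric])
  qed
  show ?thesis
    using *[of x] *[of "-x"] by (cases "x \<ge> 0") (auto simp: add.commute)
qed

lemma sum_exp_flip_sign_le:
  assumes "finite I"
  shows "(\<Sum>\<sigma>\<in>Pow I. exp (\<Sum>i\<in>I. flip_sign \<sigma> i * a i)) \<le> 2 ^ card I * exp ((\<Sum>i\<in>I. (a i)\<^sup>2) / 2)"
proof -
  have "(\<Sum>\<sigma>\<in>Pow I. exp (\<Sum>i\<in>I. flip_sign \<sigma> i * a i))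
        = (\<Sum>\<sigma>\<in>Pow I. (\<Prod>i\<in>\<sigma>. exp (- a i)) * (\<Prod>i\<in>I-\<sigma>. exp (a i)))"
  proof (rule sum.cong)
    fix \<sigma> assume \<sigma>: "\<sigma> \<in> Pow I"
    have "exp (\<Sum>i\<in>I. flip_sign \<sigma> i * a i) = (\<Prod>i\<in>I. exp (flip_sign \<sigma> i * a i))"
      using assms by (rule exp_sum)
    also have "\<dots> = (\<Prod>i\<in>I-\<sigma>. exp (flip_sign \<sigma> i * a i)) * (\<Prod>i\<in>\<sigma>. exp (flip_sign \<sigma> i * a i))"
      using \<sigma> assms by (intro prod.subset_diff) auto
    also have "\<dots> = (\<Prod>i\<in>I-\<sigma>. exp (a i)) * (\<Prod>i\<in>\<sigma>. exp (- a i))"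
      by (intro arg_cong2[where f="(*)"] prod.cong) (auto simp: flip_sign_def)
    finally show "exp (\<Sum>i\<in>I. flip_sign \<sigma> i * a i) = (\<Prod>i\<in>\<sigma>. exp (- a i)) * (\<Prod>i\<in>I-\<sigma>. exp (a i))"
      by (simp add: mult.commute)
  qed simp
  also have "\<dots> = (\<Prod>i\<in>I. exp (- a i) + exp (a i))"
    by (rule prod_add[OF assms, symmetric])
  also have "\<dots> \<le> (\<Prod>i\<in>I. 2 * exp ((a i)\<^sup>2 / 2))"
    using exp_plus_exp_minus_le by (intro prod_mono) (auto simp: add.commute intro: add_nonneg_nonneg)
  also have "\<dots> = 2 ^ card I * exp ((\<Sum>i\<in>I. (a i)\<^sup>2) / 2)"
    using assms by (simp add: prod.distrib exp_sum sum_divide_distrib)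
  finally show ?thesis .
qed

lemma card_flip_sign_tail_le:
  assumes I: "finite I" and v: "(\<Sum>i\<in>I. (a i)\<^sup>2) \<le> v" "v > 0" and "\<rho> \<ge> 0"
  shows "real (card {\<sigma>\<in>Pow I. \<bar>\<Sum>i\<in>I. flip_sign \<sigma> i * a i\<bar> > \<rho>})
           \<le> 2 ^ card I * (2 * exp (- (\<rho>\<^sup>2 / (2 * v))))"
proof -
  have one: "real (card {\<sigma>\<in>Pow I. (\<Sum>i\<in>I. flip_sign \<sigma> i * b i) > \<rho>})
           \<le> 2 ^ card I * exp (- (\<rho>\<^sup>2 / (2 * v)))" if b: "(\<Sum>i\<in>I. (b i)\<^sup>2) \<le> v" for b
  proof -
    define \<theta> where "\<theta> = \<rho> / v"
    have \<theta>: "\<theta> \<ge> 0" using assms by (simp add: \<theta>_def)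
    let ?E = "{\<sigma>\<in>Pow I. (\<Sum>i\<in>I. flip_sign \<sigma> i * b i) > \<rho>}"
    have "real (card ?E) * exp (\<theta> * \<rho>) = (\<Sum>\<sigma>\<in>?E. exp (\<theta> * \<rho>))" by simp
    also have "\<dots> \<le> (\<Sum>\<sigma>\<in>?E. exp (\<Sum>i\<in>I. flip_sign \<sigma> i * (\<theta> * b i)))"
    proof (rule sum_mono)
      fix \<sigma> assume "\<sigma> \<in> ?E"
      then have "\<theta> * \<rho> \<le> \<theta> * (\<Sum>i\<in>I. flip_sign \<sigma> i * b i)" using \<theta> by (intro mult_left_mono) auto
      also have "\<dots> = (\<Sum>i\<in>I. flip_sign \<sigma> i * (\<theta> * b i))"
        by (simp add: sum_distrib_left algebra_simps)
      finally show "exp (\<theta> * \<rho>) \<le> exp (\<Sum>i\<in>I. flip_sign \<sigma> i * (\<theta> * b i))" by simp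
    qed
    also have "\<dots> \<le> (\<Sum>\<sigma>\<in>Pow I. exp (\<Sum>i\<in>I. flip_sign \<sigma> i * (\<theta> * b i)))"
      using I by (intro sum_mono2) auto
    also have "\<dots> \<le> 2 ^ card I * exp ((\<Sum>i\<in>I. (\<theta> * b i)\<^sup>2) / 2)"
      by (rule sum_exp_flip_sign_le[OF I])
    also have "\<dots> \<le> 2 ^ card I * exp (\<theta>\<^sup>2 * v / 2)"
      using b by (simp add: power_mult_distrib sum_distrib_left[symmetric] mult_left_mono)
    finally have "real (card ?E) \<le> 2 ^ card I * exp (\<theta>\<^sup>2 * v / 2) / exp (\<theta> * \<rho>)"
      by (simp add: field_simps)
    also have "\<dots> = 2 ^ card I * exp (\<theta>\<^sup>2 * v / 2 - \<theta> * \<rho>)" by (simp add: exp_diff)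
    also have "\<theta>\<^sup>2 * v / 2 - \<theta> * \<rho> = - (\<rho>\<^sup>2 / (2 * v))"
      using v(2) by (simp add: \<theta>_def field_simps power2_eq_square)
    finally show ?thesis .
  qed
  have "real (card {\<sigma>\<in>Pow I. \<bar>\<Sum>i\<in>I. flip_sign \<sigma> i * a i\<bar> > \<rho>})
     \<le> real (card ({\<sigma>\<in>Pow I. (\<Sum>i\<in>I. flip_sign \<sigma> i * a i) > \<rho>} \<union>
                  {\<sigma>\<in>Pow I. (\<Sum>i\<in>I. flip_sign \<sigma> i * - a i) > \<rho>}))"
    using I by (intro of_nat_mono card_mono) (auto simp: abs_if sum_negf split: if_splits)
  also have "\<dots> \<le> real (card {\<sigma>\<in>Pow I. (\<Sum>i\<in>I. flip_sign \<sigma> i * a i) > \<rho>}) +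
                 real (card {\<sigma>\<in>Pow I. (\<Sum>i\<in>I. flip_sign \<sigma> i * - a i) > \<rho>})"
    unfolding of_nat_add[symmetric] by (intro of_nat_mono card_Un_le)
  also have "\<dots> \<le> 2 ^ card I * exp (- (\<rho>\<^sup>2 / (2 * v))) + 2 ^ card I * exp (- (\<rho>\<^sup>2 / (2 * v)))"
    using v(1) by (intro add_mono one) auto
  finally show ?thesis by simp
qed

text \<open>
  A maximal separated subset is a net; the induction adds a point exactly when it is far from the
  points chosen before.
\<close>

lemma ex_separated_net:
  fixes D :: "'a \<Rightarrow> 'a \<Rightarrow> real"
  assumes "finite T" and D: "\<And>x. D x x \<le> r" "\<And>x y. D x y = D y x"
  shows "\<exists>N\<subseteq>T. (\<forall>x\<in>N. \<forall>y\<in>N. x \<noteq> y \<longrightarrow> D x y > r) \<and> (\<forall>x\<in>T. \<exists>y\<in>N. D x y \<le> r)"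
  using assms(1)
proof (induction T rule: finite_induct)
  case (insert t T)
  then obtain N where N: "N \<subseteq> T" "\<forall>x\<in>N. \<forall>y\<in>N. x \<noteq> y \<longrightarrow> D x y > r" "\<forall>x\<in>T. \<exists>y\<in>N. D x y \<le> r"
    by blast
  show ?case
  proof (cases "\<exists>y\<in>N. D t y \<le> r")
    case True
    then show ?thesis using N by (intro exI[of _ N]) auto
  next
    case False
    then have "\<forall>y\<in>N. D t y > r \<and> D y t > r" using D(2) by (metis not_le)
    then show ?thesis using N D(1) by (intro exI[of _ "Set.insert t N"]) auto
  qed
qed auto

text \<open>
  The sample and its ghost occupy the indices below \<open>n\<close> and from \<open>n\<close> to \<open>2 * n\<close>. For a set \<open>t\<close> of hit
  indices this is the contribution of the \<open>i\<close>-th pair to the difference of the two counts.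
\<close>

definition half_difference :: "nat \<Rightarrow> nat set \<Rightarrow> nat \<Rightarrow> real" where
  "half_difference n t i = of_bool (i \<in> t) - of_bool (n + i \<in> t)"

lemma sum_two_halves:
  fixes f :: "nat \<Rightarrow> real"
  shows "(\<Sum>i<n. f i) + (\<Sum>i<n. f (n + i)) = (\<Sum>i<n+n. f i)"
  using sum.nat_group[of f n 2] sum.atLeastLessThan_concat[of 0 n "n+n" f]
    sum.shift_bounds_nat_ivl[of f 0 n n]
  by (simp add: lessThan_atLeast0 add.commute)

lemma sum_half_difference_sq_le:
  assumes "t \<subseteq> {..<n+n}" "t' \<subseteq> {..<n+n}"
  shows "(\<Sum>i<n. (half_difference n t i - half_difference n t' i)\<^sup>2) \<le> 2 * real (card (sym_diff t t'))"
proof -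
  let ?S = "sym_diff t t'"
  have "(\<Sum>i<n. (half_difference n t i - half_difference n t' i)\<^sup>2)
        \<le> (\<Sum>i<n. 2 * (of_bool (i \<in> ?S) + of_bool (n + i \<in> ?S)))"
    by (intro sum_mono) (auto simp: half_difference_def of_bool_def)
  also have "\<dots> = 2 * (\<Sum>i<n+n. of_bool (i \<in> ?S))"
    unfolding sum_two_halves[symmetric] by (simp add: sum_distrib_left[symmetric] sum.distrib)
  also have "(\<Sum>i<n+n. of_bool (i \<in> ?S)) = real (card ?S)"
  proof -
    have *: "(\<Sum>i<n+n. of_bool (i \<in> S)) = real (card S)" if "S \<subseteq> {..<n+n}" for S
      using that by (simp add: sum_of_bool_eq Int_absorb1)
    have "?S \<subseteq> {..<n+n}" using assms by auto
    then show ?thesis by (rule *)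
  qed
  finally show ?thesis .
qed

lemma sum_chain_weights: "(\<Sum>j<J. (real j + 1) / 2 ^ j) = 4 - (2 * real J + 4) / 2 ^ J"
proof (induction J)
  case (Suc J)
  have "(\<Sum>j<Suc J. (real j + 1) / 2 ^ j) = 4 - (2 * real J + 4) / 2 ^ J + (real J + 1) / 2 ^ J"
    using Suc by simp
  also have "\<dots> = 4 - (2 * real (Suc J) + 4) / 2 ^ Suc J" by (simp add: field_simps)
  finally show ?case .
qed simp

text \<open>
  The chaining bound. Each trace \<open>t\<close> is reached from the empty set through nets of spacing \<open>2 * n / 4 ^ j\<close>.
  A step between the levels \<open>j\<close> and \<open>j + 1\<close> has variance proxy of order \<open>n / 4 ^ j\<close>, and there are at most
  \<open>exp (8 * d * (j + 1))\<close> such steps. A threshold of order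
  \<open>sqrt (n * (d + x)) * (j + 1) / 2 ^ j\<close> makes the failure probabilities summable, and the
  thresholds sum to a constant multiple of \<open>sqrt (n * (d + x))\<close>.
\<close>

lemma card_flip_sign_sup_le:
  fixes x :: real
  assumes T: "T \<subseteq> Pow {..<n+n}" and vc: "\<And>S. S \<subseteq> {..<n+n} \<Longrightarrow> shatters T S \<Longrightarrow> card S \<le> d"
    and n: "n \<ge> 1" and d: "d \<ge> 1" and x: "x \<ge> 0"
  shows "real (card {\<sigma>\<in>Pow {..<n}. \<exists>t\<in>T. \<bar>\<Sum>i<n. flip_sign \<sigma> i * half_difference n t i\<bar>
                 > 4 * sqrt (72 * real n * (real d + x))}) \<le> 2 ^ n * (2 * exp (- x))"
proof -
  define D where "D = (\<lambda>t t' :: nat set. real (card (sym_diff t t')))"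
  define Z where "Z = (\<lambda>t \<sigma>. \<Sum>i<n. flip_sign \<sigma> i * half_difference n t i)"
  define r where "r = (\<lambda>j. real (n+n) / 4 ^ j)"
  define \<rho> where "\<rho> = (\<lambda>j. sqrt (72 * real n * (real d + x)) * ((real j + 1) / 2 ^ j))"
  have finT: "finite T" using T by (meson finite_Pow_iff finite_lessThan finite_subset)
  have "\<exists>N\<subseteq>T. (\<forall>x\<in>N. \<forall>y\<in>N. x \<noteq> y \<longrightarrow> D x y > r j) \<and> (\<forall>x\<in>T. \<exists>y\<in>N. D x y \<le> r j)" for j
    by (rule ex_separated_net[OF finT]) (auto simp: D_def r_def Un_commute)
  then obtain N where N: "\<And>j. N j \<subseteq> T" "\<And>j x y. x \<in> N j \<Longrightarrow> y \<in> N j \<Longrightarrow> x \<noteq> y \<Longrightarrow> D x y > r j"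
    "\<And>j x. x \<in> T \<Longrightarrow> \<exists>y\<in>N j. D x y \<le> r j" by metis
  \<comment> \<open>Level 0 is the empty set alone, where the process vanishes; it lies within \<open>2 * n\<close> of every trace
    but need not be a trace itself.\<close>
  define L where "L = (\<lambda>j. if j = 0 then {{}} else N j)"
  have LT: "L j \<subseteq> Pow {..<n+n}" for j using N(1)[of j] T by (auto simp: L_def)
  have near: "\<exists>y\<in>L j. D t y \<le> r j" if "t \<in> T" for t j
  proof (cases "j = 0")
    case True
    have "card t \<le> card {..<n+n}" using that T by (intro card_mono) auto
    then show ?thesis using True by (auto simp: L_def D_def r_def)
  next
    case False
    then show ?thesis using N(3)[OF that] by (simp add: L_def)
  qed
  define \<pi> where "\<pi> = (\<lambda>j t. SOME y. y \<in> L j \<and> D t y \<le> r j)"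
  have \<pi>: "\<pi> j t \<in> L j" "D t (\<pi> j t) \<le> r j" if "t \<in> T" for j t
    using someI_ex[of "\<lambda>y. y \<in> L j \<and> D t y \<le> r j"] near[OF that, of j]
    by (auto simp: \<pi>_def)
  have finL: "finite (L j)" for j using LT finite_subset by blast
  have cardL: "real (card (L (Suc j))) \<le> exp (8 * real d * (real j + 1))" for j
  proof (cases "L (Suc j) = {}")
    case False
    have LN: "L (Suc j) = N (Suc j)" by (simp add: L_def)
    have "ln (real (card (L (Suc j)))) \<le> 2 * real d * ln (8 / (1 / 4 ^ Suc j)) + 1"
    proof (rule ln_card_separated_le)
      show "finite {..<n+n}" by simp
      show "L (Suc j) \<subseteq> Pow {..<n+n}" by (rule LT)
      show "card S \<le> d" if "S \<subseteq> {..<n+n}" "shatters (L (Suc j)) S" for S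
      proof (rule vc[OF that(1)])
        show "shatters T S" using that(2) N(1)[of "Suc j"] unfolding shatters_def LN by blast
      qed
      show "0 < 1 / (4::real) ^ Suc j" by simp
      show "1 / (4::real) ^ Suc j \<le> 1" 
        using one_le_power[of "4::real" "Suc j"] by (simp only: divide_le_eq_1) simp
      show "1 / 4 ^ Suc j * real (card {..<n+n}) \<le> real (card (sym_diff A B))"
        if "A \<in> L (Suc j)" "B \<in> L (Suc j)" "A \<noteq> B" for A B
        using N(2)[of A "Suc j" B] that unfolding LN D_def r_def by simp
    qed
    also have "ln (8 / (1 / 4 ^ Suc j)) = (3 + 2 * (real j + 1)) * ln (2::real)"
    proof -
      have "(8 / (1 / 4 ^ Suc j) :: real) = 2 ^ (3 + 2 * Suc j)"
        by (simp add: power_add power_mult)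
      then show ?thesis by (simp add: ln_realpow)
    qed
    also have "2 * real d * ((3 + 2 * (real j + 1)) * ln 2) \<le> 2 * real d * ((3 + 2 * (real j + 1)) * (7/10))"
      using ln2_le_25_over_36 by (intro mult_left_mono) auto
    also have "\<dots> + 1 \<le> 2 * real d * ((3 + 2 * (real j + 1)) * (7/10)) + real d * (real j + 1)"
    proof -
      have "1 * 1 \<le> real d * (real j + 1)" using d by (intro mult_mono) auto
      then show ?thesis by simp
    qed
    also have "\<dots> \<le> 8 * real d * (real j + 1)" using d by (simp add: algebra_simps)
    finally have "ln (real (card (L (Suc j)))) \<le> 8 * real d * (real j + 1)" by simp
    moreover have "real (card (L (Suc j))) > 0" using False finL by (simp add: card_gt_0_iff)
    ultimately show ?thesis by (metis exp_le_cancel_iff exp_ln)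
  qed simp
  define bad where "bad = (\<lambda>j t. {\<sigma>\<in>Pow {..<n}. \<bar>Z t \<sigma> - Z (\<pi> j t) \<sigma>\<bar> > \<rho> j})"
  have badle: "real (card (bad j t)) \<le> 2 ^ n * (2 * exp (- (9 * (real j + 1)\<^sup>2 * (real d + x))))"
    if t: "t \<in> L (Suc j)" for j t
  proof -
    have tT: "t \<in> T" using t N(1) by (auto simp: L_def)
    define a where "a = (\<lambda>i. half_difference n t i - half_difference n (\<pi> j t) i)"
    have "(\<Sum>i<n. (a i)\<^sup>2) \<le> 2 * D t (\<pi> j t)"
      unfolding a_def D_def using tT T \<pi>(1)[OF tT, of j] LT[of j]
      by (intro sum_half_difference_sq_le) auto
    also have "\<dots> \<le> 2 * r j" using \<pi>(2)[OF tT] by simp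
    finally have v: "(\<Sum>i<n. (a i)\<^sup>2) \<le> 4 * real n / 4 ^ j" by (simp add: r_def)
    have lam0: "\<rho> j \<ge> 0" using x by (simp add: \<rho>_def)
    have "bad j t = {\<sigma>\<in>Pow {..<n}. \<bar>\<Sum>i<n. flip_sign \<sigma> i * a i\<bar> > \<rho> j}"
      by (simp add: bad_def Z_def a_def right_diff_distrib sum_subtractf)
    then have "real (card (bad j t)) \<le> 2 ^ card {..<n} * (2 * exp (- ((\<rho> j)\<^sup>2 / (2 * (4 * real n / 4 ^ j)))))"
      using card_flip_sign_tail_le[OF _ v _ lam0] n by simp
    also have "(\<rho> j)\<^sup>2 / (2 * (4 * real n / 4 ^ j)) = 9 * (real j + 1)\<^sup>2 * (real d + x)"
    proof -
      have "(2 ^ j)\<^sup>2 = (4 ^ j :: real)" by (simp add: power2_eq_square power_mult_distrib[symmetric])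
      moreover have "0 \<le> 72 * real n * (real d + x)" using x by simp
      ultimately have "(\<rho> j)\<^sup>2 = 72 * real n * (real d + x) * ((real j + 1)\<^sup>2 / 4 ^ j)"
        unfolding \<rho>_def by (simp add: power_mult_distrib power_divide)
      then show ?thesis using n by (simp add: field_simps)
    qed
    finally show ?thesis by simp
  qed
  \<comment> \<open>At level \<open>n\<close> the spacing is below 1, so the net is the whole family.\<close>
  define J where "J = n"
  have J: "r J < 1"
  proof -
    have "real n < 2 ^ n" by (rule of_nat_less_two_power)
    moreover have "(2::real) \<le> 2 ^ n" using n self_le_power[of "2::real" n] by simp
    ultimately have "2 * real n < 2 ^ n * 2 ^ n" by (intro mult_le_less_imp_less) (use n in auto)
    also have "\<dots> = 4 ^ n" by (simp add: power_mult_distrib[symmetric])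
    finally show ?thesis by (simp add: r_def J_def)
  qed
  have TL: "t \<in> L J" if "t \<in> T" for t
  proof -
    have "D t (\<pi> J t) < 1" using \<pi>(2)[OF that, of J] J by linarith
    then have "card (sym_diff t (\<pi> J t)) = 0" by (simp add: D_def)
    moreover have "finite (sym_diff t (\<pi> J t))"
      using that T \<pi>(1)[OF that, of J] LT[of J] by (meson Pow_iff finite_Diff finite_UnI finite_lessThan finite_subset subsetD)
    ultimately have "t = \<pi> J t" by auto
    then show ?thesis using \<pi>(1)[OF that] by metis
  qed
  define Bad where "Bad = (\<Union>j<J. \<Union>t\<in>L (Suc j). bad j t)"
  have sub: "{\<sigma>\<in>Pow {..<n}. \<exists>t\<in>T. \<bar>Z t \<sigma>\<bar> > 4 * sqrt (72 * real n * (real d + x))} \<subseteq> Bad"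
  proof (rule ccontr)
    assume "\<not> ?thesis"
    then obtain \<sigma> t where \<sigma>: "\<sigma> \<in> Pow {..<n}" "\<sigma> \<notin> Bad" and t: "t \<in> T"
      "\<bar>Z t \<sigma>\<bar> > 4 * sqrt (72 * real n * (real d + x))" by blast
    have "k \<le> J \<Longrightarrow> t \<in> L k \<Longrightarrow> \<bar>Z t \<sigma>\<bar> \<le> (\<Sum>j<k. \<rho> j)" for k t
    proof (induction k arbitrary: t)
      case 0
      then show ?case by (simp add: L_def Z_def half_difference_def)
    next
      case (Suc k)
      have tT: "t \<in> T" using Suc.prems N(1) by (auto simp: L_def)
      have "\<bar>Z (\<pi> k t) \<sigma>\<bar> \<le> (\<Sum>j<k. \<rho> j)" using Suc \<pi>(1)[OF tT] by auto
      moreover have "\<bar>Z t \<sigma> - Z (\<pi> k t) \<sigma>\<bar> \<le> \<rho> k"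
        using \<sigma> Suc.prems unfolding Bad_def bad_def by force
      ultimately show ?case by simp
    qed
    then have "\<bar>Z t \<sigma>\<bar> \<le> (\<Sum>j<J. \<rho> j)" using TL[OF t(1)] by blast
    also have "\<dots> = sqrt (72 * real n * (real d + x)) * (4 - (2 * real J + 4) / 2 ^ J)"
      unfolding \<rho>_def sum_distrib_left[symmetric] sum_chain_weights ..
    also have "\<dots> \<le> sqrt (72 * real n * (real d + x)) * 4"
      using x by (intro mult_left_mono) auto
    finally show False using t(2) by simp
  qed
  have finBad: "finite Bad" unfolding Bad_def bad_def using finL by auto
  have "real (card {\<sigma>\<in>Pow {..<n}. \<exists>t\<in>T. \<bar>Z t \<sigma>\<bar> > 4 * sqrt (72 * real n * (real d + x))})
        \<le> real (card Bad)"
    using sub finBad by (intro of_nat_mono card_mono)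
  also have "\<dots> \<le> (\<Sum>j<J. \<Sum>t\<in>L (Suc j). real (card (bad j t)))"
  proof -
    have "card Bad \<le> (\<Sum>j<J. card (\<Union>t\<in>L (Suc j). bad j t))"
      unfolding Bad_def by (rule card_UN_le) simp
    also have "\<dots> \<le> (\<Sum>j<J. \<Sum>t\<in>L (Suc j). card (bad j t))"
      by (intro sum_mono card_UN_le finL)
    finally have "real (card Bad) \<le> real (\<Sum>j<J. \<Sum>t\<in>L (Suc j). card (bad j t))" by (rule of_nat_mono)
    then show ?thesis by simp
  qed
  also have "\<dots> \<le> (\<Sum>j<J. \<Sum>t\<in>L (Suc j). 2 ^ n * (2 * exp (- (9 * (real j + 1)\<^sup>2 * (real d + x)))))"
    by (intro sum_mono badle)
  also have "\<dots> \<le> (\<Sum>j<J. 2 ^ n * (2 * exp (- x)) * (1/2) ^ Suc j)"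
  proof (rule sum_mono)
    fix j
    have "(\<Sum>t\<in>L (Suc j). 2 ^ n * (2 * exp (- (9 * (real j + 1)\<^sup>2 * (real d + x)))))
          = 2 ^ n * 2 * (real (card (L (Suc j))) * exp (- (9 * (real j + 1)\<^sup>2 * (real d + x))))" by simp
    also have "\<dots> \<le> 2 ^ n * 2 * (exp (8 * real d * (real j + 1)) * exp (- (9 * (real j + 1)\<^sup>2 * (real d + x))))"
      using cardL[of j] by (intro mult_left_mono mult_right_mono) auto
    also have "exp (8 * real d * (real j + 1)) * exp (- (9 * (real j + 1)\<^sup>2 * (real d + x)))
             \<le> exp (- x - (real j + 1))"
    proof -
      define y where "y = real j + 1"
      have y: "y \<ge> 1" by (simp add: y_def)
      have dd: "real d \<ge> 1" using d by simp
      have "y * 1 \<le> y * y" using y by (intro mult_left_mono) auto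
      then have yy: "y \<le> y\<^sup>2" "1 \<le> y\<^sup>2" using y unfolding power2_eq_square by linarith+
      have "8 * real d * y + y + x \<le> 8 * real d * y\<^sup>2 + y\<^sup>2 * real d + 9 * y\<^sup>2 * x"
      proof (intro add_mono)
        show "8 * real d * y \<le> 8 * real d * y\<^sup>2" using yy by (intro mult_left_mono) auto
        have "y * 1 \<le> y\<^sup>2 * real d" using yy dd y by (intro mult_mono) auto
        then show "y \<le> y\<^sup>2 * real d" by simp
        have "1 * x \<le> (9 * y\<^sup>2) * x" using yy x by (intro mult_right_mono) auto
        then show "x \<le> 9 * y\<^sup>2 * x" by simp
      qed
      then show ?thesis unfolding exp_add[symmetric] y_def[symmetric] by (simp add: algebra_simps)
    qed
    also have "exp (- x - (real j + 1)) \<le> exp (- x) * (1/2) ^ Suc j"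
    proof -
      have "exp (- x - (real j + 1)) = exp (- x) * exp (- 1) ^ Suc j"
        by (simp add: exp_of_nat_mult[symmetric] exp_add[symmetric] del: power_Suc)
      also have "\<dots> \<le> exp (- x) * (1/2) ^ Suc j"
      proof -
        have "exp (1::real) \<ge> 2" using exp_ge_add_one_self[of 1] by simp
        then have "exp (- 1) \<le> (1/2::real)" by (simp add: exp_minus field_simps)
        then show ?thesis by (intro mult_left_mono power_mono) auto
      qed
      finally show ?thesis .
    qed
    finally show "(\<Sum>t\<in>L (Suc j). 2 ^ n * (2 * exp (- (9 * (real j + 1)\<^sup>2 * (real d + x)))))
            \<le> 2 ^ n * (2 * exp (- x)) * (1/2) ^ Suc j"
      by (simp add: algebra_simps)
  qed
  also have "\<dots> = 2 ^ n * (2 * exp (- x)) * (\<Sum>j<J. (1/2) ^ Suc j)" by (simp add: sum_distrib_left)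
  also have "(\<Sum>j<J. (1/2::real) ^ Suc j) \<le> 1"
  proof -
    have "(\<Sum>j<J. (1/2::real) ^ Suc j) = 1 - (1/2) ^ J" by (induction J) auto
    then show ?thesis by simp
  qed
  finally show ?thesis unfolding Z_def by (simp add: mult_left_mono)
qed

section \<open>Uniform deviations over a class of finite VC dimension\<close>

definition vc_dim_le :: "'a set set \<Rightarrow> nat \<Rightarrow> bool" where
  "vc_dim_le H d \<longleftrightarrow> (\<forall>S. finite S \<and> shatters H S \<longrightarrow> card S \<le> d)"

definition hits :: "nat set \<Rightarrow> 'a set \<Rightarrow> (nat \<Rightarrow> 'a) \<Rightarrow> real" where
  "hits I A X = (\<Sum>i\<in>I. indicator A (X i))"

lemma vc_dim_le_subset: "vc_dim_le H d \<Longrightarrow> H' \<subseteq> H \<Longrightarrow> vc_dim_le H' d"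
  unfolding vc_dim_le_def shatters_def by (meson image_mono subset_trans)

text \<open>
  Passing from sets of points to sets of indices does not raise the VC dimension: a shattered set of
  indices cannot contain two indices of the same point.
\<close>

lemma card_le_if_shatters_traces:
  fixes X :: "'i \<Rightarrow> 'a"
  assumes H: "vc_dim_le H d" and S: "finite S" "S \<subseteq> W" "shatters ((\<lambda>A. {i\<in>W. X i \<in> A}) ` H) S"
  shows "card S \<le> d"
proof -
  have tr: "\<exists>A\<in>H. D = {i\<in>S. X i \<in> A}" if "D \<subseteq> S" for D
  proof -
    have "D \<in> (\<lambda>B. B \<inter> S) ` (\<lambda>A. {i\<in>W. X i \<in> A}) ` H"
      using S(3) that unfolding shatters_def by (meson PowI subsetD)
    then obtain A where "A \<in> H" "D = {i\<in>W. X i \<in> A} \<inter> S"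
      by (elim imageE) simp
    moreover from this have "{i\<in>W. X i \<in> A} \<inter> S = {i\<in>S. X i \<in> A}" using S(2) by auto
    ultimately show ?thesis by auto
  qed
  have inj: "inj_on X S"
  proof (rule inj_onI)
    fix i j assume ij: "i \<in> S" "j \<in> S" "X i = X j"
    obtain A where A: "{i} = {k\<in>S. X k \<in> A}" using tr[of "{i}"] ij by auto
    have "i \<in> {k\<in>S. X k \<in> A}" unfolding A[symmetric] by simp
    then have "j \<in> {k\<in>S. X k \<in> A}" using ij by simp
    then show "i = j" unfolding A[symmetric] by simp
  qed
  have "shatters H (X ` S)"
    unfolding shatters_def
  proof
    fix E assume E: "E \<in> Pow (X ` S)"
    obtain A where A: "A \<in> H" "{i\<in>S. X i \<in> E} = {i\<in>S. X i \<in> A}" using tr[of "{i\<in>S. X i \<in> E}"] by auto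
    have "X i \<in> E \<longleftrightarrow> X i \<in> A" if "i \<in> S" for i
      using arg_cong[OF A(2), of "\<lambda>B. i \<in> B"] that by simp
    then have "E = A \<inter> X ` S" using E by auto
    then show "E \<in> (\<lambda>A. A \<inter> X ` S) ` H" using A by blast
  qed
  then have "card (X ` S) \<le> d" using H S(1) unfolding vc_dim_le_def by blast
  then show ?thesis using card_image[OF inj] by simp
qed

lemma borel_measurable_hits:
  assumes "A \<in> sets M" "I \<subseteq> J"
  shows "hits I A \<in> borel_measurable (PiM J (\<lambda>_. M))"
  unfolding hits_def
  by (intro borel_measurable_sum measurable_compose[OF measurable_component_singleton]
      borel_measurable_indicator) (use assms in auto)

lemma (in prob_space) hits_concentration:
  assumes A: "A \<in> sets M" and I: "finite I" "I \<noteq> {}" and h: "h \<ge> 0"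
  shows "measure (PiM I (\<lambda>_. M)) {X\<in>space (PiM I (\<lambda>_. M)). \<bar>hits I A X - real (card I) * prob A\<bar> \<ge> h}
     \<le> 2 * exp (- 2 * h\<^sup>2 / real (card I))"
proof -
  interpret P: product_prob_space "\<lambda>_. M" I by unfold_locales
  have ind: "P.indep_vars (\<lambda>_. M) (\<lambda>i \<omega>. \<omega> i) I"
  proof (subst P.indep_vars_iff_distr_eq_PiM'[OF I(2)])
    show "(\<lambda>\<omega>. \<omega> i) \<in> measurable (PiM I (\<lambda>_. M)) M" if "i \<in> I" for i
      using that by measurable
    have "distr (PiM I (\<lambda>_. M)) (PiM I (\<lambda>_. M)) (\<lambda>x. \<lambda>i\<in>I. x i) = distr (PiM I (\<lambda>_. M)) (PiM I (\<lambda>_. M)) (\<lambda>x. x)"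
      by (rule distr_cong) (auto simp: space_PiM)
    also have "\<dots> = PiM I (\<lambda>_. M)" by simp
    also have "\<dots> = PiM I (\<lambda>i. distr (PiM I (\<lambda>_. M)) M (\<lambda>\<omega>. \<omega> i))"
      by (intro PiM_cong refl P.PiM_component[symmetric])
    finally show "distr (PiM I (\<lambda>_. M)) (PiM I (\<lambda>_. M)) (\<lambda>x. \<lambda>i\<in>I. x i)
       = PiM I (\<lambda>i. distr (PiM I (\<lambda>_. M)) M (\<lambda>\<omega>. \<omega> i))" .
  qed
  have ind': "P.indep_vars (\<lambda>_. borel) (\<lambda>i \<omega>. indicat_real A (\<omega> i)) I"
    using P.indep_vars_compose2[OF ind, of "\<lambda>_. indicat_real A" "\<lambda>_. borel"] A by simp
  interpret Hoeffding_ineq "PiM I (\<lambda>_. M)" I "\<lambda>i \<omega>. indicat_real A (\<omega> i)" "\<lambda>_. 0" "\<lambda>_. 1"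
     "\<Sum>i\<in>I. P.expectation (\<lambda>\<omega>. indicat_real A (\<omega> i))"
    by unfold_locales (use I ind' in \<open>auto simp: indicator_def\<close>)
  have "P.expectation (\<lambda>\<omega>. indicat_real A (\<omega> i)) = prob A" if "i \<in> I" for i
  proof -
    have "P.expectation (\<lambda>\<omega>. indicat_real A (\<omega> i)) = (\<integral>x. indicat_real A x \<partial>distr (PiM I (\<lambda>_. M)) M (\<lambda>\<omega>. \<omega> i))"
      using A that by (subst integral_distr) auto
    also have "\<dots> = (\<integral>x. indicat_real A x \<partial>M)" using that by (simp add: P.PiM_component)
    finally show ?thesis using A by simp
  qed
  then have e: "(\<Sum>i\<in>I. P.expectation (\<lambda>\<omega>. indicat_real A (\<omega> i))) = real (card I) * prob A" by simp
  show ?thesis using Hoeffding_ineq_abs_ge[OF h] I e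
    by (simp add: hits_def card_gt_0_iff)
qed

definition swap_halves :: "nat \<Rightarrow> nat set \<Rightarrow> nat \<Rightarrow> nat" where
  "swap_halves n \<sigma> i = (if i < n then (if i \<in> \<sigma> then n + i else i) else (if i - n \<in> \<sigma> then i - n else i))"

lemma swap_halves_swap_halves:
  "i < n + n \<Longrightarrow> \<sigma> \<subseteq> {..<n} \<Longrightarrow> swap_halves n \<sigma> (swap_halves n \<sigma> i) = i"
  by (auto simp: swap_halves_def)

lemma swap_halves_less: "i < n + n \<Longrightarrow> swap_halves n \<sigma> i < n + n"
  by (auto simp: swap_halves_def)

text \<open>
  Swapping a sample point with its ghost preserves the product law, so the probability equals its average
  over all \<open>2 ^ n\<close> swaps. The average is taken inside the integral, where the points are fixed and
  the swaps act as random signs.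
\<close>

lemma (in prob_space) symmetrized_deviation_le:
  assumes fin: "finite H" and HM: "H \<subseteq> sets M" and vc: "vc_dim_le H d"
    and n: "n \<ge> 1" and d: "d \<ge> 1" and x: "x \<ge> 0"
  defines "B \<equiv> 4 * sqrt (72 * real n * (real d + x))"
  shows "measure (PiM {..<n+n} (\<lambda>_. M)) {X\<in>space (PiM {..<n+n} (\<lambda>_. M)).
            \<exists>A\<in>H. \<bar>hits {..<n} A X - hits {n..<n+n} A X\<bar> > B} \<le> 2 * exp (- x)"
proof -
  let ?P = "PiM {..<n+n} (\<lambda>_. M)"
  define D where "D = {X\<in>space ?P. \<exists>A\<in>H. \<bar>hits {..<n} A X - hits {n..<n+n} A X\<bar> > B}"
  interpret P: product_prob_space "\<lambda>_. M" "{..<n+n}" by unfold_locales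
  have D[measurable]: "D \<in> sets ?P"
  proof -
    have "D = (\<Union>A\<in>H. {X\<in>space ?P. \<bar>hits {..<n} A X - hits {n..<n+n} A X\<bar> > B})"
      by (auto simp: D_def)
    also have "\<dots> \<in> sets ?P"
    proof (rule sets.finite_UN[OF fin])
      fix A assume "A \<in> H"
      then have [measurable]: "hits {..<n} A \<in> borel_measurable ?P" "hits {n..<n+n} A \<in> borel_measurable ?P"
        using HM by (auto intro!: borel_measurable_hits)
      show "{X\<in>space ?P. \<bar>hits {..<n} A X - hits {n..<n+n} A X\<bar> > B} \<in> sets ?P" by measurable
    qed
    finally show ?thesis .
  qed
  define T where "T = (\<lambda>\<sigma> X. \<lambda>i\<in>{..<n+n}. X (swap_halves n \<sigma> i) :: 'a)"
  have T: "T \<sigma> \<in> measurable ?P ?P" for \<sigma>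
    unfolding T_def by (intro measurable_restrict measurable_component_singleton) (auto simp: swap_halves_less)
  have distrT: "distr ?P ?P (T \<sigma>) = ?P" if "\<sigma> \<in> Pow {..<n}" for \<sigma>
    unfolding T_def
  proof (rule distr_PiM_reindex)
    show "inj_on (swap_halves n \<sigma>) {..<n+n}"
      using swap_halves_swap_halves[of _ n \<sigma>] that by (intro inj_on_inverseI[of _ "swap_halves n \<sigma>"]) auto
  qed (auto simp: swap_halves_less prob_space_axioms)
  have TD: "T \<sigma> -` D \<inter> space ?P \<in> sets ?P" for \<sigma> using T D by (rule measurable_sets)
  have eq: "measure ?P D = measure ?P (T \<sigma> -` D \<inter> space ?P)" if "\<sigma> \<in> Pow {..<n}" for \<sigma>
    using measure_distr[OF T D, of \<sigma>] distrT[OF that] by simp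
  have pt: "(\<Sum>\<sigma>\<in>Pow {..<n}. indicat_real (T \<sigma> -` D \<inter> space ?P) X) \<le> 2 ^ n * (2 * exp (- x))"
    if X: "X \<in> space ?P" for X
  proof -
    define tr where "tr = (\<lambda>A. {i\<in>{..<n+n}. X i \<in> A})"
    have hd: "hits {..<n} A (T \<sigma> X) - hits {n..<n+n} A (T \<sigma> X)
       = (\<Sum>i<n. flip_sign \<sigma> i * half_difference n (tr A) i)" if "\<sigma> \<in> Pow {..<n}" for \<sigma> A
    proof -
      have "hits {n..<n+n} A (T \<sigma> X) = (\<Sum>i<n. indicator A (T \<sigma> X (n + i)))"
        unfolding hits_def using sum.shift_bounds_nat_ivl[of "\<lambda>i. indicat_real A (T \<sigma> X i)" 0 n n]
        by (simp add: lessThan_atLeast0 add.commute)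
      then have "hits {..<n} A (T \<sigma> X) - hits {n..<n+n} A (T \<sigma> X)
        = (\<Sum>i<n. indicator A (T \<sigma> X i) - indicator A (T \<sigma> X (n + i)))"
        by (simp add: hits_def sum_subtractf)
      also have "\<dots> = (\<Sum>i<n. flip_sign \<sigma> i * half_difference n (tr A) i)"
      proof (rule sum.cong)
        fix i assume "i \<in> {..<n}"
        then show "indicator A (T \<sigma> X i) - indicator A (T \<sigma> X (n + i)) = flip_sign \<sigma> i * half_difference n (tr A) i"
          by (auto simp: T_def swap_halves_def flip_sign_def half_difference_def tr_def indicator_def)
      qed simp
      finally show ?thesis .
    qed
    have "(\<Sum>\<sigma>\<in>Pow {..<n}. indicat_real (T \<sigma> -` D \<inter> space ?P) X)
       = real (card {\<sigma>\<in>Pow {..<n}. T \<sigma> X \<in> D})"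
      using X by (simp add: indicator_def sum.If_cases Int_def)
    also have "{\<sigma>\<in>Pow {..<n}. T \<sigma> X \<in> D} = {\<sigma>\<in>Pow {..<n}. \<exists>t\<in>tr ` H. \<bar>\<Sum>i<n. flip_sign \<sigma> i * half_difference n t i\<bar> > B}"
      using hd measurable_space[OF T X] by (auto simp: D_def)
    also have "real (card \<dots>) \<le> 2 ^ n * (2 * exp (- x))"
      unfolding B_def
    proof (rule card_flip_sign_sup_le[OF _ _ n d x])
      show "tr ` H \<subseteq> Pow {..<n+n}" by (auto simp: tr_def)
      show "card S \<le> d" if "S \<subseteq> {..<n+n}" "shatters (tr ` H) S" for S
        using that finite_subset[OF that(1)] by (intro card_le_if_shatters_traces[OF vc, of S "{..<n+n}" X]) (auto simp: tr_def)
    qed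
    finally show ?thesis .
  qed
  have "2 ^ n * measure ?P D = (\<Sum>\<sigma>\<in>Pow {..<n}. measure ?P D)" by (simp add: card_Pow)
  also have "\<dots> = (\<Sum>\<sigma>\<in>Pow {..<n}. measure ?P (T \<sigma> -` D \<inter> space ?P))"
    by (intro sum.cong refl eq)
  also have "\<dots> = (\<Sum>\<sigma>\<in>Pow {..<n}. \<integral>X. indicat_real (T \<sigma> -` D \<inter> space ?P) X \<partial>?P)"
    using TD by simp
  also have "\<dots> = (\<integral>X. (\<Sum>\<sigma>\<in>Pow {..<n}. indicat_real (T \<sigma> -` D \<inter> space ?P) X) \<partial>?P)"
    using TD by (subst Bochner_Integration.integral_sum) (auto intro!: integrable_real_indicator simp: less_top[symmetric])
  also have "\<dots> \<le> 2 ^ n * (2 * exp (- x))"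
    using TD pt by (intro P.integral_le_const Bochner_Integration.integrable_sum integrable_real_indicator AE_I2)
      (auto simp: less_top[symmetric])
  finally show ?thesis by (simp add: D_def)
qed

text \<open>
  Symmetrization. When some set deviates by more than \<open>2 * B\<close> on the sample, that same set deviates by
  less than \<open>B\<close> on an independent ghost sample with probability at least one half, and then the two counts differ
  by more than \<open>B\<close>. The bound does not involve the number of sets, so it survives a limit over
  growing finite classes.
\<close>

lemma (in prob_space) uniform_deviation_finite:
  assumes fin: "finite H" and HM: "H \<subseteq> sets M" and vc: "vc_dim_le H d"
    and n: "n \<ge> 1" and d: "d \<ge> 1" and x: "x \<ge> 0"
  defines "B \<equiv> 4 * sqrt (72 * real n * (real d + x))"
  shows "measure (PiM {..<n} (\<lambda>_. M)) {X\<in>space (PiM {..<n} (\<lambda>_. M)).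
            \<exists>A\<in>H. \<bar>hits {..<n} A X - real n * prob A\<bar> > 2 * B} \<le> 4 * exp (- x)"
proof -
  let ?I = "{..<n}" and ?J = "{n..<n+n}"
  let ?P = "PiM ?I (\<lambda>_. M)" and ?Q = "PiM ?J (\<lambda>_. M)" and ?R = "PiM {..<n+n} (\<lambda>_. M)"
  interpret product_sigma_finite "\<lambda>_. M" by unfold_locales
  interpret P: product_prob_space "\<lambda>_. M" ?I by unfold_locales
  interpret Q: product_prob_space "\<lambda>_. M" ?J by unfold_locales
  interpret R: product_prob_space "\<lambda>_. M" "{..<n+n}" by unfold_locales
  have IJ: "?I \<union> ?J = {..<n+n}" "?I \<inter> ?J = {}" by auto
  define D where "D = {X\<in>space ?R. \<exists>A\<in>H. \<bar>hits ?I A X - hits ?J A X\<bar> > B}"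
  define E where "E = {X\<in>space ?P. \<exists>A\<in>H. \<bar>hits ?I A X - real n * prob A\<bar> > 2 * B}"
  have D: "D \<in> sets ?R"
  proof -
    have "D = (\<Union>A\<in>H. {X\<in>space ?R. \<bar>hits ?I A X - hits ?J A X\<bar> > B})"
      by (auto simp: D_def)
    also have "\<dots> \<in> sets ?R"
    proof (rule sets.finite_UN[OF fin])
      fix A assume "A \<in> H"
      then have [measurable]: "hits ?I A \<in> borel_measurable ?R" "hits ?J A \<in> borel_measurable ?R"
        using HM by (auto intro!: borel_measurable_hits)
      show "{X\<in>space ?R. \<bar>hits ?I A X - hits ?J A X\<bar> > B} \<in> sets ?R" by measurable
    qed
    finally show ?thesis .
  qed
  have E: "E \<in> sets ?P"
  proof -
    have "E = (\<Union>A\<in>H. {X\<in>space ?P. \<bar>hits ?I A X - real n * prob A\<bar> > 2 * B})"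
      by (auto simp: E_def)
    also have "\<dots> \<in> sets ?P"
    proof (rule sets.finite_UN[OF fin])
      fix A assume "A \<in> H"
      then have [measurable]: "hits ?I A \<in> borel_measurable ?P"
        using HM by (auto intro!: borel_measurable_hits)
      show "{X\<in>space ?P. \<bar>hits ?I A X - real n * prob A\<bar> > 2 * B} \<in> sets ?P" by measurable
    qed
    finally show ?thesis .
  qed
  have half: "emeasure ?Q ((\<lambda>Y. merge ?I ?J (X, Y)) -` D \<inter> space ?Q) \<ge> ennreal (1/2)" if X: "X \<in> E" for X
  proof -
    obtain A where A: "A \<in> H" "\<bar>hits ?I A X - real n * prob A\<bar> > 2 * B" and XP: "X \<in> space ?P"
      using X by (auto simp: E_def)
    have AM: "A \<in> sets M" using A HM by auto
    let ?G = "{Y\<in>space ?Q. \<bar>hits ?J A Y - real (card ?J) * prob A\<bar> \<ge> B}"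
    have [measurable]: "hits ?J A \<in> borel_measurable ?Q" using AM by (rule borel_measurable_hits) simp
    have G: "?G \<in> sets ?Q" by measurable
    have B0: "B \<ge> 0" using x by (simp add: B_def)
    \<comment> \<open>Only the set \<open>A\<close> picked from \<open>X\<close> matters here, so the tail bound for a single set suffices.\<close>
    have "measure ?Q ?G \<le> 2 * exp (- 2 * B\<^sup>2 / real (card ?J))"
      using AM n B0 by (intro hits_concentration) auto
    also have "2 * B\<^sup>2 / real (card ?J) = 2 * 16 * 72 * (real d + x)"
      using n x by (simp add: B_def power_mult_distrib)
    then have "2 * exp (- 2 * B\<^sup>2 / real (card ?J)) = 2 * exp (- (2 * 16 * 72 * (real d + x)))" by simp
    also have "\<dots> \<le> 2 * exp (- 3)" using d x by simp
    also have "\<dots> \<le> 1/2"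
    proof -
      have "exp (3::real) \<ge> 4" using exp_ge_add_one_self[of 3] by simp
      then show ?thesis by (simp add: exp_minus field_simps)
    qed
    finally have "measure ?Q ?G \<le> 1/2" .
    then have "measure ?Q (space ?Q - ?G) \<ge> 1/2" using Q.prob_compl[OF G] by simp
    moreover have mg: "(\<lambda>Y. merge ?I ?J (X, Y)) \<in> measurable ?Q ?R"
      using XP unfolding IJ(1)[symmetric] by measurable
    moreover have "measure ?Q (space ?Q - ?G) \<le> measure ?Q ((\<lambda>Y. merge ?I ?J (X, Y)) -` D \<inter> space ?Q)"
    proof (rule Q.finite_measure_mono)
      show "(\<lambda>Y. merge ?I ?J (X, Y)) -` D \<inter> space ?Q \<in> sets ?Q"
        by (rule measurable_sets[OF mg D])
      show "space ?Q - ?G \<subseteq> (\<lambda>Y. merge ?I ?J (X, Y)) -` D \<inter> space ?Q"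
      proof
        fix Y assume Y: "Y \<in> space ?Q - ?G"
        have h: "hits ?I A (merge ?I ?J (X, Y)) = hits ?I A X" "hits ?J A (merge ?I ?J (X, Y)) = hits ?J A Y"
          unfolding hits_def by (auto intro!: sum.cong simp: merge_def)
        have "merge ?I ?J (X, Y) \<in> space ?R"
          using measurable_space[OF mg] Y by blast
        moreover have "\<bar>hits ?J A Y - real n * prob A\<bar> < B" using Y by auto
        then have "\<bar>hits ?I A X - hits ?J A Y\<bar> > B" using A(2) by linarith
        then have "\<bar>hits ?I A (merge ?I ?J (X, Y)) - hits ?J A (merge ?I ?J (X, Y))\<bar> > B"
          unfolding h .
        ultimately have "merge ?I ?J (X, Y) \<in> D" using A(1) unfolding D_def by blast
        then show "Y \<in> (\<lambda>Y. merge ?I ?J (X, Y)) -` D \<inter> space ?Q" using Y by auto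
      qed
    qed
    ultimately show ?thesis unfolding Q.emeasure_eq_measure by (intro ennreal_leI) linarith
  qed
  have "ennreal (1/2) * emeasure ?P E = (\<integral>\<^sup>+X. ennreal (1/2) * indicator E X \<partial>?P)"
    using E by (simp add: nn_integral_cmult_indicator)
  also have "\<dots> \<le> (\<integral>\<^sup>+X. emeasure ?Q ((\<lambda>Y. merge ?I ?J (X, Y)) -` D \<inter> space ?Q) \<partial>?P)"
    using half by (intro nn_integral_mono) (auto simp: indicator_def)
  also have "\<dots> = emeasure ?R D"
    using emeasure_fold_integral[of ?I ?J D] D IJ by simp
  finally have "ennreal (1/2) * ennreal (measure ?P E) \<le> ennreal (measure ?R D)"
    unfolding P.emeasure_eq_measure R.emeasure_eq_measure .
  then have "ennreal (1/2 * measure ?P E) \<le> ennreal (measure ?R D)"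
    by (subst ennreal_mult'') auto
  then have "1/2 * measure ?P E \<le> measure ?R D" by (subst (asm) ennreal_le_iff) auto
  also have "\<dots> \<le> 2 * exp (- x)"
    unfolding D_def B_def by (rule symmetrized_deviation_le[OF fin HM vc n d x])
  finally show ?thesis by (simp add: E_def)
qed

text \<open>
  The exceptional events of the finite initial parts of an enumeration increase to the full one, and
  their bound does not depend on the number of sets.
\<close>

lemma (in prob_space) uniform_deviation_countable:
  assumes cnt: "countable H" and HM: "H \<subseteq> sets M" and vc: "vc_dim_le H d"
    and n: "n \<ge> 1" and d: "d \<ge> 1" and x: "x \<ge> 0"
  defines "E \<equiv> {X\<in>space (PiM {..<n} (\<lambda>_. M)).
            \<exists>A\<in>H. \<bar>hits {..<n} A X - real n * prob A\<bar> > 8 * sqrt (72 * real n * (real d + x))}"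
  shows "E \<in> sets (PiM {..<n} (\<lambda>_. M))" "measure (PiM {..<n} (\<lambda>_. M)) E \<le> 4 * exp (- x)"
proof -
  let ?P = "PiM {..<n} (\<lambda>_. M)"
  interpret P: product_prob_space "\<lambda>_. M" "{..<n}" by unfold_locales
  define F where "F = (\<lambda>A. {X\<in>space ?P. \<bar>hits {..<n} A X - real n * prob A\<bar> > 8 * sqrt (72 * real n * (real d + x))})"
  have F: "F A \<in> sets ?P" if "A \<in> H" for A
  proof -
    have [measurable]: "hits {..<n} A \<in> borel_measurable ?P"
      using that HM by (auto intro!: borel_measurable_hits)
    show ?thesis unfolding F_def by measurable
  qed
  have EF: "E = (\<Union>A\<in>H. F A)" by (auto simp: E_def F_def)
  show "E \<in> sets ?P" unfolding EF using cnt F by (intro sets.countable_UN') auto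
  show "measure ?P E \<le> 4 * exp (- x)"
  proof (cases "H = {}")
    case False
    define g where "g = from_nat_into H"
    have g: "range g = H" unfolding g_def using False cnt by (rule range_from_nat_into)
    define K where "K = (\<lambda>k. \<Union>A\<in>g ` {..<k}. F A)"
    have gH: "g i \<in> H" for i using g by auto
    have "E = (\<Union>k. K k)"
      unfolding EF K_def g[symmetric] by auto
    moreover have "(\<lambda>k. measure ?P (K k)) \<longlonglongrightarrow> measure ?P (\<Union>k. K k)"
    proof (rule P.finite_Lim_measure_incseq)
      show "range K \<subseteq> sets ?P" unfolding K_def using F gH by auto
      show "incseq K" unfolding K_def incseq_def by (auto intro: less_le_trans)
    qed
    moreover have "measure ?P (K k) \<le> 4 * exp (- x)" for k
    proof -
      have "K k = {X\<in>space ?P. \<exists>A\<in>g ` {..<k}. \<bar>hits {..<n} A X - real n * prob A\<bar>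
               > 2 * (4 * sqrt (72 * real n * (real d + x)))}"
        by (auto simp: K_def F_def)
      also have "measure ?P \<dots> \<le> 4 * exp (- x)"
        using gH HM vc_dim_le_subset[OF vc, of "g ` {..<k}"]
        by (intro uniform_deviation_finite n d x) auto
      finally show ?thesis .
    qed
    ultimately show ?thesis by (metis LIMSEQ_le_const2)
  qed (simp add: EF)
qed

section \<open>Halfspaces with a fixed set of active coordinates\<close>

definition halfspace :: "nat \<Rightarrow> (nat \<Rightarrow> real) \<Rightarrow> real \<Rightarrow> (nat \<Rightarrow> real) set" where
  "halfspace p u c = {x \<in> space (borel_vec p). dot p u x \<le> c}"

definition halfspaces_on :: "nat \<Rightarrow> nat set \<Rightarrow> (nat \<Rightarrow> real) set set" where
  "halfspaces_on p S = {halfspace p u c | u c. \<forall>i<p. i \<notin> S \<longrightarrow> u i = 0}"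

text \<open>
  Gaussian elimination: each equation removes one unknown, and at least one unknown remains free.
\<close>

lemma ex_nontrivial_linear_relation:
  fixes v :: "'l \<Rightarrow> 'w \<Rightarrow> real"
  assumes "finite L" "finite W" "card L < card W"
  shows "\<exists>a. (\<exists>w\<in>W. a w \<noteq> 0) \<and> (\<forall>l\<in>L. (\<Sum>w\<in>W. a w * v l w) = 0)"
  using assms
proof (induction L arbitrary: W v rule: finite_induct)
  case empty
  then have "W \<noteq> {}" by auto
  then show ?case by (intro exI[of _ "\<lambda>_. 1"]) auto
next
  case (insert l L)
  show ?case
  proof (cases "\<forall>w\<in>W. v l w = 0")
    case True
    have "card L < card W" using insert by simp
    with insert.IH[OF insert.prems(1)] obtain a where
      "\<exists>w\<in>W. a w \<noteq> 0" "\<forall>l\<in>L. (\<Sum>w\<in>W. a w * v l w) = 0" by blast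
    then show ?thesis using True by (intro exI[of _ a]) auto
  next
    case False
    then obtain w0 where w0: "w0 \<in> W" "v l w0 \<noteq> 0" by blast
    let ?W = "W - {w0}"
    define v' where "v' = (\<lambda>k w. v k w - v k w0 * v l w / v l w0)"
    have "card L < card ?W" using insert w0 by simp
    with insert.IH[of ?W v'] insert.prems obtain a where
      a: "\<exists>w\<in>?W. a w \<noteq> 0" "\<forall>k\<in>L. (\<Sum>w\<in>?W. a w * v' k w) = 0" by auto
    define b where "b = (\<lambda>w. if w = w0 then - (\<Sum>w\<in>?W. a w * v l w) / v l w0 else a w)"
    have sp: "(\<Sum>w\<in>W. b w * v k w) = (\<Sum>w\<in>?W. a w * v' k w)" for k
    proof -
      have "(\<Sum>w\<in>W. b w * v k w) = b w0 * v k w0 + (\<Sum>w\<in>?W. b w * v k w)"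
        using insert.prems w0 by (simp add: sum.remove)
      also have "(\<Sum>w\<in>?W. b w * v k w) = (\<Sum>w\<in>?W. a w * v k w)"
        by (intro sum.cong) (auto simp: b_def)
      also have "b w0 * v k w0 + (\<Sum>w\<in>?W. a w * v k w) = (\<Sum>w\<in>?W. a w * v' k w)"
      proof -
        have "b w0 * v k w0 = - (\<Sum>w\<in>?W. a w * (v k w0 * v l w / v l w0))"
          by (simp add: b_def sum_divide_distrib sum_distrib_left mult_ac)
        then show ?thesis by (simp add: v'_def right_diff_distrib sum_subtractf)
      qed
      finally show ?thesis .
    qed
    have "(\<Sum>w\<in>?W. a w * v' l w) = 0" using w0 by (simp add: v'_def)
    then have "\<forall>k\<in>Set.insert l L. (\<Sum>w\<in>W. b w * v k w) = 0" using sp a(2) by auto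
    moreover have "\<exists>w\<in>W. b w \<noteq> 0" using a(1) by (auto simp: b_def)
    ultimately show ?thesis by blast
  qed
qed

lemma dot_supported:
  assumes "S \<subseteq> {..<p}" "\<forall>i<p. i \<notin> S \<longrightarrow> u i = 0"
  shows "dot p u x = (\<Sum>i\<in>S. u i * x i)"
  unfolding dot_def using assms by (intro sum.mono_neutral_right) auto

text \<open>
  Dudley's argument. Among more than \<open>card S + 1\<close> points there is an affine relation with
  coefficients \<open>a\<close>. A halfspace that contains exactly the points with \<open>a w > 0\<close> makes every term
  \<open>a w * (c - dot p u w)\<close> nonnegative although they sum to zero, which forces \<open>a\<close> to vanish.
\<close>

lemma vc_dim_halfspaces_on:
  assumes S: "S \<subseteq> {..<p}"
  shows "vc_dim_le (halfspaces_on p S) (card S + 1)"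
  unfolding vc_dim_le_def
proof (intro allI impI, rule ccontr)
  fix W assume W: "finite W \<and> shatters (halfspaces_on p S) W" and "\<not> card W \<le> card S + 1"
  have finS: "finite S" using S finite_subset by blast
  let ?L = "Set.insert None (Some ` S)"
  define v where "v = (\<lambda>l (x :: nat \<Rightarrow> real). case l of None \<Rightarrow> 1 | Some i \<Rightarrow> x i)"
  have "card ?L = card S + 1" using finS by (simp add: card_image)
  then have "card ?L < card W" using \<open>\<not> card W \<le> card S + 1\<close> by simp
  then obtain a where a: "\<exists>w\<in>W. a w \<noteq> 0" "\<forall>l\<in>?L. (\<Sum>w\<in>W. a w * v l w) = 0"
    using ex_nontrivial_linear_relation[of ?L W v] finS W by auto
  have tr: "\<exists>u c. (\<forall>i<p. i \<notin> S \<longrightarrow> u i = 0) \<and> D = halfspace p u c \<inter> W" if "D \<subseteq> W" for D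
  proof -
    have "D \<in> (\<lambda>A. A \<inter> W) ` halfspaces_on p S"
      using W that unfolding shatters_def by (meson PowI subsetD)
    then show ?thesis unfolding halfspaces_on_def by auto
  qed
  have WS: "W \<subseteq> space (borel_vec p)"
    using tr[of W] by (auto simp: halfspace_def)
  obtain u c where u: "\<forall>i<p. i \<notin> S \<longrightarrow> u i = 0" and D: "{w\<in>W. a w > 0} = halfspace p u c \<inter> W"
    using tr[of "{w\<in>W. a w > 0}"] by auto
  have iff: "a w > 0 \<longleftrightarrow> dot p u w \<le> c" if "w \<in> W" for w
    using arg_cong[OF D, of "\<lambda>B. w \<in> B"] that WS by (auto simp: halfspace_def)
  have s0: "(\<Sum>w\<in>W. a w) = 0" using a(2) by (simp add: v_def)
  have si: "(\<Sum>w\<in>W. a w * w i) = 0" if "i \<in> S" for i using a(2) that by (auto simp: v_def)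
  have "(\<Sum>w\<in>W. a w * (c - dot p u w)) = c * (\<Sum>w\<in>W. a w) - (\<Sum>w\<in>W. a w * dot p u w)"
    by (simp add: right_diff_distrib sum_subtractf sum_distrib_left mult.commute)
  also have "(\<Sum>w\<in>W. a w * dot p u w) = (\<Sum>w\<in>W. \<Sum>i\<in>S. u i * (a w * w i))"
    by (simp add: dot_supported[OF S u] sum_distrib_left algebra_simps)
  also have "\<dots> = (\<Sum>i\<in>S. u i * (\<Sum>w\<in>W. a w * w i))"
    by (subst sum.swap) (simp add: sum_distrib_left)
  also have "\<dots> = 0" using si by simp
  finally have z: "(\<Sum>w\<in>W. a w * (c - dot p u w)) = 0" using s0 by simp
  have nn: "a w * (c - dot p u w) \<ge> 0" if "w \<in> W" for w
    using iff[OF that] by (cases "a w > 0") (auto simp: zero_le_mult_iff)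
  have "a w * (c - dot p u w) = 0" if "w \<in> W" for w
    using sum_nonneg_eq_0_iff[of W "\<lambda>w. a w * (c - dot p u w)"] nn z W that by auto
  then have "a w \<ge> 0" if "w \<in> W" for w using iff[OF that] that by fastforce
  then have "\<forall>w\<in>W. a w = 0" using s0 W sum_nonneg_eq_0_iff[of W a] by auto
  then show False using a(1) by blast
qed

lemma borel_measurable_dot: "dot p u \<in> borel_measurable (borel_vec p)"
proof -
  have "(\<lambda>x. x i) \<in> borel_measurable (borel_vec p)" if "i < p" for i
    using that measurable_component_singleton[of i "{..<p}" "\<lambda>_. borel"] by simp
  then show ?thesis unfolding dot_def
    by (intro borel_measurable_sum borel_measurable_times borel_measurable_const) auto
qed

lemma sets_halfspace: "halfspace p u c \<in> sets (borel_vec p)"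
proof -
  note [measurable] = borel_measurable_dot
  show ?thesis unfolding halfspace_def by measurable
qed

definition rational_halfspaces_on :: "nat \<Rightarrow> nat set \<Rightarrow> (nat \<Rightarrow> real) set set" where
  "rational_halfspaces_on p S =
     {halfspace p u c | u c. c \<in> \<rat> \<and> (\<forall>i. if i \<in> S then u i \<in> \<rat> else u i = 0)}"

lemma countable_rational_halfspaces_on:
  assumes "finite S" shows "countable (rational_halfspaces_on p S)"
proof -
  have cQ: "countable (\<rat> :: real set)" by (rule countable_rat)
  have "countable (PiE S (\<lambda>_. \<rat> :: real set))" using assms cQ by (intro countable_PiE) auto
  then have "countable ((\<lambda>(f, c). halfspace p (\<lambda>i. if i \<in> S then f i else 0) c) ` (PiE S (\<lambda>_. \<rat>) \<times> \<rat>))"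
    using cQ by (intro countable_image countable_SIGMA) auto
  moreover have "rational_halfspaces_on p S
      \<subseteq> (\<lambda>(f, c). halfspace p (\<lambda>i. if i \<in> S then f i else 0) c) ` (PiE S (\<lambda>_. \<rat>) \<times> \<rat>)"
  proof
    fix A assume "A \<in> rational_halfspaces_on p S"
    then obtain u c where A: "A = halfspace p u c" "c \<in> \<rat>" "\<And>i. if i \<in> S then u i \<in> \<rat> else u i = 0"
      unfolding rational_halfspaces_on_def by blast
    have "u = (\<lambda>i. if i \<in> S then restrict u S i else 0)" using A(3) by (auto simp: fun_eq_iff split: if_splits)
    moreover have "restrict u S \<in> PiE S (\<lambda>_. \<rat>)" using A(3) by (auto split: if_splits)
    ultimately show "A \<in> (\<lambda>(f, c). halfspace p (\<lambda>i. if i \<in> S then f i else 0) c) ` (PiE S (\<lambda>_. \<rat>) \<times> \<rat>)"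
      using A(1,2) by (intro image_eqI[of _ _ "(restrict u S, c)"]) auto
  qed
  ultimately show ?thesis by (rule countable_subset[rotated])
qed

text \<open>
  This makes uncountably many halfspaces accessible to a countable union of events. The threshold is
  approached from above at rate \<open>e k\<close> and the normal vector at the faster rate \<open>(e k)\<^sup>2\<close>, so that points
  on the boundary hyperplane are kept and the indicators converge at every point.
\<close>

lemma halfspace_rational_approximation:
  assumes S: "S \<subseteq> {..<p}" and u: "\<forall>i<p. i \<notin> S \<longrightarrow> u i = 0"
  obtains A where "\<And>k. A k \<in> rational_halfspaces_on p S"
    "\<And>x. x \<in> space (borel_vec p) \<Longrightarrow> (\<lambda>k. indicat_real (A k) x) \<longlonglongrightarrow> indicator (halfspace p u c) x"
proof -
  define e where "e = (\<lambda>k. 1 / real (Suc k))"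
  have e: "e k > 0" for k by (simp add: e_def)
  have elim: "e \<longlonglongrightarrow> 0" unfolding e_def by (rule LIMSEQ_Suc[OF lim_inverse_n'])
  have "\<exists>q\<in>\<rat>. c + e k < q \<and> q < c + 2 * e k" for k
    using Rats_dense_in_real[of "c + e k" "c + 2 * e k"] e[of k] by auto
  then obtain q where q: "\<And>k. q k \<in> \<rat>" "\<And>k. c + e k < q k" "\<And>k. q k < c + 2 * e k" by metis
  have "\<exists>r\<in>\<rat>. u i - (e k)\<^sup>2 < r \<and> r < u i + (e k)\<^sup>2" for i k
    using Rats_dense_in_real[of "u i - (e k)\<^sup>2" "u i + (e k)\<^sup>2"] e[of k] by auto
  then obtain r where r: "\<And>i k. r i k \<in> \<rat>" "\<And>i k. u i - (e k)\<^sup>2 < r i k" "\<And>i k. r i k < u i + (e k)\<^sup>2" by metis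
  define w where "w = (\<lambda>k i. if i \<in> S then r i k else 0)"
  have A: "halfspace p (w k) (q k) \<in> rational_halfspaces_on p S" for k
    unfolding rational_halfspaces_on_def w_def using q(1) r(1) by force
  have "(\<lambda>k. indicat_real (halfspace p (w k) (q k)) x) \<longlonglongrightarrow> indicator (halfspace p u c) x"
    if x: "x \<in> space (borel_vec p)" for x
  proof -
    define N where "N = (\<Sum>i\<in>S. \<bar>x i\<bar>)"
    have diff: "\<bar>dot p (w k) x - dot p u x\<bar> \<le> (e k)\<^sup>2 * N" for k
    proof -
      have "dot p (w k) x - dot p u x = (\<Sum>i\<in>S. (r i k - u i) * x i)"
        using S u dot_supported[OF S, of "w k" x] dot_supported[OF S u, of x]
        by (simp add: w_def left_diff_distrib sum_subtractf)
      also have "\<bar>\<dots>\<bar> \<le> (\<Sum>i\<in>S. \<bar>(r i k - u i) * x i\<bar>)" by (rule sum_abs)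
      also have "\<dots> \<le> (\<Sum>i\<in>S. (e k)\<^sup>2 * \<bar>x i\<bar>)"
        unfolding abs_mult using r(2,3)
        by (intro sum_mono mult_right_mono) (auto simp: abs_le_iff less_imp_le algebra_simps intro: add.commute)
      finally show ?thesis by (simp add: N_def sum_distrib_left)
    qed
    have N: "N \<ge> 0" by (simp add: N_def sum_nonneg)
    show ?thesis
    proof (cases "dot p u x \<le> c")
      case True
      have "(\<lambda>k. e k * N) \<longlonglongrightarrow> 0 * N" by (intro tendsto_intros elim)
      then have "eventually (\<lambda>k. e k * N < 1) sequentially" by (rule order_tendstoD) simp
      then have "eventually (\<lambda>k. indicat_real (halfspace p (w k) (q k)) x = 1) sequentially"
      proof eventually_elim
        case (elim k)
        have "(e k)\<^sup>2 * N = e k * (e k * N)" by (simp add: power2_eq_square)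
        also have "\<dots> \<le> e k * 1" using elim e[of k] by (intro mult_left_mono) auto
        finally have "dot p (w k) x \<le> dot p u x + e k" using diff[of k] by linarith
        then have "dot p (w k) x \<le> q k" using True q(2)[of k] by linarith
        then show ?case using x by (simp add: halfspace_def)
      qed
      then show ?thesis using True x by (intro tendsto_eventually) (simp add: halfspace_def)
    next
      case False
      have "(\<lambda>k. (e k)\<^sup>2 * N + 2 * e k) \<longlonglongrightarrow> 0\<^sup>2 * N + 2 * 0" by (intro tendsto_intros elim)
      then have "eventually (\<lambda>k. (e k)\<^sup>2 * N + 2 * e k < dot p u x - c) sequentially"
        by (rule order_tendstoD) (use False in simp)
      then have "eventually (\<lambda>k. indicat_real (halfspace p (w k) (q k)) x = 0) sequentially"
      proof eventually_elim
        case (elim k)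
        then have "q k < dot p (w k) x" using diff[of k] q(3)[of k] by linarith
        then show ?case by (simp add: halfspace_def)
      qed
      then show ?thesis using False by (intro tendsto_eventually) (simp add: halfspace_def)
    qed
  qed
  then show ?thesis using that[of "\<lambda>k. halfspace p (w k) (q k)"] A by blast
qed

text \<open>
  Both the empirical count and the probability pass to the limit along rational approximations, so the
  exceptional event of the countable class serves for all halfspaces.
\<close>

lemma halfspaces_on_uniform_deviation:
  assumes M: "prob_space M" and setsM: "sets M = sets (borel_vec p)"
    and S: "S \<subseteq> {..<p}" and n: "n \<ge> 1" and x: "x \<ge> 0"
  obtains E where "E \<in> sets (PiM {..<n} (\<lambda>_. M))" "measure (PiM {..<n} (\<lambda>_. M)) E \<le> 4 * exp (- x)"
    "\<And>X A. X \<in> space (PiM {..<n} (\<lambda>_. M)) - E \<Longrightarrow> A \<in> halfspaces_on p S \<Longrightarrow>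
       \<bar>hits {..<n} A X - real n * measure M A\<bar> \<le> 8 * sqrt (72 * real n * (real (card S + 1) + x))"
proof -
  interpret prob_space M by fact
  let ?P = "PiM {..<n} (\<lambda>_. M)"
  let ?b = "8 * sqrt (72 * real n * (real (card S + 1) + x))"
  have spM: "space M = space (borel_vec p)" using setsM by (rule sets_eq_imp_space_eq)
  have finS: "finite S" using S finite_subset by blast
  define E where "E = {X\<in>space ?P. \<exists>A\<in>rational_halfspaces_on p S. \<bar>hits {..<n} A X - real n * prob A\<bar> > ?b}"
  have sub: "rational_halfspaces_on p S \<subseteq> halfspaces_on p S"
  proof
    fix A assume "A \<in> rational_halfspaces_on p S"
    then obtain u c where A: "A = halfspace p u c" "\<And>i. if i \<in> S then u i \<in> \<rat> else u i = 0"
      unfolding rational_halfspaces_on_def by blast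
    then have "\<forall>i<p. i \<notin> S \<longrightarrow> u i = 0" by metis
    then show "A \<in> halfspaces_on p S" using A(1) unfolding halfspaces_on_def by blast
  qed
  have ms: "rational_halfspaces_on p S \<subseteq> sets M"
    unfolding rational_halfspaces_on_def setsM using sets_halfspace by blast
  note dev = uniform_deviation_countable[OF countable_rational_halfspaces_on[OF finS] ms
     vc_dim_le_subset[OF vc_dim_halfspaces_on[OF S] sub] n _ x, folded E_def]
  have lim: "\<bar>hits {..<n} A X - real n * prob A\<bar> \<le> ?b"
    if X: "X \<in> space ?P - E" and A: "A \<in> halfspaces_on p S" for X A
  proof -
    obtain u c where u: "\<forall>i<p. i \<notin> S \<longrightarrow> u i = 0" and Au: "A = halfspace p u c"
      using A unfolding halfspaces_on_def by blast
    obtain B where B: "\<And>k. B k \<in> rational_halfspaces_on p S"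
      "\<And>x. x \<in> space (borel_vec p) \<Longrightarrow> (\<lambda>k. indicat_real (B k) x) \<longlonglongrightarrow> indicator A x"
      using halfspace_rational_approximation[OF S u, of c] unfolding Au by blast
    have "(\<lambda>k. hits {..<n} (B k) X) \<longlonglongrightarrow> hits {..<n} A X"
      unfolding hits_def
    proof (intro tendsto_sum B(2))
      fix i assume "i \<in> {..<n}"
      then show "X i \<in> space (borel_vec p)" using X spM by (auto simp: space_PiM)
    qed
    moreover have "(\<lambda>k. prob (B k)) \<longlonglongrightarrow> prob A"
    proof -
      have "(\<lambda>k. \<integral>x. indicat_real (B k) x \<partial>M) \<longlonglongrightarrow> (\<integral>x. indicat_real A x \<partial>M)"
      proof (rule integral_dominated_convergence[where w="\<lambda>_. 1"])
        show "indicat_real A \<in> borel_measurable M"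
          using sets_halfspace[of p u c] by (simp add: Au setsM[symmetric])
        show "indicat_real (B k) \<in> borel_measurable M" for k using B(1)[of k] ms by auto
        show "AE x in M. (\<lambda>k. indicat_real (B k) x) \<longlonglongrightarrow> indicat_real A x"
          using B(2) spM by (intro AE_I2) auto
      qed (auto simp: indicator_def)
      moreover have "B k \<in> sets M" for k using B(1)[of k] ms by auto
      moreover have "A \<in> sets M" using sets_halfspace[of p u c] by (simp add: Au setsM)
      ultimately show ?thesis by simp
    qed
    ultimately have "(\<lambda>k. \<bar>hits {..<n} (B k) X - real n * prob (B k)\<bar>) \<longlonglongrightarrow> \<bar>hits {..<n} A X - real n * prob A\<bar>"
      by (intro tendsto_intros)
    moreover have "\<bar>hits {..<n} (B k) X - real n * prob (B k)\<bar> \<le> ?b" for k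
    proof (rule ccontr)
      assume "\<not> ?thesis"
      then have "X \<in> E" using X B(1)[of k] unfolding E_def by (auto simp: not_le)
      then show False using X by simp
    qed
    ultimately show ?thesis by (intro LIMSEQ_le_const2) auto
  qed
  show thesis
    using dev lim by (intro that[of E]) auto
qed

section \<open>Sparse halfspaces and slabs\<close>

text \<open>
  The usual entropy bound for the choice of a support: the subset count with \<open>y = s / p\<close>.
\<close>

lemma card_supports_le:
  assumes "1 \<le> s" "s \<le> p"
  shows "real (card {S. S \<subseteq> {..<p} \<and> card S = 2 * s}) \<le> exp (2 * (real s * ln (exp 1 * real p / real s)))"
proof -
  have "real (card {S. S \<subseteq> {..<p} \<and> card S = 2 * s}) \<le> real (card {S. S \<subseteq> {..<p} \<and> card S \<le> 2 * s})"
    by (intro of_nat_mono card_mono) auto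
  also have "\<dots> \<le> exp (real (2 * s) * ln (1 / (real s / real p)) + (real s / real p) * real (card {..<p}))"
    using assms by (intro card_small_subsets_le) auto
  also have "\<dots> \<le> exp (2 * (real s * ln (exp 1 * real p / real s)))"
  proof -
    have "ln (exp 1 * real p / real s) = 1 + ln (1 / (real s / real p))"
      using assms by (simp add: ln_mult ln_div)
    then show ?thesis using assms by (simp add: algebra_simps)
  qed
  finally show ?thesis .
qed

text \<open>
  A union bound over the supports. The exponent \<open>x\<close> spends \<open>2 * s * ln (e * p / s)\<close> on their number,
  \<open>ln (1 / \<delta>)\<close> on the confidence level, and 1 on
  bringing the constant factor 4 below 2.
\<close>

lemma sparse_halfspaces_uniform_deviation:
  assumes M: "prob_space M" and setsM: "sets M = sets (borel_vec p)"
    and s: "1 \<le> s" "2 * s \<le> p" and n: "n \<ge> 1" and \<delta>: "0 < \<delta>" "\<delta> \<le> 1"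
  defines "r \<equiv> real s * ln (exp 1 * real p / real s) + ln (1 / \<delta>)"
  obtains E where "E \<in> sets (PiM {..<n} (\<lambda>_. M))" "measure (PiM {..<n} (\<lambda>_. M)) E \<ge> 1 - 2 * \<delta>"
    "\<And>X S A. X \<in> E \<Longrightarrow> S \<subseteq> {..<p} \<Longrightarrow> card S = 2 * s \<Longrightarrow> A \<in> halfspaces_on p S \<Longrightarrow>
       \<bar>hits {..<n} A X - real n * measure M A\<bar> \<le> 167 * sqrt (real n * r)"
proof -
  interpret prob_space M by fact
  let ?P = "PiM {..<n} (\<lambda>_. M)"
  interpret P: product_prob_space "\<lambda>_. M" "{..<n}" by unfold_locales
  define L where "L = real s * ln (exp 1 * real p / real s)"
  define l where "l = ln (1 / \<delta>)"
  define x where "x = 2 * L + l + 1"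
  define \<S> where "\<S> = {S. S \<subseteq> {..<p} \<and> card S = 2 * s}"
  have l0: "l \<ge> 0" using \<delta> unfolding l_def by (intro ln_ge_zero) auto
  have Ls: "L \<ge> real s"
  proof -
    have "ln (exp 1 * real p / real s) = 1 + ln (real p / real s)"
      using s by (simp add: ln_mult ln_div)
    moreover have "ln (real p / real s) \<ge> 0" using s by (intro ln_ge_zero) (simp add: field_simps)
    ultimately have "real s * 1 \<le> real s * ln (exp 1 * real p / real s)" by (intro mult_left_mono) auto
    then show ?thesis by (simp add: L_def)
  qed
  have L0: "L \<ge> 0" using Ls s by linarith
  have x: "x \<ge> 0" using L0 l0 by (simp add: x_def)
  have fin: "finite \<S>" by (simp add: \<S>_def)
  define good where "good = (\<lambda>S E. E \<in> sets ?P \<and> measure ?P E \<le> 4 * exp (- x) \<and>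
     (\<forall>X\<in>space ?P - E. \<forall>A\<in>halfspaces_on p S.
       \<bar>hits {..<n} A X - real n * prob A\<bar> \<le> 8 * sqrt (72 * real n * (real (card S + 1) + x))))"
  have "\<exists>E. good S E" if "S \<in> \<S>" for S
  proof -
    have "S \<subseteq> {..<p}" using that by (simp add: \<S>_def)
    from halfspaces_on_uniform_deviation[OF M setsM this n x] show ?thesis
      unfolding good_def by metis
  qed
  then obtain E where E: "\<And>S. S \<in> \<S> \<Longrightarrow> good S (E S)" by metis
  define Bad where "Bad = (\<Union>S\<in>\<S>. E S)"
  have EP: "E S \<in> sets ?P" if "S \<in> \<S>" for S using E[OF that] by (simp add: good_def)
  have Bad: "Bad \<in> sets ?P" unfolding Bad_def using fin EP by (intro sets.finite_UN) auto
  have "measure ?P Bad \<le> (\<Sum>S\<in>\<S>. measure ?P (E S))"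
    unfolding Bad_def using fin EP by (intro P.finite_measure_subadditive_finite) auto
  also have "\<dots> \<le> (\<Sum>S\<in>\<S>. 4 * exp (- x))"
    using E by (intro sum_mono) (auto simp: good_def)
  also have "\<dots> = 4 * (real (card \<S>) * exp (- x))" by simp
  also have "\<dots> \<le> 4 * (exp (2 * L) * exp (- x))"
    using card_supports_le[of s p] s unfolding \<S>_def L_def by (intro mult_left_mono mult_right_mono) auto
  also have "exp (2 * L) * exp (- x) = exp (- 1) * \<delta>"
  proof -
    have "exp (2 * L) * exp (- x) = exp (- 1 + - l)" by (simp add: exp_add[symmetric] x_def)
    also have "\<dots> = exp (- 1) * exp (- l)" by (rule exp_add)
    also have "exp (- l) = \<delta>" using \<delta> by (simp add: l_def ln_div)
    finally show ?thesis .
  qed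
  also have "4 * (exp (- 1) * \<delta>) \<le> 2 * \<delta>"
  proof -
    have "exp (1::real) \<ge> 2" using exp_ge_add_one_self[of 1] by simp
    then have "exp (- 1) \<le> (1/2::real)" by (simp add: exp_minus field_simps)
    then show ?thesis using \<delta> by simp
  qed
  finally have "measure ?P Bad \<le> 2 * \<delta>" .
  then have pr: "measure ?P (space ?P - Bad) \<ge> 1 - 2 * \<delta>" using P.prob_compl[OF Bad] by simp
  have "\<bar>hits {..<n} A X - real n * prob A\<bar> \<le> 167 * sqrt (real n * r)"
    if "X \<in> space ?P - Bad" "S \<subseteq> {..<p}" "card S = 2 * s" "A \<in> halfspaces_on p S" for X S A
  proof -
    have S: "S \<in> \<S>" using that by (simp add: \<S>_def)
    have "X \<in> space ?P - E S" using that S by (auto simp: Bad_def)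
    then have "\<bar>hits {..<n} A X - real n * prob A\<bar> \<le> 8 * sqrt (72 * real n * (real (card S + 1) + x))"
      using E[OF S] that(4) unfolding good_def by blast
    also have "\<dots> = sqrt (64 * (72 * real n * (real (card S + 1) + x)))"
    proof -
      have "sqrt (64 * y) = 8 * sqrt y" for y by (subst real_sqrt_mult) simp
      then show ?thesis by (rule sym)
    qed
    also have "\<dots> \<le> sqrt (167\<^sup>2 * (real n * r))"
    proof (rule real_sqrt_le_mono)
      have "real (card S + 1) + x \<le> 6 * r"
        using that(3) Ls L0 l0 s by (simp add: x_def r_def L_def[symmetric] l_def[symmetric])
      then have "64 * (72 * real n * (real (card S + 1) + x)) \<le> 64 * (72 * real n * (6 * r))"
        by (intro mult_left_mono) auto
      also have "\<dots> = 27648 * (real n * r)" by simp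
      also have "\<dots> \<le> 167\<^sup>2 * (real n * r)"
        using L0 l0 by (intro mult_right_mono) (auto simp: r_def L_def[symmetric] l_def[symmetric])
      finally show "64 * (72 * real n * (real (card S + 1) + x)) \<le> 167\<^sup>2 * (real n * r)" .
    qed
    also have "\<dots> = 167 * sqrt (real n * r)" by (subst real_sqrt_mult) simp
    finally show ?thesis .
  qed
  then show thesis using Bad pr by (intro that[of "space ?P - Bad"]) auto
qed

lemma dot_uminus: "dot p (\<lambda>i. - u i) x = - dot p u x"
  by (simp add: dot_def sum_negf)

text \<open>
  The indicator of the inside of a slab is the sum of the indicators of two halfspaces minus 1. The
  outside is the disjoint union of two halfspaces, except at width 0, where it is the whole space.
\<close>

lemma slab_deviation:
  assumes M: "prob_space M" and setsM: "sets M = sets (borel_vec p)"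
    and u: "\<forall>i<p. i \<notin> S \<longrightarrow> u i = 0" and X: "\<And>i. i < n \<Longrightarrow> X i \<in> space M" and q: "q \<ge> 0"
    and dev: "\<And>A. A \<in> halfspaces_on p S \<Longrightarrow> \<bar>hits {..<n} A X - real n * measure M A\<bar> \<le> b"
    and b: "b \<ge> 0"
  shows "\<bar>(\<Sum>i<n. of_bool (\<bar>dot p u (X i)\<bar>\<^sup>2 \<le> q)) - real n * measure M {x\<in>space M. \<bar>dot p u x\<bar>\<^sup>2 \<le> q}\<bar> \<le> 2 * b"
    and "\<bar>(\<Sum>i<n. of_bool (\<bar>dot p u (X i)\<bar>\<^sup>2 \<ge> q)) - real n * measure M {x\<in>space M. \<bar>dot p u x\<bar>\<^sup>2 \<ge> q}\<bar> \<le> 2 * b"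
proof -
  interpret prob_space M by fact
  have spM: "space M = space (borel_vec p)" using setsM by (rule sets_eq_imp_space_eq)
  define c where "c = sqrt q"
  have c: "c \<ge> 0" "q = c\<^sup>2" using q by (auto simp: c_def)
  define A where "A = halfspace p u c"
  define B where "B = halfspace p (\<lambda>i. - u i) c"
  define A' where "A' = halfspace p u (- c)"
  define B' where "B' = halfspace p (\<lambda>i. - u i) (- c)"
  have sets[measurable]: "A \<in> sets M" "B \<in> sets M" "A' \<in> sets M" "B' \<in> sets M"
    using sets_halfspace by (auto simp: A_def B_def A'_def B'_def setsM)
  have on: "A \<in> halfspaces_on p S" "B \<in> halfspaces_on p S" "A' \<in> halfspaces_on p S" "B' \<in> halfspaces_on p S"
    unfolding halfspaces_on_def A_def B_def A'_def B'_def using u by force+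
  have split: "d\<^sup>2 \<le> q \<longleftrightarrow> d \<le> c \<and> - d \<le> c" "q \<le> d\<^sup>2 \<longleftrightarrow> d \<le> - c \<or> - d \<le> - c" for d
    using c abs_le_square_iff[of d c] abs_le_square_iff[of c d] by auto
  note m = A_def B_def A'_def B'_def halfspace_def spM dot_uminus split
  let ?Lo = "{x\<in>space M. \<bar>dot p u x\<bar>\<^sup>2 \<le> q}" and ?Hi = "{x\<in>space M. \<bar>dot p u x\<bar>\<^sup>2 \<ge> q}"
  have "?Lo = A \<inter> B" "A \<union> B = space M" using c(1) by (auto simp: m)
  then have pLo: "prob ?Lo = prob A + prob B - 1"
    using measure_Un3[of A M B] sets prob_space by (simp add: fmeasurable_eq_sets)
  have "(\<Sum>i<n. of_bool (\<bar>dot p u (X i)\<bar>\<^sup>2 \<le> q)) = (\<Sum>i<n. indicat_real A (X i) + indicat_real B (X i) - 1)"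
    using X c(1) by (intro sum.cong) (auto simp: m indicator_def)
  then have hLo: "(\<Sum>i<n. of_bool (\<bar>dot p u (X i)\<bar>\<^sup>2 \<le> q)) = hits {..<n} A X + hits {..<n} B X - real n"
    by (simp add: hits_def sum.distrib sum_subtractf)
  show "\<bar>(\<Sum>i<n. of_bool (\<bar>dot p u (X i)\<bar>\<^sup>2 \<le> q)) - real n * prob ?Lo\<bar> \<le> 2 * b"
    using dev[OF on(1)] dev[OF on(2)] unfolding hLo pLo by (simp add: algebra_simps)
  show "\<bar>(\<Sum>i<n. of_bool (\<bar>dot p u (X i)\<bar>\<^sup>2 \<ge> q)) - real n * prob ?Hi\<bar> \<le> 2 * b"
  proof (cases "c = 0")
    case True
    then have "q = 0" using c by simp
    then show ?thesis using b by (simp add: prob_space)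
  next
    case False
    then have "?Hi = A' \<union> B'" "A' \<inter> B' = {}" using c(1) by (auto simp: m)
    then have pHi: "prob ?Hi = prob A' + prob B'"
      using finite_measure_Union[of A' B'] sets by simp
    have "(\<Sum>i<n. of_bool (\<bar>dot p u (X i)\<bar>\<^sup>2 \<ge> q)) = (\<Sum>i<n. indicat_real A' (X i) + indicat_real B' (X i))"
      using X c(1) False by (intro sum.cong) (auto simp: m indicator_def)
    then have hHi: "(\<Sum>i<n. of_bool (\<bar>dot p u (X i)\<bar>\<^sup>2 \<ge> q)) = hits {..<n} A' X + hits {..<n} B' X"
      by (simp add: hits_def sum.distrib)
    show ?thesis
      using dev[OF on(3)] dev[OF on(4)] unfolding hHi pHi by (simp add: algebra_simps)
  qed
qed

lemma sparse_slabs_uniform_deviation: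
  assumes M: "prob_space M" and setsM: "sets M = sets (borel_vec p)"
    and s: "1 \<le> s" "2 * s \<le> p" and n: "n \<ge> 1" and \<delta>: "0 < \<delta>" "\<delta> \<le> 1"
  defines "h \<equiv> 334 * sqrt ((real s * ln (exp 1 * real p / real s) + ln (1 / \<delta>)) / real n)"
  obtains E where "E \<in> sets (PiM {..<n} (\<lambda>_. M))" "measure (PiM {..<n} (\<lambda>_. M)) E \<ge> 1 - 2 * \<delta>"
    "\<And>X u q. X \<in> E \<Longrightarrow> u \<in> sparse_directions p s \<Longrightarrow> q \<ge> 0 \<Longrightarrow>
       \<bar>(\<Sum>i<n. of_bool (\<bar>dot p u (X i)\<bar>\<^sup>2 \<le> q)) / real n - measure M {x\<in>space M. \<bar>dot p u x\<bar>\<^sup>2 \<le> q}\<bar> \<le> h"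
    "\<And>X u q. X \<in> E \<Longrightarrow> u \<in> sparse_directions p s \<Longrightarrow> q \<ge> 0 \<Longrightarrow>
       \<bar>(\<Sum>i<n. of_bool (\<bar>dot p u (X i)\<bar>\<^sup>2 \<ge> q)) / real n - measure M {x\<in>space M. \<bar>dot p u x\<bar>\<^sup>2 \<ge> q}\<bar> \<le> h"
proof -
  define r where "r = real s * ln (exp 1 * real p / real s) + ln (1 / \<delta>)"
  from sparse_halfspaces_uniform_deviation[OF M setsM s n \<delta>, folded r_def]
  obtain E where E: "E \<in> sets (PiM {..<n} (\<lambda>_. M))" "measure (PiM {..<n} (\<lambda>_. M)) E \<ge> 1 - 2 * \<delta>"
    "\<And>X S A. X \<in> E \<Longrightarrow> S \<subseteq> {..<p} \<Longrightarrow> card S = 2 * s \<Longrightarrow> A \<in> halfspaces_on p S \<Longrightarrow>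
       \<bar>hits {..<n} A X - real n * measure M A\<bar> \<le> 167 * sqrt (real n * r)" by metis
  have r0: "r \<ge> 0"
  proof -
    have "ln (exp 1 * real p / real s) = 1 + ln (real p / real s)"
      using s by (simp add: ln_mult ln_div)
    moreover have "ln (real p / real s) \<ge> 0" using s by (intro ln_ge_zero) (simp add: field_simps)
    moreover have "ln (1 / \<delta>) \<ge> 0" using \<delta> by (intro ln_ge_zero) auto
    ultimately show ?thesis unfolding r_def by (intro add_nonneg_nonneg mult_nonneg_nonneg) auto
  qed
  have conv: "\<bar>S / real n - m\<bar> \<le> h" if "\<bar>S - real n * m\<bar> \<le> 2 * (167 * sqrt (real n * r))" for S m
  proof -
    have "S / real n - m = (S - real n * m) / real n" using n by (simp add: field_simps)
    then have "\<bar>S / real n - m\<bar> = \<bar>S - real n * m\<bar> / real n" by (simp add: abs_divide)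
    also have "\<dots> \<le> 2 * (167 * sqrt (real n * r)) / real n"
      using that by (intro divide_right_mono) auto
    also have "\<dots> = 334 * (sqrt (real n * r) / real n)" by simp
    also have "sqrt (real n * r) / real n = sqrt (r / real n)"
    proof -
      have "real n * r = (real n)\<^sup>2 * (r / real n)" using n by (simp add: power2_eq_square)
      then have "sqrt (real n * r) = real n * sqrt (r / real n)"
        by (simp only: real_sqrt_mult real_sqrt_power) simp
      then show ?thesis using n by simp
    qed
    also have "334 * sqrt (r / real n) = h" by (simp only: h_def r_def)
    finally show ?thesis .
  qed
  have sub: "\<exists>S\<subseteq>{..<p}. card S = 2 * s \<and> (\<forall>i<p. i \<notin> S \<longrightarrow> u i = 0)" if "u \<in> sparse_directions p s" for u
    using that unfolding sparse_directions_def supported_directions_def by blast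
  have XM: "X i \<in> space M" if "X \<in> E" "i < n" for X i
    using sets.sets_into_space[OF E(1)] that by (auto simp: space_PiM)
  show thesis
  proof (rule that[OF E(1,2)])
    fix X u and q :: real assume X: "X \<in> E" and u: "u \<in> sparse_directions p s" and q: "q \<ge> 0"
    obtain S where S: "S \<subseteq> {..<p}" "card S = 2 * s" "\<forall>i<p. i \<notin> S \<longrightarrow> u i = 0" using sub[OF u] by blast
    have b0: "0 \<le> 167 * sqrt (real n * r)" using r0 by simp
    note dev = slab_deviation[OF M setsM S(3) XM[OF X] q E(3)[OF X S(1,2)] b0]
    show "\<bar>(\<Sum>i<n. of_bool (\<bar>dot p u (X i)\<bar>\<^sup>2 \<le> q)) / real n - measure M {x\<in>space M. \<bar>dot p u x\<bar>\<^sup>2 \<le> q}\<bar> \<le> h"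
      by (rule conv[OF dev(1)])
    show "\<bar>(\<Sum>i<n. of_bool (\<bar>dot p u (X i)\<bar>\<^sup>2 \<ge> q)) / real n - measure M {x\<in>space M. \<bar>dot p u x\<bar>\<^sup>2 \<ge> q}\<bar> \<le> h"
      by (rule conv[OF dev(2)])
  qed
qed

section \<open>Quadratic forms, the operator norm and the largest singular value\<close>

definition bilin :: "nat \<Rightarrow> (nat \<Rightarrow> nat \<Rightarrow> real) \<Rightarrow> (nat \<Rightarrow> real) \<Rightarrow> (nat \<Rightarrow> real) \<Rightarrow> real" where
  "bilin p A x y = (\<Sum>i<p. x i * (\<Sum>j<p. A i j * y j))"

lemma quad_bilin: "quad p A x = bilin p A x x"
  by (simp add: quad_def bilin_def sum_distrib_left mult.assoc)

lemma bilin_add: "bilin p A (\<lambda>i. x i + y i) z = bilin p A x z + bilin p A y z"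
  "bilin p A z (\<lambda>i. x i + y i) = bilin p A z x + bilin p A z y"
  by (simp_all add: bilin_def sum.distrib algebra_simps)

lemma bilin_scale: "bilin p A (\<lambda>i. c * x i) z = c * bilin p A x z"
  "bilin p A z (\<lambda>i. c * x i) = c * bilin p A z x"
  by (simp_all add: bilin_def sum_distrib_left algebra_simps)

lemma bilin_commute:
  assumes "\<forall>i<p. \<forall>j<p. A i j = A j i"
  shows "bilin p A x y = bilin p A y x"
proof -
  have "bilin p A x y = (\<Sum>i<p. \<Sum>j<p. x i * A i j * y j)"
    by (simp add: bilin_def sum_distrib_left mult.assoc)
  also have "\<dots> = (\<Sum>j<p. \<Sum>i<p. x i * A i j * y j)" by (rule sum.swap)
  also have "\<dots> = bilin p A y x"
    unfolding bilin_def sum_distrib_left using assms by (intro sum.cong) (auto simp: mult_ac)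
  finally show ?thesis .
qed

lemma quad_add_scaled:
  assumes "\<forall>i<p. \<forall>j<p. A i j = A j i"
  shows "quad p A (\<lambda>i. x i + t * y i) = quad p A x + 2 * t * bilin p A x y + t\<^sup>2 * quad p A y"
  using bilin_commute[OF assms, of y x]
  by (simp add: quad_bilin bilin_add bilin_scale algebra_simps power2_eq_square)

lemma quad_scale: "quad p A (\<lambda>i. c * x i) = c\<^sup>2 * quad p A x"
  by (simp add: quad_bilin bilin_scale power2_eq_square)

lemma quad_cong: "(\<And>i. i < p \<Longrightarrow> x i = y i) \<Longrightarrow> quad p A x = quad p A y"
  by (simp add: quad_def)

lemma quad_minus: "quad p (\<lambda>i j. A i j - B i j) x = quad p A x - quad p B x"
  by (simp add: quad_def algebra_simps sum_subtractf)

lemma unit_sphere_iff: "u \<in> unit_sphere p \<longleftrightarrow> u \<in> extensional {..<p} \<and> (\<Sum>i<p. (u i)\<^sup>2) = 1"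
  by (auto simp: unit_sphere_def L2_set_def PiE_def)

lemma quad_le_if_supported:
  assumes B: "\<And>u. u \<in> supported_directions p S \<Longrightarrow> quad p A u \<le> B"
    and w: "\<forall>i<p. i \<notin> S \<longrightarrow> w i = 0"
  shows "quad p A w \<le> B * (\<Sum>i<p. (w i)\<^sup>2)"
proof (cases "(\<Sum>i<p. (w i)\<^sup>2) = 0")
  case True
  then have "w i = 0" if "i < p" for i using that by (simp add: sum_nonneg_eq_0_iff)
  then have "quad p A w = 0" by (simp add: quad_def)
  then show ?thesis using True by simp
next
  case False
  define N where "N = (\<Sum>i<p. (w i)\<^sup>2)"
  have N: "N > 0" using False sum_nonneg[of "{..<p}" "\<lambda>i. (w i)\<^sup>2"] by (simp add: N_def)
  define u where "u = restrict (\<lambda>i. (1 / sqrt N) * w i) {..<p}"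
  have "(\<Sum>i<p. (u i)\<^sup>2) = (\<Sum>i<p. (w i)\<^sup>2 / N)"
    using N by (intro sum.cong) (auto simp: u_def power_mult_distrib power_divide)
  also have "\<dots> = 1" using N by (simp add: sum_divide_distrib[symmetric] N_def)
  finally have "u \<in> supported_directions p S"
    using w by (auto simp: supported_directions_def unit_sphere_iff u_def)
  then have "quad p A u \<le> B" by (rule B)
  also have "quad p A u = quad p A (\<lambda>i. (1 / sqrt N) * w i)"
    by (rule quad_cong) (simp add: u_def)
  also have "\<dots> = quad p A w / N" using N by (simp only: quad_scale) (simp add: power_divide)
  finally show ?thesis using N by (simp add: field_simps N_def)
qed

lemma supported_directions_all: "supported_directions p {..<p} = unit_sphere p"
  by (auto simp: supported_directions_def)

text \<open>
  In the product topology of \<open>nat \<Rightarrow> real\<close> the sphere is a closed part of a product of compact sets,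
  because its points take one fixed value outside \<open>{..<p}\<close>.
\<close>

lemma compact_unit_sphere: "compact (unit_sphere p)"
proof -
  define K where "K = PiE UNIV (\<lambda>i. if i < p then {-1..1} else {undefined :: real})"
  have "compactin (product_topology (\<lambda>_. euclidean) UNIV) K"
    unfolding K_def compactin_PiE by auto
  then have "compact K" by (simp add: euclidean_product_topology)
  moreover have "closed {u :: nat \<Rightarrow> real. (\<Sum>i<p. (u i)\<^sup>2) = 1}"
    by (intro closed_Collect_eq continuous_intros continuous_on_product_coordinates)
  moreover have "unit_sphere p = K \<inter> {u. (\<Sum>i<p. (u i)\<^sup>2) = 1}"
  proof -
    have "\<bar>u i\<bar> \<le> 1" if "(\<Sum>i<p. (u i)\<^sup>2) = 1" "i < p" for u :: "nat \<Rightarrow> real" and i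
    proof -
      have "(u i)\<^sup>2 \<le> (\<Sum>i<p. (u i)\<^sup>2)"
        using that member_le_sum[of i "{..<p}" "\<lambda>i. (u i)\<^sup>2"] by simp
      then show ?thesis using that by (simp add: abs_square_le_1)
    qed
    then show ?thesis
      by (auto simp: unit_sphere_iff K_def extensional_def PiE_iff abs_le_iff split: if_splits)
  qed
  ultimately show ?thesis by (simp add: compact_Int_closed)
qed

lemma basis_vector_in_unit_sphere:
  assumes "i < p" shows "restrict (\<lambda>k. of_bool (k = i)) {..<p} \<in> unit_sphere p"
  using assms by (simp add: unit_sphere_iff of_bool_def if_distrib[of "\<lambda>x. x\<^sup>2"] sum.delta' cong: if_cong)

lemma bdd_above_singular_values: "bdd_above (singular_values p A)"
proof -
  define B where "B = (\<Sum>i<p. \<Sum>k<p. \<bar>A k i\<bar> * (\<Sum>j<p. \<bar>A k j\<bar>))"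
  have "x \<le> sqrt B" if x: "x \<in> singular_values p A" for x
  proof -
    obtain v where v: "v \<in> unit_sphere p" "\<And>i. i < p \<Longrightarrow> (\<Sum>k<p. A k i * (\<Sum>j<p. A k j * v j)) = x\<^sup>2 * v i"
      using x unfolding singular_values_def by blast
    have v1: "\<bar>v i\<bar> \<le> 1" if "i < p" for i
    proof -
      have "(v i)\<^sup>2 \<le> (\<Sum>i<p. (v i)\<^sup>2)"
        using that member_le_sum[of i "{..<p}" "\<lambda>i. (v i)\<^sup>2"] by simp
      then show ?thesis using v(1) by (simp add: unit_sphere_iff abs_square_le_1)
    qed
    have "x\<^sup>2 = (\<Sum>i<p. v i * (x\<^sup>2 * v i))"
      using v(1) by (simp add: unit_sphere_iff power2_eq_square algebra_simps sum_distrib_left[symmetric])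
    also have "\<dots> = (\<Sum>i<p. v i * (\<Sum>k<p. A k i * (\<Sum>j<p. A k j * v j)))"
      using v(2) by simp
    also have "\<dots> \<le> (\<Sum>i<p. \<Sum>k<p. \<bar>A k i\<bar> * (\<Sum>j<p. \<bar>A k j\<bar>))"
    proof (rule sum_mono)
      fix i assume i: "i \<in> {..<p}"
      have "v i * (\<Sum>k<p. A k i * (\<Sum>j<p. A k j * v j)) \<le> \<bar>v i\<bar> * \<bar>\<Sum>k<p. A k i * (\<Sum>j<p. A k j * v j)\<bar>"
        unfolding abs_mult[symmetric] by (rule abs_ge_self)
      also have "\<dots> \<le> 1 * \<bar>\<Sum>k<p. A k i * (\<Sum>j<p. A k j * v j)\<bar>"
        using v1 i by (intro mult_right_mono) auto
      also have "\<dots> \<le> (\<Sum>k<p. \<bar>A k i * (\<Sum>j<p. A k j * v j)\<bar>)" by (simp add: sum_abs)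
      also have "\<dots> \<le> (\<Sum>k<p. \<bar>A k i\<bar> * (\<Sum>j<p. \<bar>A k j\<bar>))"
        unfolding abs_mult
      proof (intro sum_mono mult_left_mono)
        fix k
        have "\<bar>\<Sum>j<p. A k j * v j\<bar> \<le> (\<Sum>j<p. \<bar>A k j * v j\<bar>)" by (rule sum_abs)
        also have "\<dots> \<le> (\<Sum>j<p. \<bar>A k j\<bar>)"
          unfolding abs_mult using v1 by (intro sum_mono mult_left_le) auto
        finally show "\<bar>\<Sum>j<p. A k j * v j\<bar> \<le> (\<Sum>j<p. \<bar>A k j\<bar>)" .
      qed auto
      finally show "v i * (\<Sum>k<p. A k i * (\<Sum>j<p. A k j * v j)) \<le> (\<Sum>k<p. \<bar>A k i\<bar> * (\<Sum>j<p. \<bar>A k j\<bar>))" .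
    qed
    finally show ?thesis by (intro real_le_rsqrt) (simp add: B_def)
  qed
  then show ?thesis by (rule bdd_aboveI)
qed

text \<open>
  The quadratic form attains its maximum \<open>m\<close> on the sphere at some \<open>v\<close>. The form \<open>m * \<bar>w\<bar>\<^sup>2 - quad p G w\<close>
  is nonnegative and vanishes at \<open>v\<close>, so its derivative there is zero in every direction: \<open>v\<close> is an
  eigenvector for \<open>m\<close>, and \<open>m\<close> is a singular value.
\<close>

lemma quad_le_smax:
  assumes G: "psd p G" and p: "p \<ge> 1" and u: "u \<in> unit_sphere p"
  shows "quad p G u \<le> smax p G"
proof -
  have sym: "\<forall>i<p. \<forall>j<p. G i j = G j i" and nn: "\<And>u. 0 \<le> quad p G u" using G by (auto simp: psd_def)
  have "continuous_on (unit_sphere p) (quad p G)"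
    unfolding quad_def
    by (intro continuous_intros continuous_on_subset[OF continuous_on_product_coordinates]) auto
  then obtain v where v: "v \<in> unit_sphere p" "\<And>w. w \<in> unit_sphere p \<Longrightarrow> quad p G w \<le> quad p G v"
    using continuous_attains_sup[OF compact_unit_sphere] u by blast
  define m where "m = quad p G v"
  have v1: "(\<Sum>i<p. (v i)\<^sup>2) = 1" using v(1) by (simp add: unit_sphere_iff)
  have bound: "quad p G w \<le> m * (\<Sum>i<p. (w i)\<^sup>2)" for w
    using quad_le_if_supported[of p "{..<p}" G m w] v(2) by (auto simp: supported_directions_all m_def)
  have eig: "(\<Sum>j<p. G i j * v j) = m * v i" if i: "i < p" for i
  proof -
    define e :: "nat \<Rightarrow> real" where "e = (\<lambda>k. of_bool (k = i))"
    have e1: "(\<Sum>k<p. (e k)\<^sup>2) = 1"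
      using i by (simp add: e_def of_bool_def if_distrib[of "\<lambda>x. x\<^sup>2"] cong: if_cong)
    have ev: "(\<Sum>k<p. v k * e k) = v i"
      using i by (simp add: e_def of_bool_def if_distrib[of "\<lambda>x. _ * x"] cong: if_cong)
    have be: "bilin p G v e = (\<Sum>j<p. G i j * v j)"
    proof -
      have "bilin p G v e = bilin p G e v" by (rule bilin_commute[OF sym])
      also have "\<dots> = (\<Sum>j<p. G i j * v j)"
        using i by (simp add: bilin_def e_def of_bool_def if_distrib[of "\<lambda>x. x * _"] cong: if_cong)
      finally show ?thesis .
    qed
    define b where "b = m * v i - bilin p G v e"
    define c where "c = m - quad p G e"
    have c: "c \<ge> 0" using bound[of e] e1 by (simp add: c_def)
    have "0 \<le> 2 * t * b + t\<^sup>2 * c" for t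
    proof -
      have "(\<Sum>k<p. (v k + t * e k)\<^sup>2) = (\<Sum>k<p. (v k)\<^sup>2 + 2 * t * (v k * e k) + t\<^sup>2 * (e k)\<^sup>2)"
        by (intro sum.cong) (auto simp: power2_eq_square algebra_simps)
      also have "\<dots> = 1 + 2 * t * v i + t\<^sup>2"
        by (simp add: sum.distrib sum_distrib_left[symmetric] v1 e1 ev)
      finally have "quad p G v + 2 * t * bilin p G v e + t\<^sup>2 * quad p G e \<le> m * (1 + 2 * t * v i + t\<^sup>2)"
        using bound[of "\<lambda>k. v k + t * e k"] quad_add_scaled[OF sym, of v t e] by simp
      then show ?thesis by (simp add: b_def c_def m_def algebra_simps)
    qed
    \<comment> \<open>A quadratic without constant term that is nonnegative everywhere has no linear term; this value
      of \<open>t\<close> makes it negative unless \<open>b = 0\<close>, and \<open>c + 1\<close> is positive even when \<open>c\<close> vanishes.\<close>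
    from this[of "- b / (c + 1)"] have "0 \<le> (2 * (- b / (c + 1)) * b + (- b / (c + 1))\<^sup>2 * c) * (c + 1)\<^sup>2"
      by (intro mult_nonneg_nonneg) auto
    also have "\<dots> = - (b\<^sup>2 * (c + 2))"
    proof -
      have "2 * (- b / (c + 1)) * b * (c + 1)\<^sup>2 = - 2 * b * b * (c + 1)"
        using c by (simp add: power2_eq_square field_simps)
      moreover have "(- b / (c + 1))\<^sup>2 * c * (c + 1)\<^sup>2 = b * b * c"
      proof -
        have "(- b / k)\<^sup>2 * c * k\<^sup>2 = b * b * c" if "k \<noteq> 0" for k
          using that by (simp add: power2_eq_square)
        from this[of "c + 1"] show ?thesis using c by linarith
      qed
      ultimately show ?thesis by (simp add: algebra_simps power2_eq_square)
    qed
    finally have "b\<^sup>2 * (c + 2) \<le> 0" by simp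
    then have "b = 0" using c by (simp add: mult_le_0_iff)
    then show ?thesis using be by (simp add: b_def)
  qed
  have "m \<in> singular_values p G"
    unfolding singular_values_def
  proof (intro CollectI conjI bexI[OF _ v(1)] allI impI)
    show "0 \<le> m" using nn by (simp add: m_def)
    fix i assume i: "i < p"
    have "(\<Sum>k<p. G k i * (\<Sum>j<p. G k j * v j)) = (\<Sum>k<p. m * (G i k * v k))"
      using eig sym i by (intro sum.cong) auto
    also have "\<dots> = m\<^sup>2 * v i"
      by (simp add: sum_distrib_left[symmetric] eig[OF i] power2_eq_square)
    finally show "(\<Sum>k<p. G k i * (\<Sum>j<p. G k j * v j)) = m\<^sup>2 * v i" .
  qed
  then have "m \<le> smax p G" unfolding smax_def by (rule cSup_upper[OF _ bdd_above_singular_values])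
  then show ?thesis using v(2)[OF u] by (simp add: m_def)
qed

text \<open>
  For symmetric matrices the quadratic form controls the operator norm, by polarization applied to
  \<open>y = A u\<close> and \<open>u\<close> rescaled to the length \<open>N\<close> of \<open>y\<close>. The lower bound rests on boundedness of the
  set under the supremum.
\<close>

lemma op_norm_bounds:
  assumes sym: "\<forall>i<p. \<forall>j<p. A i j = A j i" and p: "p \<ge> 1"
    and B: "\<And>w. \<bar>quad p A w\<bar> \<le> B * (\<Sum>i<p. (w i)\<^sup>2)"
  shows "0 \<le> op_norm p A" "op_norm p A \<le> B"
proof -
  have le: "L2_set (\<lambda>i. \<Sum>j<p. A i j * u j) {..<p} \<le> B" if u: "u \<in> unit_sphere p" for u
  proof -
  from u have u1: "(\<Sum>i<p. (u i)\<^sup>2) = 1" by (simp add: unit_sphere_iff)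
  have B0: "B \<ge> 0" using B[of u] u1 by simp
  define y where "y = (\<lambda>i. \<Sum>j<p. A i j * u j)"
  define N where "N = L2_set y {..<p}"
  have N2: "N\<^sup>2 = (\<Sum>i<p. (y i)\<^sup>2)" by (simp add: N_def L2_set_def sum_nonneg)
  have N0: "N \<ge> 0" by (simp add: N_def L2_set_nonneg)
  have "bilin p A y u = N\<^sup>2" unfolding bilin_def N2 by (simp add: y_def power2_eq_square)
  moreover have "quad p A (\<lambda>i. y i + N * u i) - quad p A (\<lambda>i. y i + (- N) * u i) = 4 * N * bilin p A y u"
    unfolding quad_add_scaled[OF sym] by simp
  moreover have "quad p A (\<lambda>i. y i + N * u i) - quad p A (\<lambda>i. y i + (- N) * u i) \<le> 4 * B * N\<^sup>2"
  proof -
    have "quad p A (\<lambda>i. y i + N * u i) - quad p A (\<lambda>i. y i + (- N) * u i)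
        \<le> B * (\<Sum>i<p. (y i + N * u i)\<^sup>2) + B * (\<Sum>i<p. (y i + (- N) * u i)\<^sup>2)"
      using B[of "\<lambda>i. y i + N * u i"] B[of "\<lambda>i. y i + (- N) * u i"] by linarith
    also have "\<dots> = B * (\<Sum>i<p. 2 * (y i)\<^sup>2 + 2 * N\<^sup>2 * (u i)\<^sup>2)"
      unfolding distrib_left[symmetric] sum.distrib[symmetric]
      by (intro arg_cong[where f="\<lambda>x. B * x"] sum.cong) (auto simp: power2_eq_square algebra_simps)
    also have "\<dots> = 4 * B * N\<^sup>2"
      by (simp add: sum.distrib sum_distrib_left[symmetric] u1 N2[symmetric])
    finally show ?thesis .
  qed
  ultimately have "N * N\<^sup>2 \<le> B * N\<^sup>2" by simp
  then have "N \<le> B" using B0 N0 by (cases "N = 0") auto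
  then show ?thesis by (simp add: N_def y_def)
  qed
  have ne: "unit_sphere p \<noteq> {}" using basis_vector_in_unit_sphere[of 0 p] p by auto
  then show "op_norm p A \<le> B" unfolding op_norm_def using le by (rule cSUP_least)
  obtain u where u: "u \<in> unit_sphere p" using ne by blast
  have "bdd_above ((\<lambda>u. L2_set (\<lambda>i. \<Sum>j<p. A i j * u j) {..<p}) ` unit_sphere p)"
    using le by (rule bdd_aboveI2)
  from cSUP_upper2[OF this u, of 0] show "0 \<le> op_norm p A"
    unfolding op_norm_def by (simp add: L2_set_nonneg)
qed

text \<open>
  Off the diagonal the difference is supported on the union of the two sparse blocks, which fits into a
  set \<open>S\<close> of size \<open>2 * s\<close>. The form therefore splits into its restriction to \<open>S\<close>, which is controlled
  by the directions supported on \<open>S\<close>, and diagonal terms, which are controlled by the coordinate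
  directions; these are sparse as well.
\<close>

lemma op_norm_scatter_difference_le:
  assumes G: "G \<in> scatter_class p s" "G' \<in> scatter_class p s" and s: "1 \<le> s" "2 * s \<le> p"
    and B: "\<And>u. u \<in> sparse_directions p s \<Longrightarrow> \<bar>quad p G u - quad p G' u\<bar> \<le> B"
  shows "0 \<le> op_norm p (\<lambda>i j. G i j - G' i j)" "op_norm p (\<lambda>i j. G i j - G' i j) \<le> B"
proof -
  define D where "D = (\<lambda>i j. G i j - G' i j)"
  have sp: "\<exists>S\<subseteq>{..<p}. card S \<le> s \<and> (\<forall>i<p. \<forall>j<p. i \<noteq> j \<and> (i \<notin> S \<or> j \<notin> S) \<longrightarrow> H i j = 0)"
    if "H \<in> scatter_class p s" for H
    using that unfolding scatter_class_def sparse_matrices_def supported_on_def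
    by (simp split: if_splits) (metis diff_zero)
  obtain S1 where S1: "S1 \<subseteq> {..<p}" "card S1 \<le> s" "\<forall>i<p. \<forall>j<p. i \<noteq> j \<and> (i \<notin> S1 \<or> j \<notin> S1) \<longrightarrow> G i j = 0"
    using sp[OF G(1)] by blast
  obtain S2 where S2: "S2 \<subseteq> {..<p}" "card S2 \<le> s" "\<forall>i<p. \<forall>j<p. i \<noteq> j \<and> (i \<notin> S2 \<or> j \<notin> S2) \<longrightarrow> G' i j = 0"
    using sp[OF G(2)] by blast
  have "card (S1 \<union> S2) \<le> 2 * s" using card_Un_le[of S1 S2] S1(2) S2(2) by linarith
  then obtain S where S: "S1 \<union> S2 \<subseteq> S" "S \<subseteq> {..<p}" "card S = 2 * s"
    using exists_subset_between[of "S1 \<union> S2" "2 * s" "{..<p}"] S1(1) S2(1) s by auto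
  have D0: "D i j = 0" if "i < p" "j < p" "i \<noteq> j" "i \<notin> S \<or> j \<notin> S" for i j
    using S1(3) S2(3) S(1) that unfolding D_def by (metis UnCI diff_zero subsetD)
  have sym: "\<forall>i<p. \<forall>j<p. D i j = D j i"
  proof -
    have "psd p G" "psd p G'" using G by (auto simp: scatter_class_def)
    then show ?thesis by (simp add: D_def psd_def)
  qed
  have qD: "quad p D u = quad p G u - quad p G' u" for u
    unfolding D_def by (rule quad_minus)
  have diag: "\<bar>D i i\<bar> \<le> B" if i: "i < p" for i
  proof -
    define e where "e = restrict (\<lambda>k. of_bool (k = i) :: real) {..<p}"
    obtain T where T: "{i} \<subseteq> T" "T \<subseteq> {..<p}" "card T = 2 * s"
      using exists_subset_between[of "{i}" "2 * s" "{..<p}"] i s by auto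
    have "e \<in> supported_directions p T"
      using T basis_vector_in_unit_sphere[OF i] unfolding supported_directions_def e_def by auto
    then have "e \<in> sparse_directions p s" using T unfolding sparse_directions_def by blast
    moreover have "quad p D e = D i i"
    proof -
      have "quad p D e = (\<Sum>k<p. if k = i then (\<Sum>j<p. if j = i then D i i else 0) else 0)"
        unfolding quad_def by (intro sum.cong) (auto simp: e_def intro!: sum.cong sum.neutral)
      then show ?thesis using i by simp
    qed
    ultimately show ?thesis using B[of e] qD[of e] by simp
  qed
  have fin: "\<bar>quad p D w\<bar> \<le> B * (\<Sum>i<p. (w i)\<^sup>2)" for w
  proof -
    define w' where "w' = (\<lambda>i. if i \<in> S then w i else 0)"
    define R where "R = (\<Sum>i<p. if i \<in> S then 0 else D i i * (w i)\<^sup>2)"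
    have "quad p D w = (\<Sum>i<p. \<Sum>j<p. w' i * D i j * w' j + (if j = i then (if i \<in> S then 0 else D i i * (w i)\<^sup>2) else 0))"
      unfolding quad_def using D0
      by (intro sum.cong refl) (auto simp: w'_def power2_eq_square)
    also have "\<dots> = quad p D w' + R"
      by (simp add: quad_def R_def sum.distrib)
    finally have q: "quad p D w = quad p D w' + R" .
    have in_dir: "u \<in> sparse_directions p s" if "u \<in> supported_directions p S" for u
      using that S unfolding sparse_directions_def by blast
    have w'0: "\<forall>i<p. i \<notin> S \<longrightarrow> w' i = 0" by (simp add: w'_def)
    have "quad p D w' \<le> B * (\<Sum>i<p. (w' i)\<^sup>2)"
      using B[OF in_dir] qD by (intro quad_le_if_supported[OF _ w'0]) (simp add: abs_le_iff)
    moreover have "quad p (\<lambda>i j. 0 - D i j) w' \<le> B * (\<Sum>i<p. (w' i)\<^sup>2)"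
      using B[OF in_dir] qD
      by (intro quad_le_if_supported[OF _ w'0], unfold quad_minus) (fastforce simp: abs_le_iff quad_def)
    then have "- quad p D w' \<le> B * (\<Sum>i<p. (w' i)\<^sup>2)"
      unfolding quad_minus by (simp add: quad_def)
    moreover have "\<bar>R\<bar> \<le> (\<Sum>i<p. if i \<in> S then 0 else B * (w i)\<^sup>2)"
    proof -
      have "\<bar>R\<bar> \<le> (\<Sum>i<p. \<bar>if i \<in> S then 0 else D i i * (w i)\<^sup>2\<bar>)" unfolding R_def by (rule sum_abs)
      also have "\<dots> \<le> (\<Sum>i<p. if i \<in> S then 0 else B * (w i)\<^sup>2)"
        using diag by (intro sum_mono) (auto simp: abs_mult intro: mult_right_mono)
      finally show ?thesis .
    qed
    moreover have "B * (\<Sum>i<p. (w' i)\<^sup>2) + (\<Sum>i<p. if i \<in> S then 0 else B * (w i)\<^sup>2) = B * (\<Sum>i<p. (w i)\<^sup>2)"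
      unfolding sum_distrib_left sum.distrib[symmetric] by (intro sum.cong) (auto simp: w'_def)
    ultimately show ?thesis unfolding q by linarith
  qed
  show "0 \<le> op_norm p (\<lambda>i j. G i j - G' i j)" "op_norm p (\<lambda>i j. G i j - G' i j) \<le> B"
    unfolding D_def[symmetric] using op_norm_bounds[OF sym _ fin] s by auto
qed

section \<open>Elliptical and contaminated laws\<close>

text \<open>
  The unit ball has positive and finite volume because it contains a small cube and lies in a large one.
\<close>

lemma prob_space_uniform_sphere:
  assumes r: "1 \<le> r" shows "prob_space (uniform_sphere r)"
proof -
  let ?L = "PiM {..<r} (\<lambda>_. lborel :: real measure)"
  define B where "B = {z\<in>space ?L. L2_set z {..<r} \<le> 1}"
  interpret product_sigma_finite "\<lambda>_. lborel :: real measure" by unfold_locales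
  have comp[measurable]: "(\<lambda>z. z i) \<in> borel_measurable ?L" if "i < r" for i
    using that measurable_component_singleton[of i "{..<r}" "\<lambda>_. lborel"] by simp
  have L2[measurable]: "(\<lambda>z. L2_set z {..<r}) \<in> borel_measurable ?L"
  proof -
    have [measurable]: "(\<lambda>z. \<Sum>i<r. (z i)\<^sup>2) \<in> borel_measurable ?L"
      using comp by (intro borel_measurable_sum borel_measurable_power) auto
    show ?thesis unfolding L2_set_def by measurable
  qed
  have B: "B \<in> sets ?L" unfolding B_def by measurable
  have em: "emeasure ?L (PiE {..<r} (\<lambda>_. {a..b})) = ennreal (b - a) ^ r" if "a \<le> b" for a b :: real
    using that by (subst emeasure_PiM) auto
  have "B \<subseteq> PiE {..<r} (\<lambda>_. {-1..1})"
  proof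
    fix z assume z: "z \<in> B"
    have "\<bar>z i\<bar> \<le> 1" if "i < r" for i
    proof -
      have "\<bar>z i\<bar> \<le> L2_set (\<lambda>i. \<bar>z i\<bar>) {..<r}" using that by (intro member_le_L2_set) auto
      also have "\<dots> = L2_set z {..<r}" by (simp add: L2_set_def)
      also have "\<dots> \<le> 1" using z by (simp add: B_def)
      finally show ?thesis .
    qed
    then show "z \<in> PiE {..<r} (\<lambda>_. {-1..1})" using z by (auto simp: B_def space_PiM PiE_iff abs_le_iff)
  qed
  then have "emeasure ?L B \<le> emeasure ?L (PiE {..<r} (\<lambda>_. {-1..1}))"
    by (intro emeasure_mono sets_PiM_I_finite) auto
  also have "\<dots> < \<infinity>" by (subst em) (auto simp: power_less_top_ennreal)
  finally have fin: "emeasure ?L B \<noteq> \<infinity>" by simp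
  have "PiE {..<r} (\<lambda>_. {0..1 / real r}) \<subseteq> B"
  proof
    fix z assume z: "z \<in> PiE {..<r} (\<lambda>_. {0..1 / real r})"
    have zi: "0 \<le> z i" "z i \<le> 1 / real r" if "i \<in> {..<r}" for i
      using PiE_mem[OF z that] by simp_all
    have "L2_set z {..<r} \<le> (\<Sum>i<r. z i)" using zi(1) by (rule L2_set_le_sum)
    also have "\<dots> \<le> (\<Sum>i<r. 1 / real r)" using zi(2) by (rule sum_mono)
    also have "\<dots> = 1" using r by simp
    finally show "z \<in> B" using z by (simp add: B_def space_PiM PiE_def)
  qed
  then have "emeasure ?L (PiE {..<r} (\<lambda>_. {0..1 / real r})) \<le> emeasure ?L B"
    using B by (rule emeasure_mono)
  moreover have "emeasure ?L (PiE {..<r} (\<lambda>_. {0..1 / real r})) \<noteq> 0"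
    using r by (subst em) auto
  ultimately have pos: "emeasure ?L B \<noteq> 0" by auto
  interpret U: prob_space "uniform_measure ?L B" by (rule prob_space_uniform_measure[OF pos fin])
  show ?thesis
    unfolding uniform_sphere_def B_def[symmetric]
  proof (rule U.prob_space_distr)
    have "(\<lambda>z. \<lambda>i\<in>{..<r}. z i / L2_set z {..<r}) \<in> measurable ?L (borel_vec r)"
      by (intro measurable_restrict borel_measurable_divide) (auto intro: comp)
    then show "(\<lambda>z. \<lambda>i\<in>{..<r}. z i / L2_set z {..<r}) \<in> measurable (uniform_measure ?L B) (borel_vec r)"
      by (simp add: measurable_def)
  qed
qed

lemma sets_uniform_sphere: "sets (uniform_sphere r) = sets (borel_vec r)"
  by (simp add: uniform_sphere_def)

lemma elliptical_prob_space:
  assumes "elliptical p P \<Sigma> \<xi>"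
  shows "prob_space P" "sets P = sets (borel_vec p)"
proof -
  obtain r A where r: "1 \<le> r" and \<xi>: "prob_space \<xi>" "sets \<xi> = sets borel" and
    P: "P = distr (\<xi> \<Otimes>\<^sub>M uniform_sphere r) (borel_vec p)
              (\<lambda>(x, U). \<lambda>i\<in>{..<p}. x * (\<Sum>k<r. A i k * U k))"
    using assms unfolding elliptical_def by blast
  show "sets P = sets (borel_vec p)" by (simp add: P)
  interpret X: prob_space \<xi> by fact
  interpret U: prob_space "uniform_sphere r" using r by (rule prob_space_uniform_sphere)
  interpret XU: pair_prob_space \<xi> "uniform_sphere r" ..
  have snd: "(\<lambda>q. snd q k) \<in> borel_measurable (\<xi> \<Otimes>\<^sub>M uniform_sphere r)" if "k < r" for k
  proof -
    have "(\<lambda>U. U k) \<in> borel_measurable (uniform_sphere r)"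
      using that measurable_component_singleton[of k "{..<r}" "\<lambda>_. borel"]
      by (simp add: measurable_cong_sets[OF sets_uniform_sphere refl])
    then show ?thesis by (rule measurable_compose[OF measurable_snd])
  qed
  have fst: "fst \<in> borel_measurable (\<xi> \<Otimes>\<^sub>M uniform_sphere r)"
    using measurable_fst[of \<xi> "uniform_sphere r"] by (simp add: measurable_cong_sets[OF refl \<xi>(2)])
  have "(\<lambda>q. \<lambda>i\<in>{..<p}. fst q * (\<Sum>k<r. A i k * snd q k)) \<in> measurable (\<xi> \<Otimes>\<^sub>M uniform_sphere r) (borel_vec p)"
    by (intro measurable_restrict borel_measurable_times borel_measurable_sum borel_measurable_const fst snd) auto
  then show "prob_space P" unfolding P case_prod_beta by (intro XU.prob_space_distr)
qed

lemma sets_contaminated: "sets (contaminated \<epsilon> P Q) = sets P"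
  "space (contaminated \<epsilon> P Q) = space P"
  unfolding contaminated_def using sets.space_closed[of P] sets.sigma_sets_eq[of P] by auto

lemma measure_contaminated:
  assumes P: "prob_space P" and Q: "prob_space Q" and sQ: "sets Q = sets P" and B: "B \<in> sets P"
    and \<epsilon>: "0 \<le> \<epsilon>" "\<epsilon> \<le> 1"
  shows "measure (contaminated \<epsilon> P Q) B = (1 - \<epsilon>) * measure P B + \<epsilon> * measure Q B"
proof -
  interpret P: prob_space P by fact
  interpret Q: prob_space Q by fact
  have "emeasure (contaminated \<epsilon> P Q) B = ennreal ((1 - \<epsilon>) * measure P B + \<epsilon> * measure Q B)"
    unfolding emeasure_contaminated[OF sQ B] P.emeasure_eq_measure Q.emeasure_eq_measure
    using \<epsilon> by (simp add: ennreal_mult ennreal_plus)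
  moreover have "0 \<le> (1 - \<epsilon>) * measure P B + \<epsilon> * measure Q B"
    using \<epsilon> by (intro add_nonneg_nonneg mult_nonneg_nonneg) auto
  ultimately show ?thesis unfolding measure_def[of "contaminated \<epsilon> P Q"] by (simp only: enn2real_ennreal)
qed

lemma prob_space_contaminated:
  assumes P: "prob_space P" and Q: "prob_space Q" and sQ: "sets Q = sets P" and \<epsilon>: "0 \<le> \<epsilon>" "\<epsilon> \<le> 1"
  shows "prob_space (contaminated \<epsilon> P Q)"
proof
  have "emeasure P (space P) = 1" "emeasure Q (space P) = 1"
    using P Q sets_eq_imp_space_eq[OF sQ] by (metis prob_space.emeasure_space_1)+
  then show "emeasure (contaminated \<epsilon> P Q) (space (contaminated \<epsilon> P Q)) = 1"
    using \<epsilon> emeasure_contaminated[OF sQ sets.top, of \<epsilon>]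
    by (simp add: sets_contaminated ennreal_plus[symmetric] del: ennreal_plus)
qed

section \<open>The depth argument\<close>

text \<open>
  Inverting the marginal condition. Here \<open>r\<close> is the ratio of the two quadratic forms. Below 1 the value of
  \<open>G\<close> at \<open>r\<close> itself is informative. Above 1 only the probability of being strictly below \<open>r\<close> is
  controlled, hence the hypothesis about all \<open>t < r\<close> and a limit at the end.
\<close>

lemma ratio_near_one_if_cdf_near_half:
  fixes G :: "real \<Rightarrow> real"
  assumes mono: "mono G" and \<kappa>: "\<kappa> > 0" and \<Delta>: "0 \<le> \<Delta>" "\<Delta> < \<tau>"
    and far: "(INF t\<in>{t. \<alpha> \<le> \<bar>t\<bar>}. \<bar>G 1 - G (1 + t)\<bar>) \<ge> \<tau>"
    and near: "(INF t\<in>{t. 0 < \<bar>t\<bar> \<and> \<bar>t\<bar> < \<alpha>}. \<bar>G 1 - G (1 + t)\<bar> / \<bar>t\<bar>) \<ge> \<kappa> powr (- 1 / 2)"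
    and low: "G r \<ge> G 1 - \<Delta>" and up: "\<And>t. t < r \<Longrightarrow> G t \<le> G 1 + \<Delta>"
  shows "\<bar>r - 1\<bar> \<le> sqrt \<kappa> * \<Delta>"
proof -
  have key: "\<bar>t\<bar> \<le> sqrt \<kappa> * \<Delta>" if t: "t \<noteq> 0" "\<bar>G 1 - G (1 + t)\<bar> \<le> \<Delta>" for t
  proof -
    have "\<not> \<alpha> \<le> \<bar>t\<bar>"
    proof
      assume "\<alpha> \<le> \<bar>t\<bar>"
      then have "(INF t\<in>{t. \<alpha> \<le> \<bar>t\<bar>}. \<bar>G 1 - G (1 + t)\<bar>) \<le> \<bar>G 1 - G (1 + t)\<bar>"
        by (intro cINF_lower bdd_belowI2[of _ 0]) auto
      then show False using far t(2) \<Delta>(2) by linarith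
    qed
    then have "(INF t\<in>{t. 0 < \<bar>t\<bar> \<and> \<bar>t\<bar> < \<alpha>}. \<bar>G 1 - G (1 + t)\<bar> / \<bar>t\<bar>) \<le> \<bar>G 1 - G (1 + t)\<bar> / \<bar>t\<bar>"
      using t(1) by (intro cINF_lower bdd_belowI2[of _ 0]) auto
    then have "\<kappa> powr (- 1 / 2) \<le> \<bar>G 1 - G (1 + t)\<bar> / \<bar>t\<bar>" using near by linarith
    also have "\<dots> \<le> \<Delta> / \<bar>t\<bar>" using t(2) by (intro divide_right_mono) auto
    also have "\<kappa> powr (- 1 / 2) = 1 / sqrt \<kappa>"
      using \<kappa> by (simp add: powr_minus powr_half_sqrt inverse_eq_divide)
    finally show ?thesis using t(1) \<kappa> by (simp add: field_simps)
  qed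
  consider "r < 1" | "r = 1" | "r > 1" by linarith
  then show ?thesis
  proof cases
    case 1
    then have "G r \<le> G 1" using mono by (simp add: monoD)
    then show ?thesis using key[of "r - 1"] low 1 by simp
  next
    case 2
    then show ?thesis using \<Delta> \<kappa> by simp
  next
    case 3
    have "r - 1 \<le> sqrt \<kappa> * \<Delta>"
    proof (rule dense_le)
      fix t assume t: "t < r - 1"
      show "t \<le> sqrt \<kappa> * \<Delta>"
      proof (cases "t \<le> 0")
        case True
        then show ?thesis using \<Delta>(1) \<kappa> by (meson mult_nonneg_nonneg order_trans real_sqrt_ge_zero less_imp_le)
      next
        case False
        then have "G 1 \<le> G (1 + t)" using mono by (simp add: monoD)
        moreover have "G (1 + t) \<le> G 1 + \<Delta>" using t by (intro up) simp
        ultimately show ?thesis using key[of t] False by simp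
      qed
    qed
    then show ?thesis using 3 by simp
  qed
qed

lemma matrix_depth_le:
  assumes "u \<in> U"
  shows "matrix_depth p n U \<Gamma> X \<le> (\<Sum>i<n. of_bool (\<bar>dot p u (X i)\<bar>\<^sup>2 \<le> quad p \<Gamma> u)) / real n"
    "matrix_depth p n U \<Gamma> X \<le> (\<Sum>i<n. of_bool (\<bar>dot p u (X i)\<bar>\<^sup>2 \<ge> quad p \<Gamma> u)) / real n"
proof -
  have "matrix_depth p n U \<Gamma> X \<le> min
        ((\<Sum>i<n. of_bool (\<bar>dot p u (X i)\<bar>\<^sup>2 \<le> quad p \<Gamma> u)) / real n)
        ((\<Sum>i<n. of_bool (\<bar>dot p u (X i)\<bar>\<^sup>2 \<ge> quad p \<Gamma> u)) / real n)"
    unfolding matrix_depth_def using assms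
    by (intro cINF_lower bdd_belowI2[of _ 0]) (auto intro!: divide_nonneg_nonneg sum_nonneg)
  then show "matrix_depth p n U \<Gamma> X \<le> (\<Sum>i<n. of_bool (\<bar>dot p u (X i)\<bar>\<^sup>2 \<le> quad p \<Gamma> u)) / real n"
    "matrix_depth p n U \<Gamma> X \<le> (\<Sum>i<n. of_bool (\<bar>dot p u (X i)\<bar>\<^sup>2 \<ge> quad p \<Gamma> u)) / real n"
    by auto
qed

lemma sparse_directions_nonempty:
  assumes "1 \<le> s" "2 * s \<le> p" shows "sparse_directions p s \<noteq> {}"
proof -
  have "{..<2 * s} \<subseteq> {..<p}" using assms by auto
  moreover have "restrict (\<lambda>k. of_bool (k = 0)) {..<p} \<in> supported_directions p {..<2 * s}"
    using basis_vector_in_unit_sphere[of 0 p] assms by (auto simp: supported_directions_def)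
  ultimately show ?thesis unfolding sparse_directions_def by fastforce
qed

lemma sparse_directions_unit: "u \<in> sparse_directions p s \<Longrightarrow> u \<in> unit_sphere p"
  by (auto simp: sparse_directions_def supported_directions_def)

text \<open>
  The depth argument in a single direction: \<open>\<Gamma>\<close> has depth at least \<open>(1 - \<epsilon>) / 2 - h\<close>, so has
  the maximiser, and removing contamination and sampling error again leaves \<open>P\<close>-probability at
  least \<open>1/2 - \<Delta>\<close> both on the slab of the maximiser and on its closed outside.
\<close>

lemma deepest_scatter_direction_bound:
  fixes h :: real
  assumes P: "prob_space P" "sets P = sets (borel_vec p)" and Q: "prob_space Q" "sets Q = sets P"
    and \<epsilon>: "0 \<le> \<epsilon>" "\<epsilon> < 1"
    and s: "1 \<le> s" "2 * s \<le> p"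
    and \<Gamma>: "\<Gamma> \<in> scatter_class p s" and half: "\<forall>u\<in>unit_sphere p. proj_cdf p P \<Gamma> u 1 = 1 / 2"
    and mc: "marginal_condition p P \<Gamma> \<tau> \<alpha> \<kappa>"
    and deep: "deepest_sparse_scatter p s n X \<Gamma>h"
    and le: "\<And>u q. u \<in> sparse_directions p s \<Longrightarrow> q \<ge> 0 \<Longrightarrow>
       \<bar>(\<Sum>i<n. of_bool (\<bar>dot p u (X i)\<bar>\<^sup>2 \<le> q)) / real n
          - measure (contaminated \<epsilon> P Q) {x\<in>space (contaminated \<epsilon> P Q). \<bar>dot p u x\<bar>\<^sup>2 \<le> q}\<bar> \<le> h"
    and ge: "\<And>u q. u \<in> sparse_directions p s \<Longrightarrow> q \<ge> 0 \<Longrightarrow>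
       \<bar>(\<Sum>i<n. of_bool (\<bar>dot p u (X i)\<bar>\<^sup>2 \<ge> q)) / real n
          - measure (contaminated \<epsilon> P Q) {x\<in>space (contaminated \<epsilon> P Q). \<bar>dot p u x\<bar>\<^sup>2 \<ge> q}\<bar> \<le> h"
    and small: "(\<epsilon> + 2 * h) / (1 - \<epsilon>) < \<tau>" and h: "h \<ge> 0"
    and u: "u \<in> sparse_directions p s"
  shows "\<bar>quad p \<Gamma>h u - quad p \<Gamma> u\<bar> \<le> quad p \<Gamma> u * (sqrt \<kappa> * ((\<epsilon> + 2 * h) / (1 - \<epsilon>)))"
proof -
  interpret P: prob_space P by fact
  interpret Q: prob_space Q by fact
  have dotP[measurable]: "dot p v \<in> borel_measurable P" for v
    using borel_measurable_dot by (simp add: measurable_cong_sets[OF P(2) refl])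
  define Lo where "Lo = (\<lambda>v q. {x\<in>space P. \<bar>dot p v x\<bar>\<^sup>2 \<le> q})"
  define Hi where "Hi = (\<lambda>v q. {x\<in>space P. \<bar>dot p v x\<bar>\<^sup>2 \<ge> q})"
  have sLo[measurable]: "Lo v q \<in> sets P" for v q unfolding Lo_def by measurable
  have sHi[measurable]: "Hi v q \<in> sets P" for v q unfolding Hi_def by measurable
  have mono: "measure P B * (1 - \<epsilon>) \<le> measure (contaminated \<epsilon> P Q) B"
    "measure (contaminated \<epsilon> P Q) B \<le> measure P B * (1 - \<epsilon>) + \<epsilon>" if "B \<in> sets P" for B
    using measure_contaminated[OF P(1) Q(1) Q(2) that, of \<epsilon>] \<epsilon> Q.prob_le_1[of B] measure_nonneg[of Q B]
    by (auto simp: mult.commute mult_left_le)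
  have le': "\<bar>(\<Sum>i<n. of_bool (\<bar>dot p v (X i)\<bar>\<^sup>2 \<le> q)) / real n - measure (contaminated \<epsilon> P Q) (Lo v q)\<bar> \<le> h"
    if "v \<in> sparse_directions p s" "q \<ge> 0" for v q
    using le[OF that] by (simp only: Lo_def sets_contaminated)
  have ge': "\<bar>(\<Sum>i<n. of_bool (\<bar>dot p v (X i)\<bar>\<^sup>2 \<ge> q)) / real n - measure (contaminated \<epsilon> P Q) (Hi v q)\<bar> \<le> h"
    if "v \<in> sparse_directions p s" "q \<ge> 0" for v q
    using ge[OF that] by (simp only: Hi_def sets_contaminated)
  have \<Gamma>0: "quad p \<Gamma> v \<ge> 0" for v using \<Gamma> by (simp add: scatter_class_def psd_def)
  have \<Gamma>h: "\<Gamma>h \<in> scatter_class p s"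
    "matrix_depth p n (sparse_directions p s) \<Gamma> X \<le> matrix_depth p n (sparse_directions p s) \<Gamma>h X"
    using deep \<Gamma> by (auto simp: deepest_sparse_scatter_def is_arg_max_def not_less)
  have \<Gamma>h0: "quad p \<Gamma>h v \<ge> 0" for v using \<Gamma>h by (simp add: scatter_class_def psd_def)
  \<comment> \<open>Division by zero gives 0, so a direction with vanishing form would have all its mass below 1,
    which contradicts the canonical normalisation.\<close>
  have pos: "quad p \<Gamma> v > 0" if "v \<in> unit_sphere p" for v
  proof (rule ccontr)
    assume "\<not> ?thesis"
    then have "quad p \<Gamma> v = 0" using \<Gamma>0[of v] by simp
    then have "proj_cdf p P \<Gamma> v 1 = 1" by (simp add: proj_cdf_def P.prob_space)
    then show False using half that by simp
  qed
  have cdf: "proj_cdf p P \<Gamma> v t = measure P (Lo v (quad p \<Gamma> v * t))" if "v \<in> unit_sphere p" for v t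
    using pos[OF that] by (simp add: proj_cdf_def Lo_def divide_le_eq mult.commute)
  have depth: "(1 - \<epsilon>) / 2 - h \<le> matrix_depth p n (sparse_directions p s) \<Gamma> X"
    unfolding matrix_depth_def
  proof (rule cINF_greatest[OF sparse_directions_nonempty[OF s]])
    fix v assume v: "v \<in> sparse_directions p s"
    have pl: "measure P (Lo v (quad p \<Gamma> v)) = 1 / 2"
      using cdf[of v 1] half sparse_directions_unit[OF v] by simp
    have "space P - Lo v (quad p \<Gamma> v) \<subseteq> Hi v (quad p \<Gamma> v)" by (auto simp: Lo_def Hi_def)
    then have "measure P (space P - Lo v (quad p \<Gamma> v)) \<le> measure P (Hi v (quad p \<Gamma> v))"
      by (intro P.finite_measure_mono) auto
    then have ph: "measure P (Hi v (quad p \<Gamma> v)) \<ge> 1 / 2" using P.prob_compl[OF sLo] pl by simp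
    have "1 / 2 * (1 - \<epsilon>) \<le> measure P (Hi v (quad p \<Gamma> v)) * (1 - \<epsilon>)"
      using ph \<epsilon> by (intro mult_right_mono) auto
    moreover have "measure P (Lo v (quad p \<Gamma> v)) * (1 - \<epsilon>) = 1 / 2 * (1 - \<epsilon>)" using pl by simp
    ultimately show "(1 - \<epsilon>) / 2 - h \<le> min
        ((\<Sum>i<n. of_bool (\<bar>dot p v (X i)\<bar>\<^sup>2 \<le> quad p \<Gamma> v)) / real n)
        ((\<Sum>i<n. of_bool (\<bar>dot p v (X i)\<bar>\<^sup>2 \<ge> quad p \<Gamma> v)) / real n)"
      using le'[OF v \<Gamma>0, of v] ge'[OF v \<Gamma>0, of v]
        mono(1)[OF sLo[of v "quad p \<Gamma> v"]] mono(1)[OF sHi[of v "quad p \<Gamma> v"]]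
      unfolding min.bounded_iff abs_le_iff by linarith
  qed
  define \<Delta> where "\<Delta> = (\<epsilon> + 2 * h) / (1 - \<epsilon>)"
  have \<Delta>0: "\<Delta> \<ge> 0" using \<epsilon> h by (simp add: \<Delta>_def)
  have conv: "m \<ge> 1 / 2 - \<Delta>" if "(1 - \<epsilon>) / 2 - 2 * h \<le> m * (1 - \<epsilon>) + \<epsilon>" for m
  proof -
    have "(1 / 2 - \<Delta>) * (1 - \<epsilon>) \<le> m * (1 - \<epsilon>)"
      using that \<epsilon> by (simp add: \<Delta>_def left_diff_distrib)
    then show ?thesis using \<epsilon> by (simp add: mult_le_cancel_right)
  qed
  have uu: "u \<in> unit_sphere p" by (rule sparse_directions_unit[OF u])
  note d = depth \<Gamma>h(2)
  have plo: "measure P (Lo u (quad p \<Gamma>h u)) \<ge> 1 / 2 - \<Delta>"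
    using le'[OF u \<Gamma>h0, of u] mono(2)[OF sLo[of u "quad p \<Gamma>h u"]] matrix_depth_le(1)[OF u, of p n \<Gamma>h X] d
    unfolding abs_le_iff by (intro conv) linarith
  have phi: "measure P (Hi u (quad p \<Gamma>h u)) \<ge> 1 / 2 - \<Delta>"
    using ge'[OF u \<Gamma>h0, of u] mono(2)[OF sHi[of u "quad p \<Gamma>h u"]] matrix_depth_le(2)[OF u, of p n \<Gamma>h X] d
    unfolding abs_le_iff by (intro conv) linarith
  define q where "q = quad p \<Gamma> u"
  have q: "q > 0" using pos[OF uu] by (simp add: q_def)
  define r where "r = quad p \<Gamma>h u / q"
  have qr: "q * r = quad p \<Gamma>h u" using q by (simp add: r_def)
  define G where "G = proj_cdf p P \<Gamma> u"
  have G: "G t = measure P (Lo u (q * t))" for t using cdf[OF uu] by (simp add: G_def q_def)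
  have G1: "G 1 = 1 / 2" using half uu by (simp add: G_def)
  have monoG: "mono G"
  proof (rule monoI)
    fix x y :: real assume "x \<le> y"
    then have "q * x \<le> q * y" using q by simp
    then have "Lo u (q * x) \<subseteq> Lo u (q * y)" by (auto simp: Lo_def)
    then show "G x \<le> G y" unfolding G by (intro P.finite_measure_mono) auto
  qed
  have "\<bar>r - 1\<bar> \<le> sqrt \<kappa> * \<Delta>"
  proof (rule ratio_near_one_if_cdf_near_half[OF monoG])
    show "\<kappa> > 0" "\<tau> \<le> (INF t\<in>{t. \<alpha> \<le> \<bar>t\<bar>}. \<bar>G 1 - G (1 + t)\<bar>)"
      "\<kappa> powr (- 1 / 2) \<le> (INF t\<in>{t. 0 < \<bar>t\<bar> \<and> \<bar>t\<bar> < \<alpha>}. \<bar>G 1 - G (1 + t)\<bar> / \<bar>t\<bar>)"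
      using mc uu unfolding marginal_condition_def Let_def G_def by blast+
    show "0 \<le> \<Delta>" "\<Delta> < \<tau>" using \<Delta>0 small by (auto simp: \<Delta>_def)
    show "G 1 - \<Delta> \<le> G r" using plo unfolding G qr[symmetric] G1[unfolded G] by simp
    fix t assume "t < r"
    then have "q * t < q * r" using q by simp
    then have "Lo u (q * t) \<subseteq> space P - Hi u (q * r)" by (auto simp: Lo_def Hi_def)
    then have "measure P (Lo u (q * t)) \<le> measure P (space P - Hi u (q * r))"
      by (intro P.finite_measure_mono) auto
    also have "\<dots> = 1 - measure P (Hi u (q * r))" by (rule P.prob_compl[OF sHi])
    finally show "G t \<le> G 1 + \<Delta>" using phi G1 unfolding G qr by simp
  qed
  then have "q * \<bar>r - 1\<bar> \<le> q * (sqrt \<kappa> * \<Delta>)" using q by (intro mult_left_mono) auto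
  also have "q * \<bar>r - 1\<bar> = \<bar>quad p \<Gamma>h u - q\<bar>"
  proof -
    have "quad p \<Gamma>h u - q = q * (r - 1)" using qr by (simp add: right_diff_distrib)
    then show ?thesis using q by (simp add: abs_mult)
  qed
  finally show ?thesis by (simp add: q_def \<Delta>_def)
qed

text \<open>
  All constants are fixed here. The slab deviation \<open>h = 334 * sqrt ((L + l) / n)\<close> is at most \<open>\<tau> / 4\<close> by the
  sample size condition, since \<open>1336 = 4 * 334\<close>. With \<open>\<epsilon> < \<tau> / 3 < 1 / 6\<close> the total error \<open>\<Delta>\<close>
  is then below \<open>6/5 * (\<tau> / 3 + \<tau> / 2) = \<tau>\<close>, as the marginal condition requires, and \<open>\<Delta>\<^sup>2\<close> is at most
  \<open>3 * \<epsilon>\<^sup>2 + 12 * h\<^sup>2\<close>.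
\<close>

lemma deepest_scatter_error_bound:
  assumes M: "0 < M" and \<tau>: "0 < \<tau>" "\<tau> < 1/2" and \<kappa>: "\<kappa> > 0" and \<epsilon>: "0 \<le> \<epsilon>" "\<epsilon> < \<tau> / 3"
    and \<delta>: "0 < \<delta>" "\<delta> \<le> 1" and s: "1 \<le> s" "2 * s \<le> p" and n: "1 \<le> n"
    and sample: "(1336 / \<tau>)\<^sup>2 * ((real s * ln (exp 1 * real p / real s) + ln (1 / \<delta>)) / real n) < 1"
    and \<Gamma>: "\<Gamma> \<in> bounded_scatter_class p s M" and can: "canonical_elliptical p P \<Gamma> \<eta>"
    and mc: "marginal_condition p P \<Gamma> \<tau> \<alpha> \<kappa>" and Q: "prob_space Q" "sets Q = sets (borel_vec p)"
  shows "\<exists>E\<in>sets (PiM {..<n} (\<lambda>_. contaminated \<epsilon> P Q)).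
    measure (PiM {..<n} (\<lambda>_. contaminated \<epsilon> P Q)) E \<ge> 1 - 2 * \<delta> \<and>
    (\<forall>X\<in>E. \<forall>\<Gamma>h. deepest_sparse_scatter p s n X \<Gamma>h \<longrightarrow>
       (op_norm p (\<lambda>i j. \<Gamma>h i j - \<Gamma> i j))\<^sup>2
         \<le> 1340000 * M\<^sup>2 * \<kappa> * (max (real s * ln (exp 1 * real p / real s) / real n) (\<epsilon>\<^sup>2)
                               + ln (1 / \<delta>) / real n))"
proof -
  define R where "R = contaminated \<epsilon> P Q"
  define L where "L = real s * ln (exp 1 * real p / real s)"
  define l where "l = ln (1 / \<delta>)"
  define h where "h = 334 * sqrt ((L + l) / real n)"
  define \<Delta> where "\<Delta> = (\<epsilon> + 2 * h) / (1 - \<epsilon>)"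
  have \<Gamma>s: "\<Gamma> \<in> scatter_class p s" and \<Gamma>M: "smax p \<Gamma> \<le> M"
    using \<Gamma> by (auto simp: bounded_scatter_class_def)
  have sm: "(1336 / \<tau>)\<^sup>2 * ((L + l) / real n) < 1" using sample by (simp only: L_def l_def)
  have P: "prob_space P" "sets P = sets (borel_vec p)"
    using can elliptical_prob_space unfolding canonical_elliptical_def by blast+
  have half: "\<forall>u\<in>unit_sphere p. proj_cdf p P \<Gamma> u 1 = 1 / 2"
    using can unfolding canonical_elliptical_def canonical_representation_of_def by blast
  have sQ: "sets Q = sets P" using P Q by simp
  have R: "prob_space R" unfolding R_def
    using \<epsilon> \<tau> by (intro prob_space_contaminated P Q sQ) auto
  have sR: "sets R = sets (borel_vec p)" by (simp add: R_def sets_contaminated P)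
  have l0: "l \<ge> 0" using \<delta> unfolding l_def by (intro ln_ge_zero) auto
  have L0: "L \<ge> 0"
  proof -
    have "exp (1::real) \<ge> 1" using exp_ge_add_one_self[of 1] by simp
    then have "1 * real s \<le> exp 1 * real p" using s by (intro mult_mono) auto
    then show ?thesis using s unfolding L_def by (intro mult_nonneg_nonneg ln_ge_zero) (auto simp: field_simps)
  qed
  have h0: "h \<ge> 0" using L0 l0 by (simp add: h_def)
  have h2: "h\<^sup>2 = 111556 * ((L + l) / real n)"
    using L0 l0 by (simp add: h_def power_mult_distrib)
  have "h\<^sup>2 \<le> (\<tau> / 4)\<^sup>2"
  proof -
    have "0 < (1336 / \<tau>)\<^sup>2" using \<tau> by simp
      then have "(L + l) / real n < 1 / (1336 / \<tau>)\<^sup>2"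
        using sm by (simp only: pos_less_divide_eq mult.commute)
      also have "1 / (1336 / \<tau>)\<^sup>2 = \<tau>\<^sup>2 / 1784896" using \<tau> by (simp add: power_divide)
      finally have "111556 * ((L + l) / real n) \<le> 111556 * (\<tau>\<^sup>2 / 1784896)"
      by (intro mult_left_mono) auto
    also have "\<dots> = (\<tau> / 4)\<^sup>2" by (simp add: power_divide)
    finally show ?thesis unfolding h2 .
  qed
  then have ht: "h \<le> \<tau> / 4" by (rule power2_le_imp_le) (use \<tau> in simp)
  have inv: "1 / (1 - \<epsilon>) \<le> 6/5" using \<epsilon> \<tau> by (simp add: field_simps)
  have \<Delta>0: "\<Delta> \<ge> 0" using \<epsilon> \<tau> h0 by (simp add: \<Delta>_def)
  have \<Delta>le: "\<Delta> \<le> (\<epsilon> + 2 * h) * (6/5)"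
  proof -
    have "\<Delta> = (\<epsilon> + 2 * h) * (1 / (1 - \<epsilon>))" by (simp add: \<Delta>_def)
    also have "\<dots> \<le> (\<epsilon> + 2 * h) * (6/5)" using inv \<epsilon> h0 by (intro mult_left_mono) auto
    finally show ?thesis .
  qed
  have \<Delta>\<tau>: "\<Delta> < \<tau>" using \<Delta>le ht \<epsilon> by (simp add: field_simps)
  have \<Delta>2: "\<Delta>\<^sup>2 \<le> 1340000 * (max (L / real n) (\<epsilon>\<^sup>2) + l / real n)"
  proof -
    have "\<Delta>\<^sup>2 \<le> ((\<epsilon> + 2 * h) * (6/5))\<^sup>2" using \<Delta>le \<Delta>0 by (rule power_mono)
    also have "\<dots> \<le> 3 * \<epsilon>\<^sup>2 + 12 * h\<^sup>2"
    proof -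
      have "((\<epsilon> + 2 * h) * (6/5))\<^sup>2 + (36/25) * (\<epsilon> - 2 * h)\<^sup>2 = (72/25) * \<epsilon>\<^sup>2 + (288/25) * h\<^sup>2"
        by (simp add: power2_eq_square field_simps)
      then show ?thesis
        using zero_le_power2[of "\<epsilon> - 2 * h"] zero_le_power2[of \<epsilon>] zero_le_power2[of h] by linarith
    qed
    also have "\<dots> = 3 * \<epsilon>\<^sup>2 + 1338672 * (L / real n) + 1338672 * (l / real n)"
      unfolding h2 by (simp add: add_divide_distrib)
    also have "\<dots> \<le> 3 * max (L / real n) (\<epsilon>\<^sup>2) + 1338672 * max (L / real n) (\<epsilon>\<^sup>2) + 1340000 * (l / real n)"
      using l0 by (intro add_mono mult_left_mono mult_right_mono) auto
    also have "\<dots> \<le> 1340000 * (max (L / real n) (\<epsilon>\<^sup>2) + l / real n)"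
    proof -
      have "max (L / real n) (\<epsilon>\<^sup>2) \<ge> 0" by (simp add: le_max_iff_disj)
      then show ?thesis by simp
    qed
    finally show ?thesis .
  qed
  obtain E where E: "E \<in> sets (PiM {..<n} (\<lambda>_. R))" "measure (PiM {..<n} (\<lambda>_. R)) E \<ge> 1 - 2 * \<delta>"
    "\<And>X u q. X \<in> E \<Longrightarrow> u \<in> sparse_directions p s \<Longrightarrow> q \<ge> 0 \<Longrightarrow>
       \<bar>(\<Sum>i<n. of_bool (\<bar>dot p u (X i)\<bar>\<^sup>2 \<le> q)) / real n - measure R {x\<in>space R. \<bar>dot p u x\<bar>\<^sup>2 \<le> q}\<bar> \<le> h"
    "\<And>X u q. X \<in> E \<Longrightarrow> u \<in> sparse_directions p s \<Longrightarrow> q \<ge> 0 \<Longrightarrow>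
       \<bar>(\<Sum>i<n. of_bool (\<bar>dot p u (X i)\<bar>\<^sup>2 \<ge> q)) / real n - measure R {x\<in>space R. \<bar>dot p u x\<bar>\<^sup>2 \<ge> q}\<bar> \<le> h"
    by (rule sparse_slabs_uniform_deviation[OF R sR s n \<delta>, folded L_def l_def, folded h_def]) (rule that)
  have bound: "(op_norm p (\<lambda>i j. \<Gamma>h i j - \<Gamma> i j))\<^sup>2 \<le> 1340000 * M\<^sup>2 * \<kappa> * (max (L / real n) (\<epsilon>\<^sup>2) + l / real n)"
    if X: "X \<in> E" and deep: "deepest_sparse_scatter p s n X \<Gamma>h" for X \<Gamma>h
  proof -
    have \<Gamma>h: "\<Gamma>h \<in> scatter_class p s"
      using deep by (simp add: deepest_sparse_scatter_def is_arg_max_def)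
    have dir: "\<bar>quad p \<Gamma>h u - quad p \<Gamma> u\<bar> \<le> M * (sqrt \<kappa> * \<Delta>)" if u: "u \<in> sparse_directions p s" for u
    proof -
      have "\<bar>quad p \<Gamma>h u - quad p \<Gamma> u\<bar> \<le> quad p \<Gamma> u * (sqrt \<kappa> * \<Delta>)"
        unfolding \<Delta>_def
        using \<epsilon> \<tau> E(3)[OF X, unfolded R_def] E(4)[OF X, unfolded R_def] \<Delta>\<tau>[unfolded \<Delta>_def] h0
        by (intro deepest_scatter_direction_bound[OF P Q(1) sQ _ _ s \<Gamma>s half mc deep _ _ _ _ u]) auto
      also have "\<dots> \<le> M * (sqrt \<kappa> * \<Delta>)"
      proof (rule mult_right_mono)
        have "psd p \<Gamma>" using \<Gamma>s by (simp add: scatter_class_def)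
        then have "quad p \<Gamma> u \<le> smax p \<Gamma>"
          using s by (intro quad_le_smax sparse_directions_unit[OF u]) auto
        then show "quad p \<Gamma> u \<le> M" using \<Gamma>M by simp
      qed (use \<Delta>0 \<kappa> in simp)
      finally show ?thesis .
    qed
    note op = op_norm_scatter_difference_le[OF \<Gamma>h \<Gamma>s s dir]
    have "(op_norm p (\<lambda>i j. \<Gamma>h i j - \<Gamma> i j))\<^sup>2 \<le> (M * (sqrt \<kappa> * \<Delta>))\<^sup>2"
      using op(2,1) by (rule power_mono)
    also have "\<dots> = M\<^sup>2 * \<kappa> * \<Delta>\<^sup>2" using \<kappa> by (simp add: power_mult_distrib)
    also have "\<dots> \<le> M\<^sup>2 * \<kappa> * (1340000 * (max (L / real n) (\<epsilon>\<^sup>2) + l / real n))"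
      using \<Delta>2 \<kappa> by (intro mult_left_mono) auto
    also have "\<dots> = 1340000 * M\<^sup>2 * \<kappa> * (max (L / real n) (\<epsilon>\<^sup>2) + l / real n)" by simp
    finally show ?thesis .
  qed
  show ?thesis
    unfolding R_def[symmetric] L_def[symmetric] l_def[symmetric] using E(1,2) bound by blast
qed

theorem theorem4p4:
  fixes M :: real
  assumes "M > 0"
  shows "\<exists>C>0. \<forall>\<tau>\<in>{0<..<1/2}. \<exists>C1>0.
    \<forall>(\<alpha>::real) (\<kappa>::real) (\<epsilon>::real) (\<delta>::real) (p::nat) (s::nat) (n::nat) P \<Gamma> \<eta> Q.
      \<alpha> > 0 \<and> \<kappa> > 0 \<and> 0 \<le> \<epsilon> \<and> \<epsilon> < \<tau> / 3 \<and> 0 < \<delta> \<and> \<delta> < 1 / 2 \<and>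
      1 \<le> s \<and> 2 * s \<le> p \<and> 1 \<le> n \<and>
      C1 * ((real s * ln (exp 1 * real p / real s) + ln (1 / \<delta>)) / real n) < 1 \<and>
      \<Gamma> \<in> bounded_scatter_class p s M \<and>
      canonical_elliptical p P \<Gamma> \<eta> \<and>
      marginal_condition p P \<Gamma> \<tau> \<alpha> \<kappa> \<and>
      prob_space Q \<and> sets Q = sets (borel_vec p)
      \<longrightarrow>
      (let joint = PiM {..<n} (\<lambda>_. contaminated \<epsilon> P Q) in
       \<exists>E\<in>sets joint. measure joint E \<ge> 1 - 2 * \<delta> \<and>
         (\<forall>X\<in>E. \<forall>\<Gamma>h. deepest_sparse_scatter p s n X \<Gamma>h \<longrightarrow>
            (op_norm p (\<lambda>i j. \<Gamma>h i j - \<Gamma> i j))\<^sup>2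
              \<le> C * \<kappa> * (max (real s * ln (exp 1 * real p / real s) / real n) (\<epsilon>\<^sup>2)
                          + ln (1 / \<delta>) / real n)))"
proof (rule exI[of _ "1340000 * M\<^sup>2"], intro conjI ballI, goal_cases)
  case 1
  then show ?case using assms by simp
next
  case (2 \<tau>)
  show ?case
  proof (rule exI[of _ "(1336 / \<tau>)\<^sup>2"], intro conjI allI impI, goal_cases)
    case 1
    then show ?case using 2 by simp
  next
    case (2 \<alpha> \<kappa> \<epsilon> \<delta> p s n P \<Gamma> \<eta> Q)
    then show ?case
      unfolding Let_def using assms \<open>\<tau> \<in> {0<..<1/2}\<close>
      by (intro deepest_scatter_error_bound) auto
  qed
qed

end
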